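(* Let $m\ge2$, $0<a<\infty$, $\mathcal{D}=\{(x,t):0\le x<\infty,\ 0\le t<a\}$, let $D=\operatorname{diag}\{d_1,\dots,d_m\}$ with $d_1>d_2>\dots>d_m>0$, and let $\widehat D>0$ be a diagonal $m\times m$ matrix. Let the $m\times m$ matrix function $\varrho(x,t)=\varrho(x,t)^*$ satisfy on $\mathcal{D}$ the nonlinear optics equation $$[D,\varrho_t]-[\widehat D,\varrho_x]=[D,\varrho][\widehat D,\varrho]-[\widehat D,\varrho][D,\varrho]$$ and the boundary condition $\varrho(0,t)=\widehat\rho(t)$. Assume that $\varrho$ is uniformly bounded and continuously differentiable on $\mathcal{D}$. Let $R(t,z)$ be defined by $$R_t(t,z)=(\mathrm{i}z\widehat D-[\widehat D,\widehat\rho(t)])R(t,z),\qquad R(0,z)=I_m,$$ and for $0\le t<a$ let $\varphi(t,z)=\{\varphi_{ij}(t,z)\}_{i,j=1}^m$ be the Weyl function of the system $y_x=(\mathrm{i}zD-[D,\varrho(x,t)])y$, $x\ge0$ (with $t$ fixed). Set $M_0=\sup_{(x,t)\in\mathcal{D}}\|[D,\varrho(x,t)]\|$ and let $M>\max_{1\le k<m}\bigl(2M_0/(d_k-d_{k+1})\bigr)$. Then for $\Im(z)<-M$, $0\le t<a$ and $1\le k<m$ the matrix functions $$\breve\psi_k(t,z):=\begin{bmatrix} I_k & 0 \end{bmatrix} R(t,z)\varphi(0,z)\begin{bmatrix} 0 \\ I_{m-k} \end{bmatrix}\left(\begin{bmatrix} 0 & I_{m-k} \end{bmatrix} R(t,z)\varphi(0,z)\begin{bmatrix}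 0 \\ I_{m-k} \end{bmatrix}\right)^{-1}$$ are well-defined, and the evolution of the Weyl function is given by the formula $$\{\varphi_{i,k+1}(t,z)\}_{i=1}^k=\breve\psi_k(t,z)\begin{bmatrix} 1 \\ 0 \\ \vdots \\ 0 \end{bmatrix},\qquad \Im(z)<-M,\quad 1\le k<m,$$ together with the normalization conditions $\varphi_{ij}(t,z)\equiv1$ for $i=j$ and $\varphi_{ij}(t,z)\equiv0$ for $i>j$.
   Context: Notation: $[A,B]=AB-BA$; $A^*$ is the conjugate transpose; $I_k$ is the $k\times k$ identity matrix; $\|\cdot\|$ is the matrix norm induced by the $l^2$ vector norm; derivatives on the boundary of $\mathcal{D}$ are one-sided; continuously differentiable means differentiable with continuous first derivatives. "Well-defined" means that the matrix being inverted is invertible. Weyl function: for bounded $\zeta(x)=-\zeta(x)^*$ on $[0,\infty)$, let $w(x,z)$ be the normalized fundamental solution of $w_x=(\mathrm{i}zD-\zeta(x))w$, $w(0,z)=I_m$. A Weyl function of the system $y_x=(\mathrm{i}zD-\zeta)y$ is an $m\times m$ matrix function $\varphi(z)$, analytic in a half-plane $\{z:\Im(z)<-M\}$ for some $M>0$, such that for some $r>0$ and all $z$ in this half-plane $$\int_0^\infty \exp\{\mathrm{i}\overline z xD\}\varphi(z)^*w(x,z)^*w(x,z)\varphi(z)\exp\{-(\mathrm{i}zD+rI_m)x\}\,dx<\infty,$$ and whose entries satisfy the normalization conditions $\varphi_{ij}(z)\equiv1$ for $i=j$ and $\varphi_{ij}(z)\equiv0$ for $i>j$. When $\|\zeta(x)\|\le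 M_0$ on $[0,\infty)$, the Weyl function exists, is unique, and may be taken analytic in $\{z:\Im(z)<-M\}$ for any $M>\max_{1\le k<m}(2M_0/(d_k-d_{k+1}))$. *)

theory Defs
  imports
    "HOL-Analysis.Analysis"
    "Jordan_Normal_Form.Gauss_Jordan_Elimination"
    "Jordan_Normal_Form.Schur_Decomposition"
begin

no_notation Finite_Cartesian_Product.vec.vec_nth (infixl \<open>$\<close> 90)

text \<open>
  Matrices are \<^typ>\<open>complex mat\<close>, so that the blocks of size \<open>k\<close> and \<open>m - k\<close> can
  be formed for all \<open>k\<close> at once.  Indices start at 0: the entry in row \<open>i\<close>, column \<open>j\<close> of the
  mathematical text is the entry \<open>(i - 1, j - 1)\<close> here, and \<open>d\<^sub>i\<close> is \<open>d (i - 1)\<close>.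
  Calculus on matrix functions is entrywise.
\<close>

definition commutator :: "complex mat \<Rightarrow> complex mat \<Rightarrow> complex mat" where
  "commutator A B = A * B - B * A"

definition real_diag :: "nat \<Rightarrow> (nat \<Rightarrow> real) \<Rightarrow> complex mat" where
  "real_diag m d = mat_diag m (\<lambda>i. complex_of_real (d i))"

definition l2_norm :: "complex Matrix.vec \<Rightarrow> real" where
  "l2_norm v = L2_set (\<lambda>i. cmod (v $ i)) {..<dim_vec v}"

definition mat_norm :: "complex mat \<Rightarrow> real" where
  "mat_norm A = (SUP v \<in> {v \<in> carrier_vec (dim_col A). l2_norm v \<le> 1}. l2_norm (A *\<^sub>v v))"

text \<open>The derivative is taken within \<open>S\<close>, hence it is one-sided at endpoints of an interval \<open>S\<close>.\<close>

definition mat_has_derivative ::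
    "nat \<Rightarrow> (real \<Rightarrow> complex mat) \<Rightarrow> complex mat \<Rightarrow> real \<Rightarrow> real set \<Rightarrow> bool" where
  "mat_has_derivative m F F' x S \<longleftrightarrow>
     (\<forall>y\<in>S. F y \<in> carrier_mat m m) \<and> F' \<in> carrier_mat m m \<and>
     (\<forall>i<m. \<forall>j<m. ((\<lambda>y. F y $$ (i, j)) has_vector_derivative F' $$ (i, j)) (at x within S))"

definition mat_continuous_on :: "nat \<Rightarrow> 'a::topological_space set \<Rightarrow> ('a \<Rightarrow> complex mat) \<Rightarrow> bool" where
  "mat_continuous_on m S F \<longleftrightarrow> (\<forall>i<m. \<forall>j<m. continuous_on S (\<lambda>p. F p $$ (i, j)))"

definition mat_holomorphic_on :: "nat \<Rightarrow> (complex \<Rightarrow> complex mat) \<Rightarrow> complex set \<Rightarrow> bool" where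
  "mat_holomorphic_on m F S \<longleftrightarrow>
     (\<forall>z\<in>S. F z \<in> carrier_mat m m) \<and> (\<forall>i<m. \<forall>j<m. (\<lambda>z. F z $$ (i, j)) holomorphic_on S)"

definition strip :: "real \<Rightarrow> (real \<times> real) set" where
  "strip a = {0..} \<times> {0..<a}"

text \<open>
  \<open>F\<close> is continuously differentiable on the strip, with partial derivatives \<open>Fx\<close> and \<open>Ft\<close>;
  joint continuity of the partial derivatives makes \<open>F\<close> (totally) differentiable.
\<close>

definition C1_on_strip ::
    "nat \<Rightarrow> real \<Rightarrow> (real \<Rightarrow> real \<Rightarrow> complex mat) \<Rightarrow>
     (real \<Rightarrow> real \<Rightarrow> complex mat) \<Rightarrow> (real \<Rightarrow> real \<Rightarrow> complex mat) \<Rightarrow> bool" where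
  "C1_on_strip m a F Fx Ft \<longleftrightarrow>
     (\<forall>(x, t) \<in> strip a.
        mat_has_derivative m (\<lambda>y. F y t) (Fx x t) x {0..} \<and>
        mat_has_derivative m (\<lambda>s. F x s) (Ft x t) t {0..<a}) \<and>
     mat_continuous_on m (strip a) (\<lambda>(x, t). Fx x t) \<and>
     mat_continuous_on m (strip a) (\<lambda>(x, t). Ft x t)"

definition lower_half_plane :: "real \<Rightarrow> complex set" where
  "lower_half_plane M = {z. Im z < - M}"

text \<open>
  The equation is required at every \<open>x \<ge> 0\<close>, which is the appropriate notion for continuous
  \<open>\<zeta>\<close>.
\<close>

definition normalized_fundamental_solution ::
    "nat \<Rightarrow> (nat \<Rightarrow> real) \<Rightarrow> (real \<Rightarrow> complex mat) \<Rightarrow> (real \<Rightarrow> complex \<Rightarrow> complex mat) \<Rightarrow> bool" where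
  "normalized_fundamental_solution m d \<zeta> w \<longleftrightarrow>
     (\<forall>z. w 0 z = 1\<^sub>m m \<and>
        (\<forall>x\<ge>0. mat_has_derivative m (\<lambda>y. w y z)
           (((\<i> * z) \<cdot>\<^sub>m real_diag m d - \<zeta> x) * w x z) x {0..}))"

text \<open>
  The exponentials of the diagonal matrices \<open>\<i> (cnj z) x D\<close> and \<open>- (\<i> z D + r I) x\<close>
  are written out.
\<close>

definition weyl_integrand ::
    "nat \<Rightarrow> (nat \<Rightarrow> real) \<Rightarrow> (real \<Rightarrow> complex \<Rightarrow> complex mat) \<Rightarrow> (complex \<Rightarrow> complex mat) \<Rightarrow>
     real \<Rightarrow> complex \<Rightarrow> real \<Rightarrow> complex mat" where
  "weyl_integrand m d w \<phi> r z x =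
     mat_diag m (\<lambda>j. exp (\<i> * cnj z * of_real x * of_real (d j))) *
     mat_adjoint (\<phi> z) * mat_adjoint (w x z) * w x z * \<phi> z *
     mat_diag m (\<lambda>j. exp (- (\<i> * z * of_real (d j) + of_real r) * of_real x))"

definition normalized_upper_triangular :: "nat \<Rightarrow> complex mat \<Rightarrow> bool" where
  "normalized_upper_triangular m A \<longleftrightarrow>
     (\<forall>i<m. \<forall>j<m. (i = j \<longrightarrow> A $$ (i, j) = 1) \<and> (i > j \<longrightarrow> A $$ (i, j) = 0))"

text \<open>
  The integrand is positive semidefinite, so finiteness of its improper integral amounts to
  absolute integrability of all entries.  The half-plane on which \<open>\<phi>\<close> is a Weyl function is
  existentially quantified.
\<close>

definition weyl_function ::
    "nat \<Rightarrow> (nat \<Rightarrow> real) \<Rightarrow> (real \<Rightarrow> complex mat) \<Rightarrow> (complex \<Rightarrow> complex mat) \<Rightarrow> bool" where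
  "weyl_function m d \<zeta> \<phi> \<longleftrightarrow>
     (\<exists>w. normalized_fundamental_solution m d \<zeta> w \<and>
       (\<exists>M>0. mat_holomorphic_on m \<phi> (lower_half_plane M) \<and>
         (\<exists>r>0. \<forall>z\<in>lower_half_plane M. \<forall>i<m. \<forall>j<m.
            (\<lambda>x. weyl_integrand m d w \<phi> r z x $$ (i, j)) absolutely_integrable_on {0..}) \<and>
         (\<forall>z\<in>lower_half_plane M. normalized_upper_triangular m (\<phi> z))))"

text \<open>The block matrices \<open>[I\<^sub>k 0]\<close> and \<open>[0 I\<^sub>m\<^sub>-\<^sub>k]\<close> with \<open>m\<close> columns.\<close>

definition top_rows :: "nat \<Rightarrow> nat \<Rightarrow> complex mat" where
  "top_rows m k = Matrix.mat k m (\<lambda>(i, j). if j = i then 1 else 0)"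

definition bottom_rows :: "nat \<Rightarrow> nat \<Rightarrow> complex mat" where
  "bottom_rows m k = Matrix.mat (m - k) m (\<lambda>(i, j). if j = k + i then 1 else 0)"

definition psi_denominator :: "nat \<Rightarrow> nat \<Rightarrow> complex mat \<Rightarrow> complex mat \<Rightarrow> complex mat" where
  "psi_denominator m k R \<phi> = bottom_rows m k * R * \<phi> * (bottom_rows m k)\<^sup>T"

text \<open>
  The value is meaningful only if \<^term>\<open>psi_denominator m k R \<phi>\<close> is invertible;
  \<^const>\<open>mat_inverse\<close> is \<^const>\<open>None\<close> otherwise.
\<close>

definition psi_breve :: "nat \<Rightarrow> nat \<Rightarrow> complex mat \<Rightarrow> complex mat \<Rightarrow> complex mat" where
  "psi_breve m k R \<phi> =
     top_rows m k * R * \<phi> * (bottom_rows m k)\<^sup>T * the (mat_inverse (psi_denominator m k R \<phi>))"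

end

theory Submission
  imports Defs "HOL-Complex_Analysis.Complex_Analysis"
begin

text \<open>
  Fix \<open>k\<close> and \<open>z\<close>, put \<open>\<eta> = - Im z\<close>, and split \<open>y = (u, v)\<close> into its first \<open>k\<close> and its
  last \<open>m - k\<close> coordinates.  The gap condition on \<open>M\<close> makes \<open>e\<^sup>-\<^sup>2\<^sup>c\<^sup>x(|u|\<^sup>2 - |v|\<^sup>2)\<close>, with
  \<open>2 c = \<eta> (d\<^sub>k + d\<^sub>k\<^sub>+\<^sub>1)\<close>, strictly increasing along nonzero solutions.  Hence the initial values
  of the solutions that are \<open>O(e\<^sup>c\<^sup>x)\<close> form a subspace inside the cone \<open>|u| < |v|\<close>, which therefore
  is determined by its \<open>v\<close>-components.  The last \<open>m - k\<close> columns of the Weyl function lie in this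
  subspace: for large \<open>\<eta>\<close> by the integrability condition, and on the whole half-plane because they
  are locally uniform limits (Vitali) of the solutions whose \<open>u\<close>-part vanishes at \<open>x = n\<close>.
  The zero curvature equation shows that \<open>R(t, z)\<close> maps the subspace at time \<open>0\<close> into the one
  at time \<open>t\<close>, so the columns of \<open>R(t, z) \<phi>(0, z)\<close> and of \<open>\<phi>(t, z)\<close> only have to be matched in
  their \<open>v\<close>-components.
\<close>

text \<open>The exponent \<open>2 c\<close> is the midpoint of the two nearest diagonal rates. After
  subtracting it, the diagonal part of the system contributes at least
  \<open>eta (d (k - 1) - d k) |y|^2\<close> to the derivative of the form, with the same margin in
  both blocks. The skew-Hermitian potential drops out of the derivative of \<open>|y|^2\<close>, but
  not out of that of \<open>|u|^2 - |v|^2\<close>, where it can cost \<open>2 M0 |y|^2\<close>; this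
  is the origin of the bound for \<open>M\<close>. The obstacle is that the integrability condition
  is available only on an unspecified half-plane and with an unspecified \<open>r\<close>. The
  latter raises the exponent of a Weyl column by \<open>r\<close>, which stays below
  \<open>2 c\<close> only for large \<open>eta\<close>. A growth bound is no analytic condition and
  cannot be continued in \<open>z\<close> by the identity theorem; convergence of the truncated
  solutions can. Transport in \<open>t\<close> preserves growth classes because, again by skewness,
  it changes \<open>|y|^2\<close> by a factor bounded uniformly in \<open>x\<close>. Invertibility
  of the denominators is the same uniqueness statement, applied to combinations of columns with
  vanishing \<open>v\<close>-part.\<close>

section \<open>Linear systems in coordinates\<close>

text \<open>Vectors and matrices are plain index functions, so entrywise calculus runs without
  carrier conditions. Values at indices from \<open>m\<close> on are junk, which is why most
  statements restrict to \<open>i < m\<close>.\<close>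

definition sqn :: "nat \<Rightarrow> (nat \<Rightarrow> complex) \<Rightarrow> real" where
  "sqn m v = (\<Sum>i<m. (cmod (v i))\<^sup>2)"

definition mv :: "nat \<Rightarrow> (nat \<Rightarrow> nat \<Rightarrow> complex) \<Rightarrow> (nat \<Rightarrow> complex) \<Rightarrow> nat \<Rightarrow> complex" where
  "mv m A v i = (\<Sum>j<m. A i j * v j)"

definition mm :: "nat \<Rightarrow> (nat \<Rightarrow> nat \<Rightarrow> complex) \<Rightarrow> (nat \<Rightarrow> nat \<Rightarrow> complex) \<Rightarrow> nat \<Rightarrow> nat \<Rightarrow> complex" where
  "mm m A B i j = (\<Sum>l<m. A i l * B l j)"

lemma sqn_nonneg [simp]: "0 \<le> sqn m v"
  by (simp add: sqn_def sum_nonneg)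

lemma sqn_eq_0_iff: "sqn m v = 0 \<longleftrightarrow> (\<forall>i<m. v i = 0)"
  by (auto simp: sqn_def sum_nonneg_eq_0_iff)

lemma cmod_le_sqrt_sqn:
  assumes "i < m" shows "cmod (v i) \<le> sqrt (sqn m v)"
proof (rule real_le_rsqrt)
  show "(cmod (v i))\<^sup>2 \<le> sqn m v"
    unfolding sqn_def using assms by (intro member_le_sum) auto
qed

section \<open>Mean value, energy and Gronwall estimates\<close>

lemma mvt_within:
  fixes f f' :: "real \<Rightarrow> real"
  assumes "\<And>x. x \<in> S \<Longrightarrow> (f has_real_derivative f' x) (at x within S)"
    and "a < b" and "{a..b} \<subseteq> S"
  obtains \<xi> where "a < \<xi>" "\<xi> < b" "f b - f a = (b - a) * f' \<xi>"
proof -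
  have "\<exists>x\<in>{a<..<b}. f b - f a = (\<lambda>h. f' x * h) (b - a)"
  proof (rule mvt_simple[OF assms(2)])
    fix x assume "a \<le> x" "x \<le> b"
    then have "(f has_real_derivative f' x) (at x within {a..b})"
      using assms by (meson DERIV_subset atLeastAtMost_iff subsetD)
    then show "(f has_derivative (\<lambda>h. f' x * h)) (at x within {a..b})"
      by (simp add: has_field_derivative_def)
  qed
  then show thesis using that by (auto simp: mult.commute)
qed

lemma antimono_within:
  fixes f f' :: "real \<Rightarrow> real"
  assumes "\<And>x. x \<in> S \<Longrightarrow> (f has_real_derivative f' x) (at x within S)"
    and "\<And>x. x \<in> S \<Longrightarrow> f' x \<le> 0" and "a \<le> b" and "{a..b} \<subseteq> S"
  shows "f b \<le> f a"
proof (cases "a = b")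
  case False
  then have "a < b" using assms by simp
  then obtain \<xi> where "a < \<xi>" "\<xi> < b" "f b - f a = (b - a) * f' \<xi>"
    using mvt_within assms(1,4) by blast
  moreover have "f' \<xi> \<le> 0" using assms(2)[of \<xi>] subsetD[OF assms(4), of \<xi>] calculation by simp
  ultimately show ?thesis using \<open>a < b\<close>
    by (smt (verit) mult_nonneg_nonpos)
qed simp

text \<open>The weights are free because two forms are needed: constant weight 1 gives the squared
  norm, signs +1 and -1 give the indefinite form of the cone.\<close>

lemma weighted_square_has_derivative:
  assumes "\<And>i. i < m \<Longrightarrow> ((\<lambda>x. y x i) has_vector_derivative D i) (at x within S)"
  shows "((\<lambda>x. \<Sum>i<m. s i * (cmod (y x i))\<^sup>2) has_real_derivative
           (\<Sum>i<m. s i * (2 * Re (cnj (y x i) * D i)))) (at x within S)"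
proof (intro DERIV_sum DERIV_cmult)
  fix i assume "i \<in> {..<m}"
  then have i: "((\<lambda>x. y x i) has_vector_derivative D i) (at x within S)" using assms by simp
  have re: "((\<lambda>x. Re (y x i)) has_real_derivative Re (D i)) (at x within S)"
    using bounded_linear.has_vector_derivative[OF bounded_linear_Re i]
    by (simp add: has_real_derivative_iff_has_vector_derivative)
  have im: "((\<lambda>x. Im (y x i)) has_real_derivative Im (D i)) (at x within S)"
    using bounded_linear.has_vector_derivative[OF bounded_linear_Im i]
    by (simp add: has_real_derivative_iff_has_vector_derivative)
  have "((\<lambda>x. (Re (y x i))\<^sup>2 + (Im (y x i))\<^sup>2) has_real_derivative
          2 * Re (cnj (y x i) * D i)) (at x within S)"
    by (rule derivative_eq_intros re im refl)+ (simp add: algebra_simps)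
  then show "((\<lambda>x. (cmod (y x i))\<^sup>2) has_real_derivative 2 * Re (cnj (y x i) * D i)) (at x within S)"
    by (simp add: cmod_power2)
qed

text \<open>The squared norm \<open>N\<close> satisfies \<open>N' <= K N + m eps^2\<close>, and an
  integrating factor finishes. Working with the square keeps everything differentiable at zeros of
  \<open>q\<close>.\<close>

lemma gronwall:
  assumes der: "\<And>x i. x \<in> {0..X} \<Longrightarrow> i < m \<Longrightarrow>
      ((\<lambda>x. q x i) has_vector_derivative mv m (A x) (q x) i + e x i) (at x within {0..X})"
    and A: "\<And>x i j. x \<in> {0..X} \<Longrightarrow> i < m \<Longrightarrow> j < m \<Longrightarrow> cmod (A x i j) \<le> B"
    and e: "\<And>x i. x \<in> {0..X} \<Longrightarrow> i < m \<Longrightarrow> cmod (e x i) \<le> \<epsilon>"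
    and "0 \<le> B" and x: "x \<in> {0..X}"
  shows "sqn m (q x) \<le> (sqn m (q 0) + m * \<epsilon>\<^sup>2 * x) * exp ((2 * real m * B + 1) * x)"
proof -
  \<comment> \<open>\<open>2 m B\<close> collects the coupling terms, each split by
    \<open>2 a b <= a^2 + b^2\<close>; the extra 1 absorbs the forcing term
    \<open>2 |q i| eps\<close>.\<close>
  define K where "K = 2 * real m * B + 1"
  have "0 \<le> K" using \<open>0 \<le> B\<close> by (simp add: K_def)
  define N' where "N' x = (\<Sum>i<m. 1 * (2 * Re (cnj (q x i) * (mv m (A x) (q x) i + e x i))))" for x
  have N: "((\<lambda>x. sqn m (q x)) has_real_derivative N' x) (at x within {0..X})" if "x \<in> {0..X}" for x
    using weighted_square_has_derivative[of m q "\<lambda>i. mv m (A x) (q x) i + e x i" x "{0..X}" "\<lambda>_. 1"] der that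
    by (simp add: sqn_def N'_def)
  have N'le: "N' x \<le> K * sqn m (q x) + m * \<epsilon>\<^sup>2" if x: "x \<in> {0..X}" for x
  proof -
    have "2 * Re (cnj (q x i) * (mv m (A x) (q x) i + e x i)) \<le>
        (\<Sum>j<m. B * ((cmod (q x i))\<^sup>2 + (cmod (q x j))\<^sup>2)) + (cmod (q x i))\<^sup>2 + \<epsilon>\<^sup>2" if i: "i < m" for i
    proof -
      have 1: "Re (cnj (q x i) * e x i) \<le> cmod (q x i) * \<epsilon>"
        using complex_Re_le_cmod[of "cnj (q x i) * e x i"] mult_left_mono[OF e[OF x i], of "cmod (q x i)"]
        by (simp add: norm_mult)
      have 2: "2 * (cmod (q x i) * \<epsilon>) \<le> (cmod (q x i))\<^sup>2 + \<epsilon>\<^sup>2"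
        using sum_squares_bound[of "cmod (q x i)" \<epsilon>] by simp
      have 3: "2 * Re (cnj (q x i) * (A x i j * q x j)) \<le> B * ((cmod (q x i))\<^sup>2 + (cmod (q x j))\<^sup>2)"
        if j: "j < m" for j
      proof -
        have "Re (cnj (q x i) * (A x i j * q x j)) \<le> cmod (A x i j) * (cmod (q x i) * cmod (q x j))"
          using complex_Re_le_cmod[of "cnj (q x i) * (A x i j * q x j)"] by (simp add: norm_mult mult_ac)
        also have "\<dots> \<le> B * (cmod (q x i) * cmod (q x j))"
          by (intro mult_right_mono A x i j) auto
        finally have "2 * Re (cnj (q x i) * (A x i j * q x j)) \<le> B * (2 * (cmod (q x i) * cmod (q x j)))" by simp
        also have "\<dots> \<le> B * ((cmod (q x i))\<^sup>2 + (cmod (q x j))\<^sup>2)"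
          using sum_squares_bound[of "cmod (q x i)" "cmod (q x j)"] \<open>0 \<le> B\<close>
          by (intro mult_left_mono) (auto simp: mult_ac)
        finally show ?thesis .
      qed
      have "2 * Re (cnj (q x i) * mv m (A x) (q x) i) = (\<Sum>j<m. 2 * Re (cnj (q x i) * (A x i j * q x j)))"
        by (simp add: mv_def sum_distrib_left del: times_complex.sel)
      also have "\<dots> \<le> (\<Sum>j<m. B * ((cmod (q x i))\<^sup>2 + (cmod (q x j))\<^sup>2))"
        by (intro sum_mono 3) auto
      finally show ?thesis using 1 2 by (simp add: distrib_left del: times_complex.sel)
    qed
    then have "N' x \<le> (\<Sum>i<m. (\<Sum>j<m. B * ((cmod (q x i))\<^sup>2 + (cmod (q x j))\<^sup>2)) + (cmod (q x i))\<^sup>2 + \<epsilon>\<^sup>2)"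
      unfolding N'_def by (intro sum_mono) (simp del: times_complex.sel)
    also have "\<dots> = K * sqn m (q x) + m * \<epsilon>\<^sup>2"
      by (simp add: sqn_def sum.distrib K_def algebra_simps sum_distrib_left[symmetric] sum_distrib_right[symmetric])
    finally show ?thesis .
  qed
  \<comment> \<open>Since \<open>exp (- K x) <= 1\<close>, the forcing adds at most
    \<open>m eps^2\<close> to the derivative of the first summand; the subtracted linear term
    compensates it and makes \<open>h\<close> nonincreasing.\<close>
  define h where "h x = exp (- K * x) * sqn m (q x) - m * \<epsilon>\<^sup>2 * x" for x
  have "h x \<le> h 0"
  proof (rule antimono_within[of "{0..X}" h "\<lambda>x. exp (- K * x) * (N' x - K * sqn m (q x)) - m * \<epsilon>\<^sup>2"])
    show "(h has_real_derivative (exp (- K * x) * (N' x - K * sqn m (q x)) - m * \<epsilon>\<^sup>2)) (at x within {0..X})"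
      if "x \<in> {0..X}" for x
    proof -
      have "((\<lambda>x. exp (- K * x)) has_real_derivative - K * exp (- K * x)) (at x within {0..X})"
        by (auto intro!: derivative_eq_intros)
      from DERIV_diff[OF DERIV_mult[OF this N[OF that]] DERIV_cmult_Id[of "real m * \<epsilon>\<^sup>2"]]
      show ?thesis by (simp add: h_def[abs_def] algebra_simps)
    qed
    show "exp (- K * x) * (N' x - K * sqn m (q x)) - m * \<epsilon>\<^sup>2 \<le> 0" if "x \<in> {0..X}" for x
    proof -
      have "exp (- K * x) * (N' x - K * sqn m (q x)) \<le> exp (- K * x) * (m * \<epsilon>\<^sup>2)"
        using N'le[OF that] by (intro mult_left_mono) auto
      also have "\<dots> \<le> 1 * (m * \<epsilon>\<^sup>2)"
        using that \<open>0 \<le> K\<close> by (intro mult_right_mono) auto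
      finally show ?thesis by simp
    qed
  qed (use x in auto)
  then have "exp (- K * x) * sqn m (q x) \<le> sqn m (q 0) + m * \<epsilon>\<^sup>2 * x" by (simp add: h_def)
  then have "exp (K * x) * (exp (- K * x) * sqn m (q x)) \<le> exp (K * x) * (sqn m (q 0) + m * \<epsilon>\<^sup>2 * x)"
    by (intro mult_left_mono) auto
  moreover have "exp (K * x) * (exp (- K * x) * sqn m (q x)) = sqn m (q x)"
    by (simp add: exp_minus)
  ultimately have "sqn m (q x) \<le> exp (K * x) * (sqn m (q 0) + m * \<epsilon>\<^sup>2 * x)" by linarith
  then show ?thesis unfolding K_def[symmetric] by (simp only: mult.commute)
qed

text \<open>With zero initial data the bound is linear in the forcing, with a factor that depends
  only on \<open>m\<close>, \<open>X\<close> and \<open>B\<close>. This linearity makes the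
  difference quotients below converge.\<close>

lemma gronwall_from_zero:
  assumes der: "\<And>x i. x \<in> {0..X} \<Longrightarrow> i < m \<Longrightarrow>
      ((\<lambda>x. q x i) has_vector_derivative mv m (A x) (q x) i + e x i) (at x within {0..X})"
    and A: "\<And>x i j. x \<in> {0..X} \<Longrightarrow> i < m \<Longrightarrow> j < m \<Longrightarrow> cmod (A x i j) \<le> B"
    and e: "\<And>x i. x \<in> {0..X} \<Longrightarrow> i < m \<Longrightarrow> cmod (e x i) \<le> \<epsilon>"
    and q0: "\<And>i. i < m \<Longrightarrow> q 0 i = 0"
    and "0 \<le> B" "0 \<le> \<epsilon>" and x: "x \<in> {0..X}" and "i < m"
  shows "cmod (q x i) \<le> \<epsilon> * sqrt (m * X * exp ((2 * real m * B + 1) * X))"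
proof -
  have "sqn m (q x) \<le> (m * \<epsilon>\<^sup>2 * x) * exp ((2 * real m * B + 1) * x)"
    using gronwall[OF der A e \<open>0 \<le> B\<close> x] q0 by (simp add: sqn_def)
  also have "\<dots> \<le> (m * \<epsilon>\<^sup>2 * X) * exp ((2 * real m * B + 1) * X)"
    using x \<open>0 \<le> B\<close> by (intro mult_mono mult_nonneg_nonneg) (auto intro!: mult_left_mono)
  also have "\<dots> = \<epsilon>\<^sup>2 * (m * X * exp ((2 * real m * B + 1) * X))" by (simp add: mult_ac)
  finally have "sqrt (sqn m (q x)) \<le> sqrt (\<epsilon>\<^sup>2 * (m * X * exp ((2 * real m * B + 1) * X)))"
    by (rule real_sqrt_le_mono)
  also have "\<dots> = \<epsilon> * sqrt (m * X * exp ((2 * real m * B + 1) * X))"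
    using \<open>0 \<le> \<epsilon>\<close> by (simp add: real_sqrt_mult)
  finally show ?thesis using cmod_le_sqrt_sqn[OF \<open>i < m\<close>, of "q x"] by linarith
qed

lemma cmod_mv_le:
  assumes "\<And>j. j < m \<Longrightarrow> cmod (A i j) \<le> a" "\<And>j. j < m \<Longrightarrow> cmod (v j) \<le> b" "0 \<le> a"
  shows "cmod (mv m A v i) \<le> m * a * b"
proof -
  have "cmod (mv m A v i) \<le> (\<Sum>j<m. a * b)"
    unfolding mv_def
    using assms by (intro order_trans[OF norm_sum] sum_mono) (auto simp: norm_mult intro!: mult_mono)
  then show ?thesis by simp
qed

text \<open>The candidate \<open>p\<close> solves the variational equation with zero initial data.
  The filter and the scalar \<open>h\<close> are arbitrary so that the lemma serves both the complex
  derivative in \<open>z\<close> and the one-sided real derivative in \<open>t\<close>. Gronwall is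
  used twice for differences: first for \<open>y - u = O(h)\<close>, then for the remainder
  \<open>(y - u) / h - p\<close>.\<close>

lemma linear_system_parameter_derivative:
  fixes y :: "'a \<Rightarrow> real \<Rightarrow> nat \<Rightarrow> complex" and h :: "'a \<Rightarrow> complex"
  assumes u: "\<And>x i. x \<in> {0..X} \<Longrightarrow> i < m \<Longrightarrow>
      ((\<lambda>x. u x i) has_vector_derivative mv m (L x) (u x) i) (at x within {0..X})"
    and p: "\<And>x i. x \<in> {0..X} \<Longrightarrow> i < m \<Longrightarrow>
      ((\<lambda>x. p x i) has_vector_derivative mv m (L x) (p x) i + mv m (L' x) (u x) i) (at x within {0..X})"
    and p_init: "\<And>i. i < m \<Longrightarrow> p 0 i = 0"
    and y: "\<forall>\<^sub>F \<tau> in F. h \<tau> \<noteq> 0 \<and> (\<forall>i<m. y \<tau> 0 i = u 0 i \<and> (\<forall>x\<in>{0..X}.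
      ((\<lambda>x. y \<tau> x i) has_vector_derivative mv m (A \<tau> x) (y \<tau> x) i) (at x within {0..X})))"
    and h: "(h \<longlongrightarrow> 0) F"
    and lim: "\<And>\<epsilon>. \<epsilon> > 0 \<Longrightarrow> \<forall>\<^sub>F \<tau> in F. \<forall>x\<in>{0..X}. \<forall>i<m. \<forall>j<m.
      cmod ((A \<tau> x i j - L x i j) / h \<tau> - L' x i j) \<le> \<epsilon>"
    and B: "\<And>x i j. x \<in> {0..X} \<Longrightarrow> i < m \<Longrightarrow> j < m \<Longrightarrow> cmod (L x i j) \<le> B"
      "\<And>x i j. x \<in> {0..X} \<Longrightarrow> i < m \<Longrightarrow> j < m \<Longrightarrow> cmod (L' x i j) \<le> B" "0 \<le> B"
    and x: "x \<in> {0..X}" and i: "i < m"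
  shows "((\<lambda>\<tau>. (y \<tau> x i - u x i) / h \<tau>) \<longlongrightarrow> p x i) F"
proof -
  \<comment> \<open>\<open>C\<close> bounds the perturbed solutions, \<open>G\<close> is the factor
    from \<open>gronwall_from_zero\<close>, \<open>C2\<close> is the Lipschitz constant of the
    solutions in \<open>h\<close>, and \<open>C3\<close> bounds the remainder per unit of error in
    the coefficients.\<close>
  define C where "C = sqrt (sqn m (u 0) * exp ((2 * real m * (2*B+1) + 1) * X))"
  define G where "G = sqrt (m * X * exp ((2 * real m * B + 1) * X))"
  define C2 where "C2 = m * (B+1) * C * G"
  define C3 where "C3 = (m * C + m * B * C2) * G"
  have X: "0 \<le> X" using x by simp
  have nn: "0 \<le> C" "0 \<le> G" "0 \<le> C2" "0 \<le> C3"
    using \<open>0 \<le> B\<close> X by (auto simp: C_def G_def C2_def C3_def)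
  have key: "cmod ((y \<tau> x i - u x i) / h \<tau> - p x i) \<le> \<epsilon> * C3"
    if eps: "0 < \<epsilon>" "\<epsilon> \<le> 1" and h\<tau>: "h \<tau> \<noteq> 0" "cmod (h \<tau>) \<le> \<epsilon>"
      and init: "\<And>i. i < m \<Longrightarrow> y \<tau> 0 i = u 0 i"
      and der: "\<And>x i. x \<in> {0..X} \<Longrightarrow> i < m \<Longrightarrow>
        ((\<lambda>x. y \<tau> x i) has_vector_derivative mv m (A \<tau> x) (y \<tau> x) i) (at x within {0..X})"
      and E: "\<And>x i j. x \<in> {0..X} \<Longrightarrow> i < m \<Longrightarrow> j < m \<Longrightarrow>
        cmod ((A \<tau> x i j - L x i j) / h \<tau> - L' x i j) \<le> \<epsilon>"
    for \<epsilon> \<tau>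
  proof -
    define E where "E x i j = (A \<tau> x i j - L x i j) / h \<tau> - L' x i j" for x i j
    have AE: "A \<tau> x i j = L x i j + h \<tau> * (E x i j + L' x i j)" for x i j
      using h\<tau>(1) by (simp add: E_def field_simps)
    have EL': "cmod (E x i j + L' x i j) \<le> B + 1" if "x \<in> {0..X}" "i < m" "j < m" for x i j
      using norm_triangle_ineq[of "E x i j" "L' x i j"] E[OF that] B(2)[OF that] eps
      unfolding E_def by linarith
    \<comment> \<open>Here \<open>|h| <= 1\<close>, so the perturbed coefficients stay within
      \<open>B + (B + 1)\<close>.\<close>
    have A\<tau>: "cmod (A \<tau> x i j) \<le> 2*B+1" if "x \<in> {0..X}" "i < m" "j < m" for x i j
    proof -
      have "cmod (h \<tau> * (E x i j + L' x i j)) \<le> 1 * (B + 1)"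
        unfolding norm_mult using EL'[OF that] h\<tau> eps by (intro mult_mono) auto
      then show ?thesis
        using norm_triangle_ineq[of "L x i j" "h \<tau> * (E x i j + L' x i j)"] B(1)[OF that] AE by simp
    qed
    have yC: "cmod (y \<tau> x i) \<le> C" if "x \<in> {0..X}" "i < m" for x i
    proof -
      have "sqn m (y \<tau> x) \<le> (sqn m (y \<tau> 0) + real m * 0\<^sup>2 * x) * exp ((2 * real m * (2*B+1) + 1) * x)"
        by (rule gronwall[where X = X and A = "A \<tau>" and e = "\<lambda>_ _. 0"])
          (use der A\<tau> \<open>0 \<le> B\<close> that in auto)
      also have "\<dots> \<le> sqn m (u 0) * exp ((2 * real m * (2*B+1) + 1) * X)"
        using init that \<open>0 \<le> B\<close> by (simp add: sqn_def sum_nonneg mult_left_mono)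
      finally show ?thesis
        using cmod_le_sqrt_sqn[OF that(2), of "y \<tau> x"] unfolding C_def
        by (meson order_trans real_sqrt_le_mono)
    qed
    have C2: "cmod (y \<tau> x i - u x i) \<le> cmod (h \<tau>) * C2" if "x \<in> {0..X}" "i < m" for x i
    proof -
      have "cmod (y \<tau> x i - u x i) \<le> (m * (cmod (h \<tau>) * (B+1)) * C) * sqrt (m * X * exp ((2 * real m * B + 1) * X))"
      proof (rule gronwall_from_zero[where A = L and q = "\<lambda>x i. y \<tau> x i - u x i"
            and e = "\<lambda>x i. mv m (\<lambda>i j. h \<tau> * (E x i j + L' x i j)) (y \<tau> x) i"])
        show "((\<lambda>x. y \<tau> x i - u x i) has_vector_derivative mv m (L x) (\<lambda>i. y \<tau> x i - u x i) i +
           mv m (\<lambda>i j. h \<tau> * (E x i j + L' x i j)) (y \<tau> x) i) (at x within {0..X})"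
          if "x \<in> {0..X}" "i < m" for x i
        proof -
          have "mv m (L x) (\<lambda>i. y \<tau> x i - u x i) i + mv m (\<lambda>i j. h \<tau> * (E x i j + L' x i j)) (y \<tau> x) i
              = mv m (A \<tau> x) (y \<tau> x) i - mv m (L x) (u x) i"
            unfolding mv_def sum_subtractf[symmetric] sum.distrib[symmetric]
            by (intro sum.cong refl) (simp add: AE algebra_simps)
          then show ?thesis using has_vector_derivative_diff[OF der[OF that] u[OF that]] by simp
        qed
        show "cmod (mv m (\<lambda>i j. h \<tau> * (E x i j + L' x i j)) (y \<tau> x) i) \<le> m * (cmod (h \<tau>) * (B+1)) * C"
          if "x \<in> {0..X}" "i < m" for x i
          using that EL' yC \<open>0 \<le> B\<close> by (intro cmod_mv_le) (auto simp: norm_mult intro!: mult_left_mono)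
      qed (use that B nn init in auto)
      then show ?thesis by (simp add: C2_def G_def mult_ac)
    qed
    \<comment> \<open>The remainder solves the unperturbed system with forcing
      \<open>E y + L' (y - u)\<close>. Both summands are small: the first by the hypothesis on the
      coefficients, the second by the bound \<open>C2\<close>.\<close>
    have "cmod ((y \<tau> x i - u x i) / h \<tau> - p x i) \<le> (m * \<epsilon> * C + m * B * (\<epsilon> * C2)) * sqrt (m * X * exp ((2 * real m * B + 1) * X))"
    proof (rule gronwall_from_zero[where A = L and q = "\<lambda>x i. (y \<tau> x i - u x i) / h \<tau> - p x i"
          and e = "\<lambda>x i. mv m (E x) (y \<tau> x) i + mv m (L' x) (\<lambda>i. y \<tau> x i - u x i) i"])
      show "((\<lambda>x. (y \<tau> x i - u x i) / h \<tau> - p x i) has_vector_derivative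
          mv m (L x) (\<lambda>i. (y \<tau> x i - u x i) / h \<tau> - p x i) i +
          (mv m (E x) (y \<tau> x) i + mv m (L' x) (\<lambda>i. y \<tau> x i - u x i) i)) (at x within {0..X})"
        if "x \<in> {0..X}" "i < m" for x i
      proof -
        have "((\<lambda>x. (y \<tau> x i - u x i) / h \<tau> - p x i) has_vector_derivative
           (mv m (A \<tau> x) (y \<tau> x) i - mv m (L x) (u x) i) / h \<tau> - (mv m (L x) (p x) i + mv m (L' x) (u x) i))
           (at x within {0..X})"
          by (rule derivative_intros der u p that)+
        moreover have "A \<tau> x i j * y \<tau> x j / h \<tau> - L x i j * u x j / h \<tau> - (L x i j * p x j + L' x i j * u x j)
           = L x i j * ((y \<tau> x j - u x j) / h \<tau> - p x j) + (E x i j * y \<tau> x j + L' x i j * (y \<tau> x j - u x j))" for j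
          using h\<tau>(1) by (simp add: AE field_simps)
        then have "(mv m (A \<tau> x) (y \<tau> x) i - mv m (L x) (u x) i) / h \<tau> - (mv m (L x) (p x) i + mv m (L' x) (u x) i)
          = mv m (L x) (\<lambda>i. (y \<tau> x i - u x i) / h \<tau> - p x i) i +
          (mv m (E x) (y \<tau> x) i + mv m (L' x) (\<lambda>i. y \<tau> x i - u x i) i)"
          unfolding mv_def diff_divide_distrib sum_divide_distrib sum_subtractf[symmetric] sum.distrib[symmetric]
          by simp
        ultimately show ?thesis by simp
      qed
      show "cmod (mv m (E x) (y \<tau> x) i + mv m (L' x) (\<lambda>i. y \<tau> x i - u x i) i) \<le> m * \<epsilon> * C + m * B * (\<epsilon> * C2)"
        if "x \<in> {0..X}" "i < m" for x i
      proof (rule norm_triangle_mono)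
        show "cmod (mv m (E x) (y \<tau> x) i) \<le> m * \<epsilon> * C"
          using that E yC eps by (intro cmod_mv_le) (auto simp: E_def)
        have "cmod (y \<tau> x i - u x i) \<le> \<epsilon> * C2" if "i < m" for i
          using C2[OF \<open>x \<in> {0..X}\<close> that] mult_right_mono[OF h\<tau>(2) nn(3)] by linarith
        then show "cmod (mv m (L' x) (\<lambda>i. y \<tau> x i - u x i) i) \<le> m * B * (\<epsilon> * C2)"
          using that B by (intro cmod_mv_le) auto
      qed
      show "0 \<le> m * \<epsilon> * C + m * B * (\<epsilon> * C2)" using nn eps B by simp
    qed (use B x i init p_init in auto)
    then show ?thesis by (simp add: C3_def G_def algebra_simps)
  qed
  show ?thesis
  proof (rule tendstoI)
    fix e :: real assume "0 < e"
    \<comment> \<open>The cap 1 is demanded by \<open>key\<close>; the summand 1 keeps the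
      denominator positive if \<open>C3 = 0\<close>, and the factor 2 makes the final inequality
      strict.\<close>
    define \<epsilon> where "\<epsilon> = min 1 (e / (2 * (C3 + 1)))"
    have eps: "0 < \<epsilon>" "\<epsilon> \<le> 1" using \<open>0 < e\<close> nn by (auto simp: \<epsilon>_def)
    have "\<epsilon> * C3 \<le> e / (2 * (C3 + 1)) * (C3 + 1)"
      using nn \<open>0 < e\<close> by (intro mult_mono) (auto simp: \<epsilon>_def)
    also have "\<dots> < e" using nn(4) \<open>0 < e\<close> by (simp add: divide_simps)
    finally have small: "\<epsilon> * C3 < e" .
    have "\<forall>\<^sub>F \<tau> in F. cmod (h \<tau>) < \<epsilon>" using tendstoD[OF h eps(1)] by simp
    with y lim[OF eps(1)] show "\<forall>\<^sub>F \<tau> in F. dist ((y \<tau> x i - u x i) / h \<tau>) (p x i) < e"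
    proof eventually_elim
      case (elim \<tau>)
      have "cmod ((y \<tau> x i - u x i) / h \<tau> - p x i) \<le> \<epsilon> * C3"
        by (rule key) (use elim eps in auto)
      then show ?case using small by (simp add: dist_norm)
    qed
  qed
qed

section \<open>Skew-Hermitian systems and the invariant cone\<close>

text \<open>One shape for both directions: the coefficient of the \<open>x\<close>-system with
  \<open>d\<close>, that of the \<open>t\<close>-system with \<open>h\<close>.\<close>

definition coef :: "(nat \<Rightarrow> real) \<Rightarrow> complex \<Rightarrow> (nat \<Rightarrow> nat \<Rightarrow> complex) \<Rightarrow> nat \<Rightarrow> nat \<Rightarrow> complex" where
  "coef d z P i j = (if i = j then \<i> * z * d i else 0) - P i j"

text \<open>Skew-Hermitian, not antisymmetric: this is what a commutator of a real diagonal matrix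
  with a Hermitian matrix satisfies.\<close>

definition skew :: "nat \<Rightarrow> (nat \<Rightarrow> nat \<Rightarrow> complex) \<Rightarrow> bool" where
  "skew m P \<longleftrightarrow> (\<forall>i<m. \<forall>j<m. P j i = - cnj (P i j))"

lemma skewD:
  assumes "skew m P" "i < m" "j < m" shows "cnj (P i j) = - P j i"
proof -
  have "P j i = - cnj (P i j)" using assms unfolding skew_def by blast
  then show ?thesis by simp
qed

lemma mv_mm: "mv m (mm m A B) v i = mv m A (mv m B v) i"
proof -
  have "mv m (mm m A B) v i = (\<Sum>j<m. \<Sum>l<m. A i l * B l j * v j)"
    by (simp add: mv_def mm_def sum_distrib_right)
  also have "\<dots> = (\<Sum>l<m. \<Sum>j<m. A i l * B l j * v j)" by (rule sum.swap)
  also have "\<dots> = mv m A (mv m B v) i"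
    by (simp add: mv_def sum_distrib_left mult.assoc)
  finally show ?thesis .
qed

lemma mv_cong: "(\<And>j. j < m \<Longrightarrow> u j = v j) \<Longrightarrow> mv m A u i = mv m A v i"
  by (simp add: mv_def)

lemma mv_diff: "mv m A (\<lambda>j. u j - v j) i = mv m A u i - mv m A v i"
  by (simp add: mv_def sum_subtractf right_diff_distrib)

lemma mv_coef: "i < m \<Longrightarrow> mv m (coef d z P) v i = \<i> * z * d i * v i - mv m P v i"
proof -
  assume "i < m"
  then have "(\<Sum>j<m. (if i = j then \<i> * z * d i else 0) * v j) = \<i> * z * d i * v i"
    by (subst sum.remove[of _ i]) (auto intro!: sum.neutral)
  then show ?thesis by (simp add: mv_def coef_def left_diff_distrib sum_subtractf)
qed

text \<open>The sesquilinear form of a skew-Hermitian matrix takes imaginary values on the diagonal.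
  Hence the potential contributes nothing to the growth of the squared norm, in \<open>x\<close> as
  well as in \<open>t\<close>.\<close>

lemma skew_energy:
  assumes "skew m P"
  shows "(\<Sum>i<m. Re (cnj (v i) * mv m P v i)) = 0"
proof -
  define S where "S = (\<Sum>i<m. \<Sum>j<m. cnj (v i) * P i j * v j)"
  have "cnj S = (\<Sum>i<m. \<Sum>j<m. v i * cnj (P i j) * cnj (v j))" by (simp add: S_def)
  also have "\<dots> = (\<Sum>i<m. \<Sum>j<m. - (cnj (v j) * P j i * v i))"
    by (intro sum.cong refl) (simp add: skewD[OF assms] mult_ac)
  also have "\<dots> = - (\<Sum>j<m. \<Sum>i<m. cnj (v j) * P j i * v i)"
    by (subst sum.swap) (simp add: sum_negf)
  finally have "cnj S = - S" by (simp add: S_def)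
  then have "Re S = 0" by (metis complex_cnj(1) complex_cnj_minus cnj.sel(1) uminus_complex.sel(1) equal_neg_zero)
  moreover have "S = (\<Sum>i<m. cnj (v i) * mv m P v i)"
    by (simp add: S_def mv_def sum_distrib_left mult.assoc)
  ultimately show ?thesis by (simp only: Re_sum)
qed

lemma diagonal_energy: "Re (cnj v * (\<i> * z * complex_of_real r * v)) = - Im z * r * (cmod v)\<^sup>2"
  unfolding cmod_power2 by (simp add: power2_eq_square algebra_simps)

text \<open>The factor 1 on the left lets this equation rewrite the instance of
  \<open>weighted_square_has_derivative\<close> with constant weight literally.\<close>

lemma energy_rate:
  assumes "skew m P"
  shows "(\<Sum>i<m. 1 * (2 * Re (cnj (v i) * mv m (coef d z P) v i))) = - 2 * Im z * (\<Sum>i<m. d i * (cmod (v i))\<^sup>2)"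
proof -
  have "(\<Sum>i<m. 1 * (2 * Re (cnj (v i) * mv m (coef d z P) v i))) =
    (\<Sum>i<m. 2 * (- Im z * d i * (cmod (v i))\<^sup>2) - 2 * Re (cnj (v i) * mv m P v i))"
    by (intro sum.cong refl)
      (simp add: mv_coef right_diff_distrib diagonal_energy del: times_complex.sel)
  also have "\<dots> = - 2 * Im z * (\<Sum>i<m. d i * (cmod (v i))\<^sup>2)"
    unfolding sum_subtractf sum_distrib_left[symmetric] skew_energy[OF assms]
    by (simp add: sum_distrib_left mult_ac sum_negf)
  finally show ?thesis .
qed

text \<open>\<open>Z_bound\<close> is the operator norm bound in sesquilinear form, because the cone
  estimate pairs \<open>Z y\<close> not with \<open>y\<close> but with \<open>y\<close> after a
  change of sign in the last coordinates.\<close>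

locale skew_system =
  fixes m :: nat and d :: "nat \<Rightarrow> real" and Z :: "real \<Rightarrow> nat \<Rightarrow> nat \<Rightarrow> complex"
    and W :: "real \<Rightarrow> complex \<Rightarrow> nat \<Rightarrow> nat \<Rightarrow> complex" and M0 :: real
  assumes d_pos: "\<And>i. i < m \<Longrightarrow> 0 < d i"
    and d_dec: "\<And>i j. i < j \<Longrightarrow> j < m \<Longrightarrow> d j < d i"
    and Z_skew: "\<And>x. 0 \<le> x \<Longrightarrow> skew m (Z x)"
    and Z_bound: "\<And>x a b. 0 \<le> x \<Longrightarrow>
      cmod (\<Sum>i<m. cnj (a i) * mv m (Z x) b i) \<le> M0 * sqrt (sqn m a) * sqrt (sqn m b)"
    and W_0: "\<And>z i j. i < m \<Longrightarrow> j < m \<Longrightarrow> W 0 z i j = (if i = j then 1 else 0)"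
    and W_deriv: "\<And>x z i j. 0 \<le> x \<Longrightarrow> i < m \<Longrightarrow> j < m \<Longrightarrow>
      ((\<lambda>x. W x z i j) has_vector_derivative mm m (coef d z (Z x)) (W x z) i j) (at x within {0..})"
begin

definition sol :: "complex \<Rightarrow> (nat \<Rightarrow> complex) \<Rightarrow> real \<Rightarrow> nat \<Rightarrow> complex" where
  "sol z v x = mv m (W x z) v"

lemma sol_0: "i < m \<Longrightarrow> sol z v 0 i = v i"
  by (simp add: sol_def mv_def W_0 sum.remove[of _ i])

lemma sol_deriv:
  assumes "0 \<le> x" "i < m"
  shows "((\<lambda>x. sol z v x i) has_vector_derivative mv m (coef d z (Z x)) (sol z v x) i) (at x within {0..})"
proof -
  have "((\<lambda>x. \<Sum>j<m. W x z i j * v j) has_vector_derivative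
      (\<Sum>j<m. mm m (coef d z (Z x)) (W x z) i j * v j)) (at x within {0..})"
    using assms by (intro has_vector_derivative_sum has_vector_derivative_mult_left W_deriv) auto
  then show ?thesis
    by (simp add: sol_def mv_mm[symmetric]) (simp add: mv_def)
qed

lemma sol_diff: "sol z (\<lambda>j. u j - v j) x i = sol z u x i - sol z v x i"
  by (simp add: sol_def mv_diff)

lemma d_antimono: "i \<le> j \<Longrightarrow> j < m \<Longrightarrow> d j \<le> d i"
  using d_dec[of i j] by (cases "i = j") auto

lemma sqn_sol_deriv:
  assumes "0 \<le> x"
  shows "((\<lambda>x. sqn m (sol z v x)) has_real_derivative - 2 * Im z * (\<Sum>i<m. d i * (cmod (sol z v x i))\<^sup>2))
    (at x within {0..})"
  using weighted_square_has_derivative[of m "sol z v" "\<lambda>i. mv m (coef d z (Z x)) (sol z v x) i" x "{0..}" "\<lambda>_. 1",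
      OF sol_deriv[OF assms], unfolded energy_rate[OF Z_skew[OF assms]]]
  by (simp add: sqn_def)

lemma sqn_sol_mono:
  assumes "Im z \<le> 0" "0 \<le> a" "a \<le> b"
  shows "sqn m (sol z v a) \<le> sqn m (sol z v b)"
proof -
  have "- sqn m (sol z v b) \<le> - sqn m (sol z v a)"
  proof (rule antimono_within[of "{0..}" "\<lambda>x. - sqn m (sol z v x)"
        "\<lambda>x. - (- 2 * Im z * (\<Sum>i<m. d i * (cmod (sol z v x i))\<^sup>2))"])
    fix x :: real assume x: "x \<in> {0..}"
    then show "((\<lambda>x. - sqn m (sol z v x)) has_real_derivative
      - (- 2 * Im z * (\<Sum>i<m. d i * (cmod (sol z v x i))\<^sup>2))) (at x within {0..})"
      using sqn_sol_deriv by (intro DERIV_minus) auto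
    have "0 \<le> - Im z * (\<Sum>i<m. d i * (cmod (sol z v x i))\<^sup>2)"
      using assms d_pos by (intro mult_nonneg_nonneg sum_nonneg) (auto simp: less_imp_le)
    then show "- (- 2 * Im z * (\<Sum>i<m. d i * (cmod (sol z v x i))\<^sup>2)) \<le> 0" by simp
  qed (use assms in auto)
  then show ?thesis by simp
qed

text \<open>\<open>rate z k\<close> is the exponent \<open>2 c\<close>; \<open>k\<close> counts coordinates, so that \<open>d (k - 1)\<close> and \<open>d k\<close> are the
  paper's \<open>d\<^sub>k\<close> and \<open>d\<^sub>k\<^sub>+\<^sub>1\<close>.\<close>

definition rate :: "complex \<Rightarrow> nat \<Rightarrow> real" where
  "rate z k = - Im z * (d (k - 1) + d k)"

definition cone_form :: "nat \<Rightarrow> (nat \<Rightarrow> complex) \<Rightarrow> real" where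
  "cone_form k y = (\<Sum>i<m. (if i < k then 1 else -1) * (cmod (y i))\<^sup>2)"

definition cone_sol :: "nat \<Rightarrow> complex \<Rightarrow> (nat \<Rightarrow> complex) \<Rightarrow> real \<Rightarrow> real" where
  "cone_sol k z v x = exp (- rate z k * x) * cone_form k (sol z v x)"

definition growth :: "nat \<Rightarrow> complex \<Rightarrow> (nat \<Rightarrow> complex) \<Rightarrow> real \<Rightarrow> real" where
  "growth k z v x = exp (- rate z k * x) * sqn m (sol z v x)"

definition subordinate :: "nat \<Rightarrow> complex \<Rightarrow> (nat \<Rightarrow> complex) \<Rightarrow> bool" where
  "subordinate k z v \<longleftrightarrow> (\<exists>C. \<forall>x\<ge>0. growth k z v x \<le> C)"

text \<open>The margin in the cone estimate: gain of the diagonal part minus the largest cost of the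
  potential. The bound on \<open>M\<close> makes it positive on the whole half-plane.\<close>

definition gap :: "nat \<Rightarrow> complex \<Rightarrow> real" where
  "gap k z = - Im z * (d (k - 1) - d k) - 2 * M0"

section \<open>Monotonicity of the cone form along solutions\<close>

lemma cone_form_le: "cone_form k y \<le> sqn m y"
  unfolding cone_form_def sqn_def by (intro sum_mono) auto

text \<open>The potential does not drop out here, since the signs in the form do not commute with
  \<open>Z x\<close>. \<open>Z_bound\<close> limits its share to \<open>2 * M0\<close> times the
  squared norm, and the diagonal part has to outweigh it.\<close>

lemma cone_sol_deriv:
  assumes "Im z \<le> 0" "1 \<le> k" "k < m" "0 \<le> x"
  obtains f' where "(cone_sol k z v has_real_derivative f') (at x within {0..})"
    "gap k z * growth k z v x \<le> f'"
proof -
  define s where "s i = (if i < k then 1 else -1 :: real)" for i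
  define y where "y = sol z v x"
  define Q where "Q = (\<Sum>i<m. s i * (2 * Re (cnj (y i) * mv m (coef d z (Z x)) y i)))"
  have dQ: "((\<lambda>x. cone_form k (sol z v x)) has_real_derivative Q) (at x within {0..})"
    using weighted_square_has_derivative[of m "sol z v" "\<lambda>i. mv m (coef d z (Z x)) (sol z v x) i" x "{0..}" s,
      OF sol_deriv[OF assms(4)]]
    by (simp add: cone_form_def s_def Q_def y_def)
  have de: "((\<lambda>x. exp (- rate z k * x)) has_real_derivative - rate z k * exp (- rate z k * x)) (at x within {0..})"
    by (auto intro!: derivative_eq_intros)
  have D: "(cone_sol k z v has_real_derivative exp (- rate z k * x) * (Q - rate z k * cone_form k y)) (at x within {0..})"
    using DERIV_mult[OF de dQ] by (simp add: cone_sol_def[abs_def] y_def algebra_simps)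
  have "Q = (\<Sum>i<m. s i * (2 * (- Im z * d i * (cmod (y i))\<^sup>2)) - 2 * Re (cnj (s i * y i) * mv m (Z x) y i))"
    unfolding Q_def
    by (intro sum.cong refl)
      (simp add: mv_coef right_diff_distrib diagonal_energy s_def del: times_complex.sel)
  also have "\<dots> = (\<Sum>i<m. s i * (2 * (- Im z * d i * (cmod (y i))\<^sup>2))) - 2 * Re (\<Sum>i<m. cnj (s i * y i) * mv m (Z x) y i)"
    by (simp add: sum_subtractf sum_distrib_left del: times_complex.sel)
  finally have Q: "Q = (\<Sum>i<m. s i * (2 * (- Im z * d i * (cmod (y i))\<^sup>2))) - 2 * Re (\<Sum>i<m. cnj (s i * y i) * mv m (Z x) y i)" .
  have "Re (\<Sum>i<m. cnj (s i * y i) * mv m (Z x) y i) \<le> M0 * sqrt (sqn m (\<lambda>i. s i * y i)) * sqrt (sqn m y)"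
    by (rule order_trans[OF complex_Re_le_cmod Z_bound[OF assms(4)]])
  also have "sqn m (\<lambda>i. s i * y i) = sqn m y"
    unfolding sqn_def by (intro sum.cong) (auto simp: s_def norm_mult)
  finally have Zle: "Re (\<Sum>i<m. cnj (s i * y i) * mv m (Z x) y i) \<le> M0 * sqn m y" by (simp add: mult.assoc)
  have termwise: "- Im z * (d (k - 1) - d k) * (cmod (y i))\<^sup>2 \<le>
      s i * (2 * (- Im z * d i * (cmod (y i))\<^sup>2)) - rate z k * (s i * (cmod (y i))\<^sup>2)" if i: "i < m" for i
  proof -
    \<comment> \<open>For \<open>i < k\<close> this says \<open>d i >= d (k - 1)\<close>, for
      \<open>i >= k\<close> it says \<open>d i <= d k\<close>; the midpoint in \<open>rate\<close>
      makes the two margins equal.\<close>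
    have "d (k - 1) - d k \<le> s i * (2 * d i - (d (k - 1) + d k))"
      using d_antimono[of i "k - 1"] d_antimono[of k i] assms i by (auto simp: s_def)
    then have "- Im z * (d (k - 1) - d k) * (cmod (y i))\<^sup>2 \<le> - Im z * (s i * (2 * d i - (d (k - 1) + d k))) * (cmod (y i))\<^sup>2"
      using assms(1) by (intro mult_right_mono mult_left_mono) auto
    then show ?thesis by (simp add: rate_def algebra_simps)
  qed
  have "- Im z * (d (k - 1) - d k) * sqn m y \<le> (\<Sum>i<m. s i * (2 * (- Im z * d i * (cmod (y i))\<^sup>2))) - rate z k * cone_form k y"
    unfolding sqn_def cone_form_def sum_distrib_left s_def[symmetric] sum_subtractf[symmetric]
    by (intro sum_mono termwise) simp
  then have "gap k z * sqn m y \<le> Q - rate z k * cone_form k y"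
    using Q Zle by (simp add: gap_def left_diff_distrib)
  then have "exp (- rate z k * x) * (gap k z * sqn m y) \<le> exp (- rate z k * x) * (Q - rate z k * cone_form k y)"
    by (intro mult_left_mono) auto
  then have "gap k z * growth k z v x \<le> exp (- rate z k * x) * (Q - rate z k * cone_form k y)"
    by (simp add: growth_def y_def mult_ac)
  with D show thesis by (rule that)
qed

lemma cone_sol_le_growth: "cone_sol k z v x \<le> growth k z v x"
  by (simp add: cone_sol_def growth_def cone_form_le)

text \<open>The mean value theorem turns the pointwise lower bound into a bound for increments
  without integrating the derivative.\<close>

lemma cone_sol_mvt:
  assumes "Im z \<le> 0" "1 \<le> k" "k < m" "0 \<le> a" "a < b"
  obtains \<xi> where "a < \<xi>" "\<xi> < b" "(b - a) * (gap k z * growth k z v \<xi>) \<le> cone_sol k z v b - cone_sol k z v a"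
proof -
  obtain f' where f': "\<And>x. x \<in> {0..} \<Longrightarrow> (cone_sol k z v has_real_derivative f' x) (at x within {0..})"
    "\<And>x. x \<in> {0..} \<Longrightarrow> gap k z * growth k z v x \<le> f' x"
  proof -
    have "\<exists>f'. (cone_sol k z v has_real_derivative f') (at x within {0..}) \<and> gap k z * growth k z v x \<le> f'"
      if "x \<in> {0..}" for x
      using cone_sol_deriv[OF assms(1-3), of x v] that by (metis atLeast_iff)
    then show thesis using that by metis
  qed
  obtain \<xi> where \<xi>: "a < \<xi>" "\<xi> < b" "cone_sol k z v b - cone_sol k z v a = (b - a) * f' \<xi>"
    using mvt_within[OF f'(1) assms(5)] assms(4) by auto
  have "(b - a) * (gap k z * growth k z v \<xi>) \<le> (b - a) * f' \<xi>"
    using f'(2) \<xi> assms by (intro mult_left_mono) auto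
  then show thesis using that \<xi> by simp
qed

lemma growth_nonneg [simp]: "0 \<le> growth k z v x"
  by (simp add: growth_def)

lemma cone_sol_mono:
  assumes "Im z \<le> 0" "1 \<le> k" "k < m" "0 < gap k z" "0 \<le> a" "a \<le> b"
  shows "cone_sol k z v a \<le> cone_sol k z v b"
proof (cases "a = b")
  case False
  then obtain \<xi> where \<xi>: "a < \<xi>" "(b - a) * (gap k z * growth k z v \<xi>) \<le> cone_sol k z v b - cone_sol k z v a"
    using cone_sol_mvt[of z k a b v] assms by (metis order_le_imp_less_or_eq)
  have "0 \<le> (b - a) * (gap k z * growth k z v \<xi>)" using assms \<xi> by simp
  then show ?thesis using \<xi> by simp
qed simp

text \<open>\<open>growth\<close> dominates the form and the form is nondecreasing, so after
  \<open>a\<close> the slope stays at least \<open>gap k z\<close> times the value at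
  \<open>a\<close>. In particular a positive value forces unboundedness.\<close>

lemma cone_sol_linear_growth:
  assumes "Im z \<le> 0" "1 \<le> k" "k < m" "0 < gap k z" "0 \<le> a" "a \<le> b"
  shows "cone_sol k z v a + (b - a) * (gap k z * cone_sol k z v a) \<le> cone_sol k z v b"
proof (cases "a = b")
  case False
  then obtain \<xi> where \<xi>: "a < \<xi>" "(b - a) * (gap k z * growth k z v \<xi>) \<le> cone_sol k z v b - cone_sol k z v a"
    using cone_sol_mvt[of z k a b v] assms by (metis order_le_imp_less_or_eq)
  have "cone_sol k z v a \<le> growth k z v \<xi>"
    using cone_sol_mono[of z k a \<xi> v] cone_sol_le_growth[of k z v \<xi>] assms \<xi> by simp
  then have "(b - a) * (gap k z * cone_sol k z v a) \<le> (b - a) * (gap k z * growth k z v \<xi>)"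
    using assms by (intro mult_left_mono) auto
  then show ?thesis using \<xi> by simp
qed simp

lemma rate_nonneg: "Im z \<le> 0 \<Longrightarrow> 1 \<le> k \<Longrightarrow> k < m \<Longrightarrow> 0 \<le> rate z k"
proof -
  assume k: "Im z \<le> 0" "1 \<le> k" "k < m"
  have "0 < d k" "0 < d (k - 1)" using k by (auto intro!: d_pos)
  then show ?thesis using k unfolding rate_def by (intro mult_nonneg_nonneg) auto
qed

text \<open>This moves the lower bound from the unknown mean value point to \<open>x\<close>: within
  a unit step the squared norm does not fall, and the exponential weight loses at most the factor
  \<open>exp (- rate z k)\<close>.\<close>

lemma cone_sol_unit_step:
  assumes "Im z \<le> 0" "1 \<le> k" "k < m" "0 < gap k z" "0 \<le> x"
  shows "gap k z * (exp (- rate z k) * growth k z v x) \<le> cone_sol k z v (x + 1) - cone_sol k z v x"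
proof -
  obtain \<xi> where \<xi>: "x < \<xi>" "\<xi> < x + 1"
    "(x + 1 - x) * (gap k z * growth k z v \<xi>) \<le> cone_sol k z v (x + 1) - cone_sol k z v x"
    using cone_sol_mvt[of z k x "x + 1" v] assms by auto
  have "exp (- rate z k) * growth k z v x = exp (- rate z k * (x + 1)) * sqn m (sol z v x)"
    by (simp add: growth_def exp_add[symmetric] mult.assoc[symmetric] algebra_simps)
  also have "\<dots> \<le> exp (- rate z k * \<xi>) * sqn m (sol z v \<xi>)"
  proof (intro mult_mono sqn_sol_mono)
    show "exp (- rate z k * (x + 1)) \<le> exp (- rate z k * \<xi>)"
      using \<xi> rate_nonneg[OF assms(1-3)] by (simp add: mult_left_mono)
  qed (use \<xi> assms in auto)
  finally have "gap k z * (exp (- rate z k) * growth k z v x) \<le> gap k z * growth k z v \<xi>"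
    using assms by (intro mult_left_mono) (auto simp: growth_def)
  then show ?thesis using \<xi> by simp
qed

section \<open>The subspace of subordinate initial values\<close>

lemma subordinate_imp_cone:
  assumes "Im z \<le> 0" "1 \<le> k" "k < m" "0 < gap k z" "subordinate k z v" "0 \<le> a"
  shows "cone_sol k z v a \<le> 0"
proof (rule ccontr)
  assume pos: "\<not> cone_sol k z v a \<le> 0"
  obtain C where C: "growth k z v x \<le> C" if "0 \<le> x" for x using assms(5) by (auto simp: subordinate_def)
  define r where "r = gap k z * cone_sol k z v a"
  have r: "0 < r" using pos assms by (simp add: r_def)
  \<comment> \<open>Far enough for the linear lower bound to rise by \<open>|C| + 1\<close>, beyond
    the bound \<open>C\<close>.\<close>
  define b where "b = a + (\<bar>C\<bar> + 1) / r"
  have ab: "a \<le> b" using r by (simp add: b_def)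
  have "cone_sol k z v a + (b - a) * r \<le> C"
    using cone_sol_linear_growth[of z k a b v] cone_sol_le_growth[of k z v b] C[of b] assms ab unfolding r_def by linarith
  moreover have "(b - a) * r = \<bar>C\<bar> + 1" using r by (simp add: b_def)
  ultimately show False using pos by linarith
qed

text \<open>A nondecreasing form that stays nonpositive can rise by at most
  \<open>- cone_sol k z v 0\<close> in total, while a unit step from \<open>x\<close> raises it by
  at least a fixed multiple of the growth at \<open>x\<close>.\<close>

lemma cone_imp_subordinate:
  assumes "Im z \<le> 0" "1 \<le> k" "k < m" "0 < gap k z" "\<And>x. 0 \<le> x \<Longrightarrow> cone_sol k z v x \<le> 0"
  shows "subordinate k z v"
  unfolding subordinate_def
proof (intro exI allI impI)
  fix x :: real assume x: "0 \<le> x"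
  define r where "r = gap k z * exp (- rate z k)"
  have "r * growth k z v x \<le> - cone_sol k z v 0"
    using cone_sol_unit_step[of z k x v] cone_sol_mono[of z k 0 x v] assms(5)[of "x + 1"] assms(1-4) x
    by (simp add: r_def mult.assoc)
  moreover have "0 < r" using assms by (simp add: r_def)
  ultimately show "growth k z v x \<le> - cone_sol k z v 0 / r" by (simp add: field_simps)
qed

text \<open>Over the first unit step the form would pass from a nonnegative to a nonpositive value,
  which leaves no room for the strict increase that a nonzero \<open>v\<close> enforces.\<close>

lemma subordinate_strict:
  assumes "Im z \<le> 0" "1 \<le> k" "k < m" "0 < gap k z" "subordinate k z v" "0 \<le> cone_form k v" "i < m"
  shows "v i = 0"
proof -
  have c: "cone_form k (sol z v 0) = cone_form k v" "sqn m (sol z v 0) = sqn m v"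
    unfolding cone_form_def sqn_def by (simp_all add: sol_0)
  have "gap k z * (exp (- rate z k) * growth k z v 0) \<le> 0"
    using cone_sol_unit_step[of z k 0 v] subordinate_imp_cone[of z k v 1] assms(1-6)
    by (simp add: cone_sol_def[of _ _ _ 0] c)
  then have "growth k z v 0 \<le> 0" using assms(4) by (simp add: mult_le_0_iff)
  then have "sqn m v \<le> 0" by (simp add: growth_def c)
  then have "sqn m v = 0" using sqn_nonneg[of m v] by linarith
  then show ?thesis using assms(7) by (simp add: sqn_eq_0_iff)
qed

text \<open>Meant for differences: it shows that a subordinate vector is determined by its
  coordinates from \<open>k\<close> on. A vector supported on the first \<open>k\<close> coordinates
  has nonnegative form.\<close>

lemma subordinate_unique:
  assumes "Im z \<le> 0" "1 \<le> k" "k < m" "0 < gap k z" "subordinate k z v" "\<And>i. k \<le> i \<Longrightarrow> i < m \<Longrightarrow> v i = 0" "i < m"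
  shows "v i = 0"
proof -
  have "0 \<le> cone_form k v" unfolding cone_form_def using assms(6) by (intro sum_nonneg) (auto simp: not_less)
  then show ?thesis using subordinate_strict assms by blast
qed

lemma sqn_diff_le: "sqn m (\<lambda>i. u i - v i) \<le> 2 * sqn m u + 2 * sqn m v"
proof -
  have "(cmod (u i - v i))\<^sup>2 \<le> 2 * (cmod (u i))\<^sup>2 + 2 * (cmod (v i))\<^sup>2" for i
  proof -
    have "(cmod (u i - v i))\<^sup>2 \<le> (cmod (u i) + cmod (v i))\<^sup>2"
      by (intro power_mono norm_triangle_ineq4) auto
    also have "\<dots> \<le> 2 * (cmod (u i))\<^sup>2 + 2 * (cmod (v i))\<^sup>2"
      using sum_squares_bound[of "cmod (u i)" "cmod (v i)"] by (simp add: power2_sum)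
    finally show ?thesis .
  qed
  then show ?thesis
    unfolding sqn_def sum_distrib_left sum.distrib[symmetric] by (intro sum_mono) auto
qed

lemma subordinate_diff:
  assumes "subordinate k z u" "subordinate k z v"
  shows "subordinate k z (\<lambda>i. u i - v i)"
proof -
  obtain C C' where C: "growth k z u x \<le> C" "growth k z v x \<le> C'" if "0 \<le> x" for x
    using assms by (auto simp: subordinate_def)
  have "growth k z (\<lambda>i. u i - v i) x \<le> 2 * C + 2 * C'" if "0 \<le> x" for x
  proof -
    have "sqn m (sol z (\<lambda>i. u i - v i) x) \<le> 2 * sqn m (sol z u x) + 2 * sqn m (sol z v x)"
      using sqn_diff_le[of "sol z u x" "sol z v x"] by (simp add: sqn_def sol_diff)
    then have "growth k z (\<lambda>i. u i - v i) x \<le> exp (- rate z k * x) * (2 * sqn m (sol z u x) + 2 * sqn m (sol z v x))"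
      unfolding growth_def by (intro mult_left_mono) auto
    also have "\<dots> = 2 * growth k z u x + 2 * growth k z v x" by (simp add: growth_def algebra_simps)
    finally show ?thesis using C[OF that] by linarith
  qed
  then show ?thesis unfolding subordinate_def by blast
qed

lemma subordinate_smult:
  assumes "subordinate k z v"
  shows "subordinate k z (\<lambda>i. c * v i)"
proof -
  obtain C where C: "growth k z v x \<le> C" if "0 \<le> x" for x
    using assms by (auto simp: subordinate_def)
  have "growth k z (\<lambda>i. c * v i) x = (cmod c)\<^sup>2 * growth k z v x" for x
  proof -
    have "sol z (\<lambda>i. c * v i) x i = c * sol z v x i" for i
      by (simp add: sol_def mv_def sum_distrib_left mult_ac)
    then show ?thesis by (simp add: growth_def sqn_def norm_mult power_mult_distrib sum_distrib_left mult_ac)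
  qed
  then have "growth k z (\<lambda>i. c * v i) x \<le> (cmod c)\<^sup>2 * C" if "0 \<le> x" for x
    using C[OF that] by (simp add: mult_left_mono)
  then show ?thesis unfolding subordinate_def by blast
qed

lemma subordinate_zero: "subordinate k z (\<lambda>_. 0)"
  by (auto simp: subordinate_def growth_def sqn_def sol_def mv_def)

lemma subordinate_sum:
  assumes "finite J" "\<And>j. j \<in> J \<Longrightarrow> subordinate k z (u j)"
  shows "subordinate k z (\<lambda>i. \<Sum>j\<in>J. c j * u j i)"
  using assms
proof (induction J rule: finite_induct)
  case (insert j J)
  have "subordinate k z (\<lambda>i. c j * u j i - (- 1) * (\<Sum>j\<in>J. c j * u j i))"
    using insert by (intro subordinate_diff subordinate_smult) auto
  then show ?case using insert by simp
qed (simp add: subordinate_zero)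

lemma subordinate_cong:
  assumes "subordinate k z v" "\<And>i. i < m \<Longrightarrow> u i = v i"
  shows "subordinate k z u"
proof -
  have "sol z u = sol z v" using assms(2) by (intro ext) (simp add: sol_def mv_def)
  then show ?thesis using assms(1) by (simp add: subordinate_def growth_def)
qed

text \<open>\<open>rate z k\<close> is nonincreasing in \<open>k\<close>, so the growth classes are
  nested. This puts every Weyl column \<open>j\<close> with \<open>j >= k\<close> into the subspace
  of level \<open>k\<close>.\<close>

lemma subordinate_mono:
  assumes "subordinate j z v" "1 \<le> k" "k \<le> j" "j < m" "Im z \<le> 0"
  shows "subordinate k z v"
proof -
  obtain C where C: "growth j z v x \<le> C" if "0 \<le> x" for x
    using assms by (auto simp: subordinate_def)
  have "rate z j \<le> rate z k"
    using d_antimono[of k j] d_antimono[OF diff_le_mono[OF assms(3), of 1]] assms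
    unfolding rate_def by (intro mult_left_mono add_mono) auto
  then have "growth k z v x \<le> growth j z v x" if "0 \<le> x" for x
    using that unfolding growth_def by (intro mult_right_mono) (auto intro: mult_right_mono)
  then show ?thesis unfolding subordinate_def using C order_trans by blast
qed

end

section \<open>Analytic continuation in the spectral parameter\<close>

lemma holomorphic_on_det:
  fixes A :: "complex \<Rightarrow> complex mat"
  assumes "\<And>z. z \<in> S \<Longrightarrow> A z \<in> carrier_mat n n"
    and "\<And>i j. i < n \<Longrightarrow> j < n \<Longrightarrow> (\<lambda>z. A z $$ (i, j)) holomorphic_on S"
  shows "(\<lambda>z. Determinant.det (A z)) holomorphic_on S"
proof -
  have "(\<lambda>z. \<Sum>p | p permutes {0..<n}. signof p * (\<Prod>i = 0..<n. A z $$ (i, p i))) holomorphic_on S"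
    using assms(2) permutes_in_image by (fastforce intro!: holomorphic_intros)
  then show ?thesis
    by (rule holomorphic_transform) (simp add: det_def'[OF assms(1)])
qed

text \<open>The quotient of adjugate and determinant shows that the solution depends holomorphically
  on \<open>z\<close>. Injectivity is assumed in place of a nonzero determinant because it is what
  the cone argument supplies.\<close>

lemma cramer_holomorphic:
  fixes A :: "complex \<Rightarrow> nat \<Rightarrow> nat \<Rightarrow> complex"
  assumes A: "\<And>i j. i < n \<Longrightarrow> j < n \<Longrightarrow> (\<lambda>z. A z i j) holomorphic_on S"
    and b: "\<And>i. i < n \<Longrightarrow> (\<lambda>z. b z i) holomorphic_on S"
    and inj: "\<And>z v. z \<in> S \<Longrightarrow> (\<And>i. i < n \<Longrightarrow> mv n (A z) v i = 0) \<Longrightarrow> (\<And>i. i < n \<Longrightarrow> v i = 0)"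
  obtains u where "\<And>i. i < n \<Longrightarrow> (\<lambda>z. u z i) holomorphic_on S"
    "\<And>z i. z \<in> S \<Longrightarrow> i < n \<Longrightarrow> mv n (A z) (u z) i = b z i"
proof -
  define P where "P z = Matrix.mat n n (\<lambda>(i, j). A z i j)" for z
  have P: "P z \<in> carrier_mat n n" for z by (simp add: P_def)
  have detP: "(\<lambda>z. Determinant.det (P z)) holomorphic_on S"
    by (rule holomorphic_on_det[OF P]) (simp add: P_def A)
  have nz: "Determinant.det (P z) \<noteq> 0" if z: "z \<in> S" for z
  proof
    assume "Determinant.det (P z) = 0"
    then obtain v where v: "v \<in> carrier_vec n" "v \<noteq> 0\<^sub>v n" "P z *\<^sub>v v = 0\<^sub>v n"
      using det_0_iff_vec_prod_zero_field[OF P] by blast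
    have "mv n (A z) (\<lambda>j. v $ j) i = 0" if i: "i < n" for i
    proof -
      have "(P z *\<^sub>v v) $ i = 0" using v(3) i by simp
      then show ?thesis
        using v(1) i by (simp add: P_def scalar_prod_def mv_def atLeast0LessThan)
    qed
    then have "v $ i = 0" if "i < n" for i using inj[OF z] that by blast
    then have "v = 0\<^sub>v n" using v(1) by (intro eq_vecI) auto
    then show False using v(2) by simp
  qed
  have adjP: "(\<lambda>z. adj_mat (P z) $$ (i, j)) holomorphic_on S" if ij: "i < n" "j < n" for i j
  proof -
    have "(\<lambda>z. Determinant.det (mat_delete (P z) j i)) holomorphic_on S"
    proof (rule holomorphic_on_det[where n = "n - 1"])
      show "mat_delete (P z) j i \<in> carrier_mat (n - 1) (n - 1)" for z
        using P[of z] by (simp add: mat_delete_def)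
      show "(\<lambda>z. mat_delete (P z) j i $$ (i', j')) holomorphic_on S" if "i' < n - 1" "j' < n - 1" for i' j'
        using that A by (simp add: mat_delete_def P_def)
    qed
    then have "(\<lambda>z. (- 1) ^ (j + i) * Determinant.det (mat_delete (P z) j i)) holomorphic_on S"
      by (intro holomorphic_intros)
    then show ?thesis using ij P by (simp add: adj_mat_def cofactor_def P_def)
  qed
  define u where "u z j = (\<Sum>l<n. adj_mat (P z) $$ (j, l) * b z l) / Determinant.det (P z)" for z j
  show thesis
  proof
    show "(\<lambda>z. u z i) holomorphic_on S" if "i < n" for i
      unfolding u_def using that nz by (intro holomorphic_intros adjP b detP) auto
    show "mv n (A z) (u z) i = b z i" if z: "z \<in> S" and i: "i < n" for z i
    proof -
      have adj: "(\<Sum>j<n. A z i j * adj_mat (P z) $$ (j, l)) = (if i = l then Determinant.det (P z) else 0)"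
        if l: "l < n" for l
      proof -
        have "(P z * adj_mat (P z)) $$ (i, l) = (Determinant.det (P z) \<cdot>\<^sub>m 1\<^sub>m n) $$ (i, l)"
          using adj_mat(2)[OF P] by simp
        then show ?thesis using i l adj_mat(1)[OF P[of z]]
          by (simp add: P_def scalar_prod_def atLeast0LessThan if_distrib[of "\<lambda>x. _ * x"] split: if_splits)
      qed
      have "mv n (A z) (u z) i = (\<Sum>j<n. \<Sum>l<n. A z i j * adj_mat (P z) $$ (j, l) * b z l) / Determinant.det (P z)"
        by (simp add: mv_def u_def sum_divide_distrib sum_distrib_left mult.assoc)
      also have "(\<Sum>j<n. \<Sum>l<n. A z i j * adj_mat (P z) $$ (j, l) * b z l) =
          (\<Sum>l<n. (\<Sum>j<n. A z i j * adj_mat (P z) $$ (j, l)) * b z l)"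
        by (subst sum.swap) (simp add: sum_distrib_right)
      also have "\<dots> = (\<Sum>l<n. if i = l then Determinant.det (P z) * b z l else 0)"
        by (intro sum.cong refl) (simp add: adj)
      also have "\<dots> = Determinant.det (P z) * b z i" using i by simp
      finally show ?thesis using nz[OF z] by simp
    qed
  qed
qed

text \<open>If convergence failed at \<open>z\<close>, a subsequence would stay away from
  \<open>g z\<close>. Montel's theorem gives it a further subsequence with a holomorphic limit,
  which agrees with \<open>g\<close> on \<open>U\<close> and hence on the connected set
  \<open>S\<close>.\<close>

lemma vitali_pointwise:
  fixes f :: "nat \<Rightarrow> complex \<Rightarrow> complex"
  assumes S: "open S" "connected S" and f: "\<And>n. f n holomorphic_on S"
    and B: "\<And>n z. z \<in> S \<Longrightarrow> cmod (f n z) \<le> B"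
    and g: "g holomorphic_on S"
    and U: "open U" "U \<noteq> {}" "U \<subseteq> S" and lim: "\<And>z. z \<in> U \<Longrightarrow> (\<lambda>n. f n z) \<longlonglongrightarrow> g z"
    and z: "z \<in> S"
  shows "(\<lambda>n. f n z) \<longlonglongrightarrow> g z"
proof (rule ccontr)
  assume "\<not> (\<lambda>n. f n z) \<longlonglongrightarrow> g z"
  then obtain e where e: "0 < e" "\<not> (\<forall>\<^sub>F n in sequentially. dist (f n z) (g z) < e)"
    by (auto simp: tendsto_iff)
  then have "infinite {n. e \<le> dist (f n z) (g z)}"
    by (simp add: frequently_cofinite[symmetric] cofinite_eq_sequentially not_eventually not_less)
  then obtain s where s: "strict_mono (s :: nat \<Rightarrow> nat)" "\<And>n. e \<le> dist (f (s n) z) (g z)"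
    using infinite_enumerate[of "{n. e \<le> dist (f n z) (g z)}"] by auto
  obtain g' r where g': "g' holomorphic_on S" "strict_mono (r :: nat \<Rightarrow> nat)"
    "\<And>x. x \<in> S \<Longrightarrow> (\<lambda>n. f (s (r n)) x) \<longlonglongrightarrow> g' x"
  proof (rule Montel[OF S(1), of "range f" "\<lambda>n. f (s n)"])
    show "\<exists>B. \<forall>h\<in>range f. \<forall>z\<in>K. cmod (h z) \<le> B" if "K \<subseteq> S" for K
      using B that by (intro exI[of _ B]) auto
  qed (use f that in auto)
  have "g' x = g x" if "x \<in> U" for x
  proof (rule LIMSEQ_unique)
    show "(\<lambda>n. f (s (r n)) x) \<longlonglongrightarrow> g' x" using g'(3) U that by auto
    have "strict_mono (s \<circ> r)" using s g' by (simp add: strict_mono_o)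
    from LIMSEQ_subseq_LIMSEQ[OF lim[OF that] this]
    show "(\<lambda>n. f (s (r n)) x) \<longlonglongrightarrow> g x" by (simp add: o_def)
  qed
  then have "g' z = g z"
    using analytic_continuation_open[OF U(1) S(1) U(2) S(2) U(3) g'(1) g] z by blast
  then have "(\<lambda>n. f (s (r n)) z) \<longlonglongrightarrow> g z" using g'(3)[OF z] by simp
  then have "\<forall>\<^sub>F n in sequentially. dist (f (s (r n)) z) (g z) < e" using e(1) by (rule tendstoD)
  then show False using s(2) by (auto simp: eventually_sequentially not_le[symmetric])
qed

section \<open>Holomorphic dependence on the spectral parameter and continuation of
  subordinacy\<close>

context skew_system
begin

text \<open>The adjoint of the coefficient at \<open>cnj z\<close> is minus the coefficient at
  \<open>z\<close>, so the adjoint of \<open>W x (cnj z)\<close> times \<open>W x z\<close> has zero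
  derivative. This exhibits an explicit inverse of the fundamental solution.\<close>

lemma W_conserved:
  assumes x: "0 \<le> x" and ij: "i < m" "j < m"
  shows "(\<Sum>l<m. cnj (W x (cnj z) l i) * W x z l j) = (if i = j then 1 else 0)"
proof -
  define h where "h x = (\<Sum>l<m. cnj (W x (cnj z) l i) * W x z l j)" for x
  have "(h has_vector_derivative 0) (at x within {0..})" if x: "x \<in> {0..}" for x
  proof -
    have "(h has_vector_derivative (\<Sum>l<m. cnj (W x (cnj z) l i) * mm m (coef d z (Z x)) (W x z) l j
        + cnj (mm m (coef d (cnj z) (Z x)) (W x (cnj z)) l i) * W x z l j)) (at x within {0..})"
      unfolding h_def using x ij
      by (intro has_vector_derivative_sum has_vector_derivative_mult
          bounded_linear.has_vector_derivative[OF bounded_linear_cnj] W_deriv) auto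
    moreover have "(\<Sum>l<m. cnj (W x (cnj z) l i) * mm m (coef d z (Z x)) (W x z) l j
        + cnj (mm m (coef d (cnj z) (Z x)) (W x (cnj z)) l i) * W x z l j) = 0"
    proof -
      have "(\<Sum>l<m. cnj (mm m (coef d (cnj z) (Z x)) (W x (cnj z)) l i) * W x z l j)
        = (\<Sum>l<m. \<Sum>r<m. cnj (coef d (cnj z) (Z x) l r) * cnj (W x (cnj z) r i) * W x z l j)"
        by (simp add: mm_def sum_distrib_right)
      also have "\<dots> = (\<Sum>r<m. \<Sum>l<m. cnj (coef d (cnj z) (Z x) l r) * cnj (W x (cnj z) r i) * W x z l j)"
        by (rule sum.swap)
      also have "\<dots> = (\<Sum>r<m. \<Sum>l<m. - (cnj (W x (cnj z) r i) * (coef d z (Z x) r l * W x z l j)))"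
        using x by (intro sum.cong refl) (auto simp: coef_def skewD[OF Z_skew] algebra_simps)
      also have "\<dots> = - (\<Sum>l<m. cnj (W x (cnj z) l i) * mm m (coef d z (Z x)) (W x z) l j)"
        by (simp add: mm_def sum_negf sum_distrib_left)
      finally show ?thesis by (simp add: sum.distrib)
    qed
    ultimately show ?thesis by simp
  qed
  then obtain c where c: "\<And>x. x \<in> {0..} \<Longrightarrow> h x = c"
    using has_vector_derivative_zero_constant[of "{0..}" h] by (metis convex_real_interval(1))
  have "h x = h 0" using c x by simp
  also have "h 0 = (if i = j then 1 else 0)"
    using ij by (simp add: h_def W_0 if_distrib[of "\<lambda>x. _ * x"] if_distrib[of cnj] sum.remove[of _ j])
  finally show ?thesis by (simp add: h_def)
qed

lemma W_conserved_right:
  assumes x: "0 \<le> x" and ij: "i < m" "j < m"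
  shows "(\<Sum>l<m. W x z i l * cnj (W x (cnj z) j l)) = (if i = j then 1 else 0)"
proof -
  define A where "A = Matrix.mat m m (\<lambda>(i, j). cnj (W x (cnj z) j i))"
  define B where "B = Matrix.mat m m (\<lambda>(i, j). W x z i j)"
  have AB: "A \<in> carrier_mat m m" "B \<in> carrier_mat m m" by (simp_all add: A_def B_def)
  have "A * B = 1\<^sub>m m"
  proof (rule eq_matI)
    fix i j assume "i < dim_row (1\<^sub>m m :: complex mat)" "j < dim_col (1\<^sub>m m :: complex mat)"
    then show "(A * B) $$ (i, j) = 1\<^sub>m m $$ (i, j)"
      using W_conserved[OF x, of i j z] by (simp add: A_def B_def scalar_prod_def atLeast0LessThan)
  qed (simp_all add: A_def B_def)
  then have "B * A = 1\<^sub>m m" using mat_mult_left_right_inverse AB by blast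
  then have "(B * A) $$ (i, j) = 1\<^sub>m m $$ (i, j)" by simp
  then show ?thesis using ij by (simp add: A_def B_def scalar_prod_def atLeast0LessThan)
qed

lemma Z_entry_bound:
  assumes "0 \<le> x" "i < m" "j < m"
  shows "cmod (Z x i j) \<le> M0"
proof -
  define e where "e i l = (if l = i then 1 else 0 :: complex)" for i l :: nat
  have s: "sqn m (e i) = 1" if "i < m" for i
    using that by (simp add: sqn_def e_def sum.remove[of _ i])
  have "mv m (Z x) (e j) l = Z x l j" for l
    using assms by (simp add: mv_def e_def sum.remove[of _ j])
  moreover have "(\<Sum>l<m. cnj (e i l) * Z x l j) = Z x i j"
    using assms by (simp add: e_def sum.remove[of _ i])
  ultimately show ?thesis using Z_bound[OF assms(1), of "e i" "e j"] s assms by simp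
qed

lemma coef_bound:
  assumes "0 \<le> x" "i < m" "j < m"
  shows "cmod (coef d z (Z x) i j) \<le> cmod z * d 0 + M0"
proof -
  have d: "0 < d i" "d i \<le> d 0" using d_pos d_antimono[of 0 i] assms by auto
  have "cmod (coef d z (Z x) i j) \<le> cmod (if i = j then \<i> * z * d i else 0) + cmod (Z x i j)"
    unfolding coef_def by (rule norm_triangle_ineq4)
  also have "\<dots> \<le> cmod z * d 0 + M0"
    using d assms by (intro add_mono Z_entry_bound) (auto simp: norm_mult intro!: mult_left_mono)
  finally show ?thesis .
qed

text \<open>The candidate \<open>p\<close> for the \<open>z\<close>-derivative comes from variation of constants, where
  \<open>W_conserved\<close> supplies the inverse of \<open>W\<close>.\<close>

lemma W_has_field_derivative:
  assumes x: "0 \<le> x" and ij: "i < m" "j < m"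
  shows "\<exists>D. ((\<lambda>z. W x z i j) has_field_derivative D) (at z)"
proof -
  \<comment> \<open>The integrand of variation of constants: column \<open>j\<close> of the inverse
    of \<open>W\<close> times \<open>i D W\<close>, where the inverse is the adjoint of
    \<open>W s (cnj z)\<close>.\<close>
  define K where "K s l = (\<Sum>r<m. cnj (W s (cnj z) r l) * (\<i> * d r * W s z r j))" for s l
  define p where "p s = mv m (W s z) (\<lambda>l. integral {0..s} (\<lambda>s. K s l))" for s
  \<comment> \<open>The \<open>z\<close>-derivative of the coefficient. As the coefficient is affine
    in \<open>z\<close>, its difference quotient equals \<open>A'\<close> exactly.\<close>
  define A' where "A' i l = (if i = l then \<i> * complex_of_real (d i) else 0)" for i l
  have A': "mv m A' v i = \<i> * d i * v i" if "i < m" for v i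
    using that by (simp add: mv_def A'_def if_distrib[of "\<lambda>x. x * _"] cong: if_cong)
  have W': "((\<lambda>s. W s z i j) has_vector_derivative mm m (coef d z (Z s)) (W s z) i j) (at s within {0..x})"
    if "s \<in> {0..x}" "i < m" "j < m" for s z i j
    using has_vector_derivative_within_subset[OF W_deriv[of s i j z], of "{0..x}"] that by auto
  have contW: "continuous_on {0..x} (\<lambda>s. W s z i j)" if "i < m" "j < m" for z i j
    using W'[OF _ that] has_vector_derivative_continuous continuous_on_eq_continuous_within by blast
  have "continuous_on {0..x} (\<lambda>s. K s l)" if "l < m" for l
    unfolding K_def using that ij by (intro continuous_intros contW) auto
  then have I: "((\<lambda>u. integral {0..u} (\<lambda>s. K s l)) has_vector_derivative K s l) (at s within {0..x})"
    if "s \<in> {0..x}" "l < m" for s l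
    using integral_has_vector_derivative that by blast
  have p: "((\<lambda>s. p s i) has_vector_derivative
      mv m (coef d z (Z s)) (p s) i + mv m A' (\<lambda>l. W s z l j) i) (at s within {0..x})"
    if s: "s \<in> {0..x}" and i: "i < m" for s i
  proof -
    have "((\<lambda>s. \<Sum>l<m. W s z i l * integral {0..s} (\<lambda>s. K s l)) has_vector_derivative
      (\<Sum>l<m. W s z i l * K s l + mm m (coef d z (Z s)) (W s z) i l * integral {0..s} (\<lambda>s. K s l))) (at s within {0..x})"
      using s i by (intro has_vector_derivative_sum has_vector_derivative_mult W' I) auto
    moreover have "(\<Sum>l<m. mm m (coef d z (Z s)) (W s z) i l * integral {0..s} (\<lambda>s. K s l)) = mv m (coef d z (Z s)) (p s) i"
      unfolding p_def mv_mm[symmetric] by (simp add: mv_def)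
    moreover have "(\<Sum>l<m. W s z i l * K s l) = mv m A' (\<lambda>l. W s z l j) i"
    proof -
      have "(\<Sum>l<m. W s z i l * K s l) = (\<Sum>l<m. \<Sum>r<m. W s z i l * cnj (W s (cnj z) r l) * (\<i> * d r * W s z r j))"
        by (simp add: K_def sum_distrib_left mult.assoc)
      also have "\<dots> = (\<Sum>r<m. (\<Sum>l<m. W s z i l * cnj (W s (cnj z) r l)) * (\<i> * d r * W s z r j))"
        by (subst sum.swap) (simp add: sum_distrib_right)
      also have "\<dots> = (\<Sum>r<m. (if i = r then 1 else 0) * (\<i> * d r * W s z r j))"
        using s i by (intro sum.cong refl) (subst W_conserved_right, auto)
      also have "\<dots> = \<i> * d i * W s z i j"
        using i by (simp add: if_distrib[of "\<lambda>x. x * _"] cong: if_cong)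
      finally show ?thesis using A'[OF i] by simp
    qed
    ultimately show ?thesis by (simp add: sum.distrib p_def mv_def[of m "W _ z"] add.commute)
  qed
  define B where "B = cmod z * d 0 + M0 + d 0"
  have d0: "d l \<le> d 0" "0 < d l" if "l < m" for l using d_antimono[of 0 l] d_pos that by auto
  have M0: "0 \<le> M0" using Z_entry_bound[of 0 i i] ij norm_ge_zero order_trans by blast
  have coefB: "cmod (coef d z (Z s) i l) \<le> B" if "s \<in> {0..x}" "i < m" "l < m" for s i l
    using coef_bound[of s i l z] that d0[OF ij(1)] by (simp add: B_def)
  have "((\<lambda>z'. (W x z' i j - W x z i j) / (z' - z)) \<longlongrightarrow> p x i) (at z)"
  proof (rule linear_system_parameter_derivative[where X = x and m = m and y = "\<lambda>z' s i. W s z' i j" and h = "\<lambda>z'. z' - z"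
        and A = "\<lambda>z' s. coef d z' (Z s)" and L = "\<lambda>s. coef d z (Z s)" and L' = "\<lambda>_. A'" and B = B])
    show "((\<lambda>s. W s z i j) has_vector_derivative mv m (coef d z (Z s)) (\<lambda>i. W s z i j) i) (at s within {0..x})"
      if "s \<in> {0..x}" "i < m" for s i
      using W'[OF that ij(2)] by (simp add: mm_def mv_def)
    show "p 0 i = 0" if "i < m" for i by (simp add: p_def mv_def)
    show "\<forall>\<^sub>F z' in at z. z' - z \<noteq> 0 \<and> (\<forall>i<m. W 0 z' i j = W 0 z i j \<and>
       (\<forall>s\<in>{0..x}. ((\<lambda>s. W s z' i j) has_vector_derivative mv m (coef d z' (Z s)) (\<lambda>i. W s z' i j) i) (at s within {0..x})))"
      using W' ij(2) unfolding eventually_at_filter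
      by (intro always_eventually) (auto simp: W_0 mm_def mv_def)
    show "((\<lambda>z'. z' - z) \<longlongrightarrow> 0) (at z)" by (auto intro!: tendsto_eq_intros)
    show "\<forall>\<^sub>F z' in at z. \<forall>s\<in>{0..x}. \<forall>i<m. \<forall>j<m.
        cmod ((coef d z' (Z s) i j - coef d z (Z s) i j) / (z' - z) - A' i j) \<le> \<epsilon>" if "0 < \<epsilon>" for \<epsilon>
      unfolding eventually_at_filter
    proof (intro always_eventually allI impI ballI)
      fix z' s i j assume "z' \<noteq> z"
      then have "(coef d z' (Z s) i j - coef d z (Z s) i j) / (z' - z) = A' i j"
        by (simp add: coef_def A'_def divide_simps) (simp add: algebra_simps)
      then show "cmod ((coef d z' (Z s) i j - coef d z (Z s) i j) / (z' - z) - A' i j) \<le> \<epsilon>"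
        using that by simp
    qed
    show "cmod (A' i l) \<le> B" if "i < m" for i l
    proof -
      have "0 \<le> cmod z * d 0" using d0[OF ij(1)] by simp
      moreover have "cmod (A' i l) \<le> d 0" using d0[OF that] by (auto simp: A'_def norm_mult)
      ultimately show ?thesis using M0 unfolding B_def by linarith
    qed
    show "0 \<le> B" using d0[OF ij(1)] M0 by (simp add: B_def)
  qed (use p coefB x ij in auto)
  then show ?thesis by (auto simp: has_field_derivative_iff)
qed

lemma W_holomorphic: "0 \<le> x \<Longrightarrow> i < m \<Longrightarrow> j < m \<Longrightarrow> (\<lambda>z. W x z i j) holomorphic_on S"
  using W_has_field_derivative unfolding holomorphic_on_def field_differentiable_def
  by (meson has_field_derivative_at_within)

text \<open>The squared norm is nondecreasing, so the integral over \<open>[x, x + 1]\<close>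
  controls the value at \<open>x\<close>. This turns integrability into a pointwise bound.\<close>

lemma subordinate_if_integrable:
  assumes "Im z \<le> 0" "1 \<le> k" "k < m" "0 \<le> q" "q \<le> rate z k"
    and int: "(\<lambda>x. exp (- q * x) * sqn m (sol z v x)) integrable_on {0..}"
  shows "subordinate k z v"
  unfolding subordinate_def
proof (intro exI allI impI)
  fix x :: real assume x: "0 \<le> x"
  define N where "N x = sqn m (sol z v x)" for x
  define I where "I = integral {0..} (\<lambda>x. exp (- q * x) * N x)"
  have sub: "(\<lambda>x. exp (- q * x) * N x) integrable_on {x..x+1}"
    by (rule integrable_on_subinterval[OF int[folded N_def]]) (use x in auto)
  have "exp (- q * (x + 1)) * N x = integral {x..x+1} (\<lambda>_. exp (- q * (x + 1)) * N x)" by simp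
  also have "\<dots> \<le> integral {x..x+1} (\<lambda>x. exp (- q * x) * N x)"
  proof (rule integral_le[OF _ sub])
    show "exp (- q * (x + 1)) * N x \<le> exp (- q * y) * N y" if "y \<in> {x..x+1}" for y
    proof (rule mult_mono)
      show "exp (- q * (x + 1)) \<le> exp (- q * y)" using that assms(4) by (simp add: mult_left_mono)
      show "N x \<le> N y" unfolding N_def using that x assms by (intro sqn_sol_mono) auto
    qed (auto simp: N_def)
  qed auto
  also have "\<dots> \<le> I" unfolding I_def
    by (rule integral_subset_le[OF _ sub int[folded N_def]]) (use x in \<open>auto simp: N_def\<close>)
  finally have *: "exp (- q * (x + 1)) * N x \<le> I" .
  have "growth k z v x \<le> exp (- q * x) * N x"
    unfolding growth_def N_def using assms x by (intro mult_right_mono) (auto intro: mult_right_mono)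
  also have "\<dots> = exp q * (exp (- q * (x + 1)) * N x)"
    by (simp add: mult.assoc[symmetric] exp_add[symmetric] algebra_simps)
  also have "\<dots> \<le> exp q * I" using * by (intro mult_left_mono) auto
  finally show "growth k z v x \<le> exp q * I" .
qed

lemma cone_form_lower_zero:
  assumes "\<And>i. k \<le> i \<Longrightarrow> i < m \<Longrightarrow> y i = 0" shows "cone_form k y = sqn m y"
  unfolding cone_form_def sqn_def using assms by (intro sum.cong) auto

text \<open>A linear system with the leading \<open>k\<close>-block of \<open>W X z\<close> has to
  be solved. The block is injective: a nonzero initial vector supported on the first
  \<open>k\<close> coordinates has positive form, and the nondecreasing weighted form cannot reach
  the nonpositive value that it has when the first \<open>k\<close> coordinates vanish at
  \<open>X\<close>.\<close>

lemma truncated_solution: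
  assumes S: "\<And>z. z \<in> S \<Longrightarrow> Im z \<le> 0" "\<And>z. z \<in> S \<Longrightarrow> 0 < gap k z" and k: "1 \<le> k" "k < m" and X: "0 \<le> X"
  obtains v where "\<And>i. (\<lambda>z. v z i) holomorphic_on S"
    "\<And>z. v z k = 1" "\<And>z i. k < i \<Longrightarrow> v z i = 0"
    "\<And>z i. z \<in> S \<Longrightarrow> i < k \<Longrightarrow> sol z (v z) X i = 0"
proof -
  have "v i = 0" if z: "z \<in> S" and v: "\<And>i. i < k \<Longrightarrow> mv k (W X z) v i = 0" and i: "i < k" for z v i
  proof -
    define y where "y i = (if i < k then v i else 0)" for i
    have y: "sol z y X i = 0" if "i < k" for i
    proof -
      have "(\<Sum>j<m. W X z i j * y j) = (\<Sum>j<k. W X z i j * v j)"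
        using k by (intro sum.mono_neutral_cong_right) (auto simp: y_def)
      then show ?thesis using v[OF that] by (simp add: sol_def mv_def)
    qed
    have "cone_form k (sol z y X) \<le> 0"
      unfolding cone_form_def by (intro sum_nonpos) (auto simp: y)
    then have "cone_sol k z y X \<le> 0" by (simp add: cone_sol_def mult_le_0_iff)
    then have "cone_sol k z y 0 \<le> 0"
      using cone_sol_mono[of z k 0 X y] S z k X by force
    then have "cone_form k y \<le> 0" by (simp add: cone_sol_def cone_form_def sol_0)
    moreover have "cone_form k y = sqn m y" by (rule cone_form_lower_zero) (simp add: y_def)
    ultimately have "sqn m y = 0" using sqn_nonneg[of m y] by linarith
    then show "v i = 0" using i k by (auto simp: sqn_eq_0_iff y_def split: if_splits)
  qed
  moreover have "(\<lambda>z. W X z i j) holomorphic_on S" if "i < k" "j < k" for i j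
    using that k X by (intro W_holomorphic) auto
  moreover have "(\<lambda>z. - W X z i k) holomorphic_on S" if "i < k" for i
    using that k X by (intro holomorphic_intros W_holomorphic) auto
  ultimately obtain u where u: "\<And>i. i < k \<Longrightarrow> (\<lambda>z. u z i) holomorphic_on S"
    "\<And>z i. z \<in> S \<Longrightarrow> i < k \<Longrightarrow> mv k (W X z) (u z) i = - W X z i k"
    using cramer_holomorphic[of k "\<lambda>z. W X z" S "\<lambda>z i. - W X z i k"] by blast
  \<comment> \<open>The entries from \<open>k\<close> on are those of column \<open>k\<close> of a
    normalized Weyl function, so the difference of the two vectors is supported on the first
    \<open>k\<close> coordinates.\<close>
  define v where "v z i = (if i < k then u z i else if i = k then 1 else 0)" for z i
  show thesis
  proof
    show "(\<lambda>z. v z i) holomorphic_on S" for i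
      using u(1)[of i] by (cases "i < k"; cases "i = k") (auto simp: v_def)
    show "sol z (v z) X i = 0" if "z \<in> S" "i < k" for z i
    proof -
      have "sol z (v z) X i = (\<Sum>j\<in>{..<k} \<union> {k}. W X z i j * v z j)"
        unfolding sol_def mv_def using k by (intro sum.mono_neutral_right) (auto simp: v_def)
      also have "\<dots> = mv k (W X z) (u z) i + W X z i k"
        by (subst sum.union_disjoint) (auto simp: v_def mv_def)
      finally show ?thesis using u(2)[OF that] by simp
    qed
  qed (auto simp: v_def)
qed

text \<open>Nonpositivity of the form passes to pointwise limits, unlike a growth bound with an
  unspecified constant; \<open>cone_imp_subordinate\<close> turns it back into growth at the
  end.\<close>

lemma subordinate_continuation:
  assumes S: "open S" "connected S" "\<And>z. z \<in> S \<Longrightarrow> Im z \<le> 0" "\<And>z. z \<in> S \<Longrightarrow> 0 < gap k z"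
    and k: "1 \<le> k" "k < m"
    and u: "\<And>i. i < m \<Longrightarrow> (\<lambda>z. u z i) holomorphic_on S" "\<And>z. z \<in> S \<Longrightarrow> u z k = 1"
      "\<And>z i. z \<in> S \<Longrightarrow> k < i \<Longrightarrow> i < m \<Longrightarrow> u z i = 0"
    and U: "open U" "U \<noteq> {}" "U \<subseteq> S" "\<And>z. z \<in> U \<Longrightarrow> subordinate k z (u z)"
    and z: "z \<in> S"
  shows "subordinate k z (u z)"
proof -
  have "\<exists>v. (\<forall>i. (\<lambda>z. v z i) holomorphic_on S) \<and> (\<forall>z. v z k = 1) \<and> (\<forall>z i. k < i \<longrightarrow> v z i = 0) \<and>
     (\<forall>z\<in>S. \<forall>i<k. sol z (v z) (real n) i = 0)" for n
    using truncated_solution[of S k "real n"] S k by (metis of_nat_0_le_iff)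
  then obtain v where v: "\<And>n i. (\<lambda>z. v n z i) holomorphic_on S" "\<And>n z. v n z k = 1"
    "\<And>n z i. k < i \<Longrightarrow> v n z i = 0" "\<And>n z i. z \<in> S \<Longrightarrow> i < k \<Longrightarrow> sol z (v n z) (real n) i = 0"
    by metis
  have neg: "cone_sol k z (v n z) x \<le> 0" if z: "z \<in> S" and x: "0 \<le> x" "x \<le> real n" for n z x
  proof -
    have "cone_form k (sol z (v n z) n) \<le> 0"
      unfolding cone_form_def by (intro sum_nonpos) (auto simp: v(4)[OF z])
    then have "cone_sol k z (v n z) n \<le> 0" by (simp add: cone_sol_def mult_le_0_iff)
    then show ?thesis using cone_sol_mono[of z k x "real n" "v n z"] S z x k by force
  qed
  \<comment> \<open>At \<open>x = 0\<close> the form is the squared norm of the first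
    \<open>k\<close> entries minus 1, so the cone itself supplies the uniform bound for Vitali's
    theorem.\<close>
  have bound: "cmod (v n z i) \<le> 1" if z: "z \<in> S" and i: "i < m" for n z i
  proof (cases "i < k")
    case True
    have "cone_sol k z (v n z) 0 \<le> 0" using neg[OF z, of 0 n] by simp
    then have "cone_form k (v n z) \<le> 0" by (simp add: cone_sol_def cone_form_def sol_0)
    moreover have "(\<Sum>j\<in>{i, k}. (if j < k then 1 else -1) * (cmod (v n z j))\<^sup>2) \<le> cone_form k (v n z)"
      unfolding cone_form_def using v(3) k i by (intro sum_mono2) auto
    ultimately have "(cmod (v n z i))\<^sup>2 \<le> 1" using True v(2) by simp
    then show ?thesis by (simp add: power_le_one_iff abs_square_le_1)
  next
    case False
    then show ?thesis using v(2,3) by (cases "i = k") auto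
  qed
  have conv: "(\<lambda>n. v n z i) \<longlonglongrightarrow> u z i" if z: "z \<in> U" and i: "i < m" for z i
  proof -
    have zS: "z \<in> S" using z U by auto
    obtain C where C: "growth k z (u z) x \<le> C" if "0 \<le> x" for x
      using U(4)[OF z] by (auto simp: subordinate_def)
    \<comment> \<open>The difference \<open>y\<close> has form \<open>sqn m y\<close> at 0. At
      \<open>n\<close> its first \<open>k\<close> coordinates are those of the solution through
      \<open>u\<close>, up to sign, so the weighted form there is at most \<open>C\<close>. Linear
      growth in between forces \<open>sqn m y\<close> to be of order \<open>1 / n\<close>.\<close>
    have le: "(cmod (v n z i - u z i))\<^sup>2 \<le> C / (1 + n * gap k z)" for n
    proof -
      define y where "y j = v n z j - u z j" for j
      have ylow: "y j = 0" if "k \<le> j" "j < m" for j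
        using that v(2,3) u(2,3)[OF zS] by (cases "j = k") (auto simp: y_def)
      have sy: "sol z y n j = - sol z (u z) n j" if "j < k" for j
        using v(4)[OF zS that, of n] sol_diff[of z "v n z" "u z" n j] by (simp add: y_def[abs_def])
      have "cone_form k (sol z y n) \<le> sqn m (sol z (u z) n)"
        unfolding cone_form_def sqn_def
        by (intro sum_mono) (auto simp: sy)
      then have "cone_sol k z y n \<le> growth k z (u z) n"
        by (simp add: cone_sol_def growth_def)
      also have "\<dots> \<le> C" using C by simp
      finally have "cone_sol k z y n \<le> C" .
      moreover have "cone_sol k z y 0 = sqn m y"
        using cone_form_lower_zero[of k y] ylow by (simp add: cone_sol_def cone_form_def sol_0)
      ultimately have "sqn m y * (1 + n * gap k z) \<le> C"
        using cone_sol_linear_growth[of z k 0 n y] S(3,4)[OF zS] k by (simp add: algebra_simps)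
      then have "sqn m y \<le> C / (1 + n * gap k z)"
        using S(4)[OF zS] by (simp add: pos_le_divide_eq add_pos_nonneg)
      moreover have "(cmod (y i))\<^sup>2 \<le> sqn m y" unfolding sqn_def using i by (intro member_le_sum) auto
      ultimately show ?thesis by (simp add: y_def)
    qed
    have "filterlim (\<lambda>n. 1 + real n * gap k z) at_top sequentially"
      using S(4)[OF zS]
      by (intro filterlim_tendsto_add_at_top[OF tendsto_const]
          filterlim_at_top_mult_tendsto_pos[OF tendsto_const] filterlim_real_sequentially)
    then have "(\<lambda>n. C / (1 + real n * gap k z)) \<longlonglongrightarrow> 0"
      by (intro tendsto_divide_0[OF tendsto_const] filterlim_at_top_imp_at_infinity)
    then have "(\<lambda>n. (cmod (v n z i - u z i))\<^sup>2) \<longlonglongrightarrow> 0"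
      by (rule tendsto_sandwich[OF _ _ tendsto_const, rotated 2]) (use le in auto)
    then have "(\<lambda>n. sqrt ((cmod (v n z i - u z i))\<^sup>2)) \<longlonglongrightarrow> sqrt 0" by (rule tendsto_real_sqrt)
    then show ?thesis by (simp add: tendsto_norm_zero_iff LIM_zero_iff)
  qed
  have lim: "(\<lambda>n. v n z i) \<longlonglongrightarrow> u z i" if i: "i < m" for i
    by (rule vitali_pointwise[OF S(1,2) v(1) bound u(1) U(1-3) conv z]) (use i in auto)
  show ?thesis
  proof (rule cone_imp_subordinate)
    fix x :: real assume x: "0 \<le> x"
    have "(\<lambda>n. cone_sol k z (v n z) x) \<longlonglongrightarrow> cone_sol k z (u z) x"
      unfolding cone_sol_def cone_form_def sol_def mv_def by (intro tendsto_intros lim) auto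
    moreover have "\<exists>N. \<forall>n\<ge>N. cone_sol k z (v n z) x \<le> 0"
    proof (intro exI allI impI)
      fix n assume "nat \<lceil>x\<rceil> \<le> n"
      then have "x \<le> n" by linarith
      then show "cone_sol k z (v n z) x \<le> 0" using neg[OF z x] by simp
    qed
    ultimately show "cone_sol k z (u z) x \<le> 0" by (rule LIMSEQ_le_const2)
  qed (use S z k in auto)
qed

end

section \<open>Evolution in the second variable\<close>

text \<open>\<open>linear_system_parameter_derivative\<close> asks for convergence of the
  coefficients uniformly in \<open>s\<close>; uniform continuity of \<open>f'\<close> on a compact
  rectangle provides it.\<close>

lemma uniform_difference_quotient:
  fixes f f' :: "real \<Rightarrow> real \<Rightarrow> complex"
  assumes cont: "continuous_on ({0..} \<times> {0..<a}) (\<lambda>(s, t). f' s t)"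
    and der: "\<And>s t. 0 \<le> s \<Longrightarrow> t \<in> {0..<a} \<Longrightarrow> ((\<lambda>t. f s t) has_vector_derivative f' s t) (at t within {0..<a})"
    and t: "t \<in> {0..<a}" and "0 < \<epsilon>"
  shows "\<forall>\<^sub>F \<tau> in at t within {0..<a}. \<forall>s\<in>{0..X}.
    cmod ((f s \<tau> - f s t) / of_real (\<tau> - t) - f' s t) \<le> \<epsilon>"
proof -
  \<comment> \<open>The interval \<open>{0..<a}\<close> is not compact; a point strictly between
    \<open>t\<close> and \<open>a\<close> confines nearby parameters to the compact
    \<open>{0..b}\<close>.\<close>
  define b where "b = (t + a) / 2"
  have b: "t < b" "b < a" using t by (auto simp: b_def)
  have "uniformly_continuous_on ({0..X} \<times> {0..b}) (\<lambda>(s, t). f' s t)"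
    using b by (intro compact_uniformly_continuous compact_Times continuous_on_subset[OF cont]) auto
  then obtain \<delta> where \<delta>: "0 < \<delta>" "\<And>p p'. p \<in> {0..X} \<times> {0..b} \<Longrightarrow> p' \<in> {0..X} \<times> {0..b} \<Longrightarrow> dist p' p < \<delta> \<Longrightarrow>
      dist ((\<lambda>(s, t). f' s t) p') ((\<lambda>(s, t). f' s t) p) < \<epsilon>"
    using uniformly_continuous_onE[OF _ \<open>0 < \<epsilon>\<close>] by metis
  show ?thesis
    unfolding eventually_at
  proof (intro exI[of _ "min \<delta> (b - t)"] conjI ballI impI)
    show "0 < min \<delta> (b - t)" using \<delta> b by simp
    fix \<tau> s assume \<tau>: "\<tau> \<in> {0..<a}" "\<tau> \<noteq> t \<and> dist \<tau> t < min \<delta> (b - t)" and s: "s \<in> {0..X}"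
    have \<tau>b: "\<tau> \<le> b" using \<tau> by (auto simp: dist_real_def)
    have seg: "x \<in> {0..b}" "\<bar>x - t\<bar> < \<delta>" "x \<in> {0..<a}" if "x \<in> closed_segment t \<tau>" for x
      using that \<tau> \<tau>b t b by (auto simp: closed_segment_eq_real_ivl dist_real_def split: if_splits)
    have "norm (f s \<tau> - f s t - (\<tau> - t) *\<^sub>R f' s t) \<le> norm (\<tau> - t) * \<epsilon>"
    proof (rule vector_differentiable_bound_linearization[of "closed_segment t \<tau>"])
      show "((\<lambda>t. f s t) has_vector_derivative f' s x) (at x within closed_segment t \<tau>)"
        if "x \<in> closed_segment t \<tau>" for x
        using seg s that by (intro has_vector_derivative_within_subset[OF der]) auto
      show "norm (f' s x - f' s t) \<le> \<epsilon>" if "x \<in> closed_segment t \<tau>" for x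
        using \<delta>(2)[of "(s, t)" "(s, x)"] seg[OF that] s t b
        by (auto simp: dist_Pair_Pair dist_norm)
    qed auto
    then have "norm (f s \<tau> - f s t - (\<tau> - t) *\<^sub>R f' s t) / norm (\<tau> - t) \<le> \<epsilon>"
      using \<tau> by (simp add: field_simps)
    moreover have "(f s \<tau> - f s t) / of_real (\<tau> - t) - f' s t = (f s \<tau> - f s t - (\<tau> - t) *\<^sub>R f' s t) / of_real (\<tau> - t)"
      using \<tau> by (simp add: field_simps scaleR_conv_of_real)
    ultimately show "cmod ((f s \<tau> - f s t) / of_real (\<tau> - t) - f' s t) \<le> \<epsilon>"
      by (simp only: norm_divide norm_of_real real_norm_def)
  qed
qed

lemma has_vector_derivative_iff_difference_quotient:
  fixes f :: "real \<Rightarrow> 'a::real_normed_vector"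
  shows "(f has_vector_derivative f') (at t within S) \<longleftrightarrow>
    ((\<lambda>s. (f s - f t) /\<^sub>R (s - t)) \<longlongrightarrow> f') (at t within S)"
proof -
  have "norm (f s - f t - (s - t) *\<^sub>R f') / norm (s - t) = norm ((f s - f t) /\<^sub>R (s - t) - f')" if "s \<noteq> t" for s
  proof -
    have "f s - f t - (s - t) *\<^sub>R f' = (s - t) *\<^sub>R ((f s - f t) /\<^sub>R (s - t) - f')"
      using that by (simp add: scaleR_diff_right)
    then show ?thesis using that by (simp only: norm_scaleR) simp
  qed
  then have "(f has_vector_derivative f') (at t within S) \<longleftrightarrow>
      ((\<lambda>s. norm ((f s - f t) /\<^sub>R (s - t) - f')) \<longlongrightarrow> 0) (at t within S)"
    unfolding has_vector_derivative_def has_derivative_iff_norm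
    by (simp add: bounded_linear_scaleR_left eventually_at_filter cong: Lim_cong_within)
  then show ?thesis by (simp add: tendsto_norm_zero_iff LIM_zero_iff)
qed

lemma mm_assoc: "mm m (mm m A B) C i j = mm m A (mm m B C) i j"
  using mv_mm[of m A B "\<lambda>l. C l j" i] by (simp add: mm_def mv_def)

lemma mm_has_vector_derivative:
  assumes "\<And>l. l < m \<Longrightarrow> ((\<lambda>x. A x i l) has_vector_derivative A' i l) (at x within S)"
    and "\<And>l. l < m \<Longrightarrow> ((\<lambda>x. B x l j) has_vector_derivative B' l j) (at x within S)"
  shows "((\<lambda>x. mm m (A x) (B x) i j) has_vector_derivative mm m (A x) B' i j + mm m A' (B x) i j) (at x within S)"
  unfolding mm_def sum.distrib[symmetric]
  using assms by (intro has_vector_derivative_sum has_vector_derivative_mult) auto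

lemma mm_cong:
  "(\<And>l. l < m \<Longrightarrow> A i l = A' i l) \<Longrightarrow> (\<And>l. l < m \<Longrightarrow> B l j = B' l j) \<Longrightarrow> mm m A B i j = mm m A' B' i j"
  by (simp add: mm_def)

lemma mm_add_left: "mm m (\<lambda>i j. A i j + B i j) C i j = mm m A C i j + mm m B C i j"
  by (simp add: mm_def distrib_right sum.distrib)

lemma mm_coef:
  assumes "i < m" "j < m"
  shows "mm m (coef d z A) (coef h z B) i j =
    (if i = j then (\<i> * z * d i) * (\<i> * z * h i) else 0) - \<i> * z * d i * B i j - A i j * (\<i> * z * h j) + mm m A B i j"
proof -
  have "mm m (coef d z A) (coef h z B) i j = mv m (coef d z A) (\<lambda>l. coef h z B l j) i"
    by (simp add: mm_def mv_def)
  also have "\<dots> = \<i> * z * d i * coef h z B i j - mv m A (\<lambda>l. coef h z B l j) i"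
    using assms by (simp add: mv_coef)
  also have "mv m A (\<lambda>l. coef h z B l j) i = (\<Sum>l<m. A i l * (if l = j then \<i> * z * h l else 0)) - mm m A B i j"
    by (simp add: mm_def mv_def coef_def right_diff_distrib sum_subtractf)
  also have "(\<Sum>l<m. A i l * (if l = j then \<i> * z * h l else 0)) = A i j * (\<i> * z * h j)"
    using assms by (subst sum.remove[of _ j]) (auto intro!: sum.neutral)
  finally show ?thesis by (auto simp: coef_def[of h z B i j] algebra_simps)
qed

text \<open>The entries of the commutator of the diagonal matrix of \<open>d\<close> with
  \<open>P\<close>.\<close>

definition diag_comm :: "(nat \<Rightarrow> real) \<Rightarrow> (nat \<Rightarrow> nat \<Rightarrow> complex) \<Rightarrow> nat \<Rightarrow> nat \<Rightarrow> complex" where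
  "diag_comm d P i j = of_real (d i - d j) * P i j"

text \<open>Compare powers of \<open>z\<close>: the quadratic terms are products of diagonal
  matrices and commute, the linear terms cancel because both are multiples of
  \<open>(d i - d j) * (h i - h j) * P i j\<close>, and the constant term is the nonlinear optics
  equation.\<close>

lemma zero_curvature_coefficients:
  assumes "i < m" "j < m"
    and eq: "diag_comm d Pt i j - diag_comm h Px i j =
      mm m (diag_comm d P) (diag_comm h P) i j - mm m (diag_comm h P) (diag_comm d P) i j"
  shows "mm m (coef h z (diag_comm h P)) (coef d z (diag_comm d P)) i j + - diag_comm h Px i j =
    mm m (coef d z (diag_comm d P)) (coef h z (diag_comm h P)) i j + - diag_comm d Pt i j"
proof -
  have "mm m (coef d z (diag_comm d P)) (coef h z (diag_comm h P)) i j -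
      mm m (coef h z (diag_comm h P)) (coef d z (diag_comm d P)) i j =
      mm m (diag_comm d P) (diag_comm h P) i j - mm m (diag_comm h P) (diag_comm d P) i j"
    unfolding mm_coef[OF assms(1,2)] by (simp add: diag_comm_def algebra_simps)
  then have "mm m (coef d z (diag_comm d P)) (coef h z (diag_comm h P)) i j -
      mm m (coef h z (diag_comm h P)) (coef d z (diag_comm d P)) i j = diag_comm d Pt i j - diag_comm h Px i j"
    using eq by (simp only:)
  from arg_cong[OF this, of "\<lambda>u. mm m (coef d z (diag_comm d P)) (coef h z (diag_comm h P)) i j - u - diag_comm h Px i j"]
  show ?thesis by simp
qed

text \<open>\<open>W t\<close> is specified separately for each \<open>t\<close>, without any
  regularity in \<open>t\<close>; that is derived in \<open>W_t_deriv\<close>.\<close>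

locale nonlinear_optics =
  fixes m :: nat and a :: real and d h :: "nat \<Rightarrow> real" and M0 :: real
    and r rx rt :: "real \<Rightarrow> real \<Rightarrow> nat \<Rightarrow> nat \<Rightarrow> complex"
    and W :: "real \<Rightarrow> real \<Rightarrow> complex \<Rightarrow> nat \<Rightarrow> nat \<Rightarrow> complex"
    and R :: "real \<Rightarrow> complex \<Rightarrow> nat \<Rightarrow> nat \<Rightarrow> complex"
  assumes sys: "\<And>t. t \<in> {0..<a} \<Longrightarrow> skew_system m d (\<lambda>x. diag_comm d (r x t)) (W t) M0"
    and h_pos: "\<And>i. i < m \<Longrightarrow> 0 < h i"
    and h_skew: "\<And>x t. 0 \<le> x \<Longrightarrow> t \<in> {0..<a} \<Longrightarrow> skew m (diag_comm h (r x t))"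
    and r_x: "\<And>x t i j. 0 \<le> x \<Longrightarrow> t \<in> {0..<a} \<Longrightarrow> i < m \<Longrightarrow> j < m \<Longrightarrow>
      ((\<lambda>x. r x t i j) has_vector_derivative rx x t i j) (at x within {0..})"
    and r_t: "\<And>x t i j. 0 \<le> x \<Longrightarrow> t \<in> {0..<a} \<Longrightarrow> i < m \<Longrightarrow> j < m \<Longrightarrow>
      ((\<lambda>t. r x t i j) has_vector_derivative rt x t i j) (at t within {0..<a})"
    and rt_continuous: "\<And>i j. i < m \<Longrightarrow> j < m \<Longrightarrow> continuous_on ({0..} \<times> {0..<a}) (\<lambda>(x, t). rt x t i j)"
    and optics: "\<And>x t i j. 0 \<le> x \<Longrightarrow> t \<in> {0..<a} \<Longrightarrow> i < m \<Longrightarrow> j < m \<Longrightarrow>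
      diag_comm d (rt x t) i j - diag_comm h (rx x t) i j =
      mm m (diag_comm d (r x t)) (diag_comm h (r x t)) i j - mm m (diag_comm h (r x t)) (diag_comm d (r x t)) i j"
    and R_0: "\<And>z i j. i < m \<Longrightarrow> j < m \<Longrightarrow> R 0 z i j = (if i = j then 1 else 0)"
    and R_deriv: "\<And>t z i j. t \<in> {0..<a} \<Longrightarrow> i < m \<Longrightarrow> j < m \<Longrightarrow>
      ((\<lambda>t. R t z i j) has_vector_derivative mm m (coef h z (diag_comm h (r 0 t))) (R t z) i j) (at t within {0..<a})"
begin

abbreviation G :: "real \<Rightarrow> real \<Rightarrow> complex \<Rightarrow> nat \<Rightarrow> nat \<Rightarrow> complex" where
  "G x t z \<equiv> coef h z (diag_comm h (r x t))"

abbreviation F :: "real \<Rightarrow> real \<Rightarrow> complex \<Rightarrow> nat \<Rightarrow> nat \<Rightarrow> complex" where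
  "F x t z \<equiv> coef d z (diag_comm d (r x t))"

text \<open>
  The commutator-like combination \<open>G w - w G\<^sub>0\<close> satisfies the equation obtained by
  formally differentiating \<open>w\<^sub>x = F w\<close> in \<open>t\<close>; this is the zero curvature condition
  \<open>F\<^sub>t - G\<^sub>x + F G - G F = 0\<close>.
\<close>

lemma W_t_deriv:
  assumes x: "0 \<le> x" and t: "t \<in> {0..<a}" and ij: "i < m" "j < m"
  shows "((\<lambda>t. W t x z i j) has_vector_derivative
    mm m (G x t z) (W t x z) i j - mm m (W t x z) (G 0 t z) i j) (at t within {0..<a})"
proof -
  interpret skew_system m d "\<lambda>x. diag_comm d (r x t)" "W t" M0 by (rule sys[OF t])
  define p where "p s i = mm m (G s t z) (W t s z) i j - mm m (W t s z) (G 0 t z) i j" for s i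
  have Wd: "((\<lambda>s. W \<tau> s z i l) has_vector_derivative mm m (F s \<tau> z) (W \<tau> s z) i l) (at s within {0..x})"
    if "\<tau> \<in> {0..<a}" "s \<in> {0..x}" "i < m" "l < m" for \<tau> s i l
    using that by (intro has_vector_derivative_within_subset[OF skew_system.W_deriv[OF sys]]) auto
  have p: "((\<lambda>s. p s i) has_vector_derivative
      mv m (F s t z) (p s) i + mv m (\<lambda>i j. - diag_comm d (rt s t) i j) (\<lambda>l. W t s z l j) i) (at s within {0..x})"
    if s: "s \<in> {0..x}" and i: "i < m" for s i
  proof -
    have Gd: "((\<lambda>s. G s t z i l) has_vector_derivative - diag_comm h (rx s t) i l) (at s within {0..x})"
      if "l < m" for l
    proof -
      have "((\<lambda>s. r s t i l) has_vector_derivative rx s t i l) (at s within {0..x})"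
        using s t i that by (intro has_vector_derivative_within_subset[OF r_x]) auto
      from has_vector_derivative_mult_right[OF this, of "of_real (h i - h l)"]
      have "((\<lambda>s. (if i = l then \<i> * z * h i else 0) - of_real (h i - h l) * r s t i l) has_vector_derivative
          0 - of_real (h i - h l) * rx s t i l) (at s within {0..x})"
        by (intro has_vector_derivative_diff has_vector_derivative_const)
      then show ?thesis by (simp add: coef_def diag_comm_def)
    qed
    have "((\<lambda>s. mm m (G s t z) (W t s z) i j) has_vector_derivative
        mm m (G s t z) (mm m (F s t z) (W t s z)) i j + mm m (\<lambda>i j. - diag_comm h (rx s t) i j) (W t s z) i j)
        (at s within {0..x})"
      using Wd[OF t s] ij by (intro mm_has_vector_derivative Gd)
    moreover have "((\<lambda>s. mm m (W t s z) (G 0 t z) i j) has_vector_derivative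
        mm m (W t s z) (\<lambda>_ _. 0) i j + mm m (mm m (F s t z) (W t s z)) (G 0 t z) i j) (at s within {0..x})"
      by (rule mm_has_vector_derivative[where A = "\<lambda>s. W t s z" and B = "\<lambda>_. G 0 t z"])
        (use Wd[OF t s i] in auto)
    ultimately have D: "((\<lambda>s. p s i) has_vector_derivative
        (mm m (G s t z) (mm m (F s t z) (W t s z)) i j + mm m (\<lambda>i j. - diag_comm h (rx s t) i j) (W t s z) i j) -
        (mm m (W t s z) (\<lambda>_ _. 0) i j + mm m (mm m (F s t z) (W t s z)) (G 0 t z) i j)) (at s within {0..x})"
      unfolding p_def by (rule has_vector_derivative_diff)
    \<comment> \<open>Zero curvature at work: exchanging \<open>G F\<close> for \<open>F G\<close>
      replaces the \<open>x\<close>-derivative of \<open>G\<close> by the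
      \<open>t\<close>-derivative of \<open>F\<close>.\<close>
    have e1: "mm m (G s t z) (mm m (F s t z) (W t s z)) i j + mm m (\<lambda>i j. - diag_comm h (rx s t) i j) (W t s z) i j
      = mm m (F s t z) (mm m (G s t z) (W t s z)) i j + mm m (\<lambda>i j. - diag_comm d (rt s t) i j) (W t s z) i j"
      unfolding mm_assoc[symmetric] mm_add_left[symmetric]
      using s t i by (intro mm_cong zero_curvature_coefficients optics) auto
    have e2: "mm m (mm m (F s t z) (W t s z)) (G 0 t z) i j = mm m (F s t z) (mm m (W t s z) (G 0 t z)) i j"
      by (rule mm_assoc)
    have e3: "mv m (F s t z) (p s) i = mm m (F s t z) (mm m (G s t z) (W t s z)) i j
        - mm m (F s t z) (mm m (W t s z) (G 0 t z)) i j"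
      by (simp add: p_def[abs_def] mv_diff) (simp add: mm_def[of m "F s t z"] mv_def)
    have e4: "mv m (\<lambda>i j. - diag_comm d (rt s t) i j) (\<lambda>l. W t s z l j) i
        = mm m (\<lambda>i j. - diag_comm d (rt s t) i j) (W t s z) i j"
      by (simp add: mm_def mv_def)
    have e5: "mm m (W t s z) (\<lambda>_ _. 0) i j = 0" by (simp add: mm_def)
    from D show ?thesis unfolding e1 e2 e3 e4 e5 by (simp add: algebra_simps)
  qed
  have "\<exists>B. \<forall>s\<in>{0..x}. cmod (diag_comm d (rt s t) i l) \<le> B" if "i < m" "l < m" for i l
  proof -
    have "continuous_on {0..x} (\<lambda>s. (\<lambda>(x, t). rt x t i l) (s, t))"
      using t by (intro continuous_on_compose2[OF rt_continuous[OF that]] continuous_intros) auto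
    then have "continuous_on {0..x} (\<lambda>s. diag_comm d (rt s t) i l)"
      unfolding diag_comm_def by (intro continuous_intros) auto
    then show ?thesis using continuous_on_compact_bound[of "{0..x}"] by (metis compact_Icc)
  qed
  then obtain b where b: "\<And>i l s. i < m \<Longrightarrow> l < m \<Longrightarrow> s \<in> {0..x} \<Longrightarrow> cmod (diag_comm d (rt s t) i l) \<le> b i l"
    by metis
  define B where "B = \<bar>cmod z * d 0 + M0\<bar> + (\<Sum>i<m. \<Sum>l<m. \<bar>b i l\<bar>)"
  have bB: "b i l \<le> (\<Sum>i<m. \<Sum>l<m. \<bar>b i l\<bar>)" if "i < m" "l < m" for i l
  proof -
    have "\<bar>b i l\<bar> \<le> (\<Sum>l<m. \<bar>b i l\<bar>)" using that by (intro member_le_sum) auto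
    also have "\<dots> \<le> (\<Sum>i<m. \<Sum>l<m. \<bar>b i l\<bar>)" using that by (intro member_le_sum) (auto intro: sum_nonneg)
    finally show ?thesis by simp
  qed
  have b_nonneg: "0 \<le> (\<Sum>i<m. \<Sum>l<m. \<bar>b i l\<bar>)" by (intro sum_nonneg) auto
  have T: "\<forall>\<^sub>F \<tau> in at t within {0..<a}. \<tau> \<noteq> t \<and> \<tau> \<in> {0..<a}"
    by (auto simp: eventually_at_filter)
  have "((\<lambda>\<tau>. (W \<tau> x z i j - W t x z i j) / of_real (\<tau> - t)) \<longlongrightarrow> p x i) (at t within {0..<a})"
  proof (rule linear_system_parameter_derivative[where X = x and m = m and y = "\<lambda>\<tau> s i. W \<tau> s z i j"
        and h = "\<lambda>\<tau>. of_real (\<tau> - t)" and A = "\<lambda>\<tau> s. F s \<tau> z" and L = "\<lambda>s. F s t z"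
        and L' = "\<lambda>s i j. - diag_comm d (rt s t) i j" and B = B])
    show "((\<lambda>s. W t s z i j) has_vector_derivative mv m (F s t z) (\<lambda>i. W t s z i j) i) (at s within {0..x})"
      if "s \<in> {0..x}" "i < m" for s i
      using Wd[OF t that ij(2)] by (simp add: mm_def mv_def)
    \<comment> \<open>The product with \<open>G 0 t z\<close> was subtracted for this purpose:
      \<open>W\<close> is the identity at 0, where both products reduce to
      \<open>G 0 t z\<close>.\<close>
    show "p 0 i = 0" if "i < m" for i
    proof -
      have "mm m (G 0 t z) (W t 0 z) i j = G 0 t z i j"
        using that ij by (simp add: mm_def W_0 sum.remove[of _ j])
      moreover have "mm m (W t 0 z) (G 0 t z) i j = G 0 t z i j"
        using that ij by (simp add: mm_def W_0 sum.remove[of _ i])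
      ultimately show ?thesis by (simp add: p_def)
    qed
    show "\<forall>\<^sub>F \<tau> in at t within {0..<a}. of_real (\<tau> - t) \<noteq> (0::complex) \<and> (\<forall>i<m. W \<tau> 0 z i j = W t 0 z i j \<and>
       (\<forall>s\<in>{0..x}. ((\<lambda>s. W \<tau> s z i j) has_vector_derivative mv m (F s \<tau> z) (\<lambda>i. W \<tau> s z i j) i) (at s within {0..x})))"
      using T
    proof eventually_elim
      case (elim \<tau>)
      then show ?case
        using Wd[of \<tau> _ _ j] ij(2) skew_system.W_0[OF sys] t by (auto simp: mm_def mv_def)
    qed
    show "((\<lambda>\<tau>. complex_of_real (\<tau> - t)) \<longlongrightarrow> 0) (at t within {0..<a})"
      by (auto intro!: tendsto_eq_intros)
    show "\<forall>\<^sub>F \<tau> in at t within {0..<a}. \<forall>s\<in>{0..x}. \<forall>i<m. \<forall>l<m.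
        cmod ((F s \<tau> z i l - F s t z i l) / of_real (\<tau> - t) - - diag_comm d (rt s t) i l) \<le> \<epsilon>" if "0 < \<epsilon>" for \<epsilon>
    proof -
      \<comment> \<open>All \<open>d i\<close> lie between 0 and \<open>d 0\<close>, so passing from
        \<open>r\<close> to its commutator enlarges errors at most by the factor
        \<open>d 0\<close>.\<close>
      define \<epsilon>' where "\<epsilon>' = \<epsilon> / d 0"
      have d0: "0 < d 0" using d_pos ij by auto
      have "\<forall>\<^sub>F \<tau> in at t within {0..<a}. \<forall>i\<in>{..<m}. \<forall>l\<in>{..<m}. \<forall>s\<in>{0..x}.
          cmod ((r s \<tau> i l - r s t i l) / of_real (\<tau> - t) - rt s t i l) \<le> \<epsilon>'"
        using that d0 t r_t rt_continuous
        by (intro eventually_ball_finite ballI uniform_difference_quotient) (auto simp: \<epsilon>'_def)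
      then show ?thesis
      proof eventually_elim
        case (elim \<tau>)
        show ?case
        proof (intro ballI allI impI)
          fix s i l assume s: "s \<in> {0..x}" and il: "i < m" "l < m"
          have "(F s \<tau> z i l - F s t z i l) / of_real (\<tau> - t) - - diag_comm d (rt s t) i l =
              - of_real (d i - d l) * ((r s \<tau> i l - r s t i l) / of_real (\<tau> - t) - rt s t i l)"
          proof -
            have "F s \<tau> z i l - F s t z i l = - of_real (d i - d l) * (r s \<tau> i l - r s t i l)"
              by (simp add: coef_def diag_comm_def algebra_simps)
            then show ?thesis by (simp only: diag_comm_def, simp add: right_diff_distrib, simp add: algebra_simps)
          qed
          then have "cmod ((F s \<tau> z i l - F s t z i l) / of_real (\<tau> - t) - - diag_comm d (rt s t) i l) =
              \<bar>d i - d l\<bar> * cmod ((r s \<tau> i l - r s t i l) / of_real (\<tau> - t) - rt s t i l)"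
            by (simp only: norm_mult norm_minus_cancel norm_of_real)
          also have "\<dots> \<le> d 0 * \<epsilon>'"
          proof (rule mult_mono)
            show "\<bar>d i - d l\<bar> \<le> d 0"
              using d_antimono[of 0 i] d_antimono[of 0 l] d_pos[of i] d_pos[of l] il by auto
          qed (use elim s il d0 in auto)
          finally show "cmod ((F s \<tau> z i l - F s t z i l) / of_real (\<tau> - t) - - diag_comm d (rt s t) i l) \<le> \<epsilon>"
            using d0 by (simp add: \<epsilon>'_def)
        qed
      qed
    qed
    show "cmod (F s t z i l) \<le> B" if "s \<in> {0..x}" "i < m" "l < m" for s i l
      using coef_bound[of s i l z] that b_nonneg unfolding B_def by auto
    show "cmod (- diag_comm d (rt s t) i l) \<le> B" if "s \<in> {0..x}" "i < m" "l < m" for s i l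
    proof -
      have "cmod (- diag_comm d (rt s t) i l) \<le> b i l" using b[OF that(2,3,1)] by simp
      then show ?thesis using bB[OF that(2,3)] unfolding B_def by linarith
    qed
    show "0 \<le> B" using b_nonneg by (simp add: B_def)
  qed (use p x ij in auto)
  then have "((\<lambda>\<tau>. (W \<tau> x z i j - W t x z i j) /\<^sub>R (\<tau> - t)) \<longlongrightarrow> p x i) (at t within {0..<a})"
    by (simp add: scaleR_conv_of_real divide_inverse mult.commute)
  then show ?thesis
    by (simp add: has_vector_derivative_iff_difference_quotient p_def)
qed

text \<open>In the product rule the term from \<open>R_t = G 0 R\<close> cancels the term
  \<open>- W (G 0) R\<close> from \<open>W_t_deriv\<close>. The product \<open>V\<close> thus solves
  \<open>V_t = G x t V\<close> at fixed \<open>x\<close>, and only the diagonal part of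
  \<open>G\<close> affects its energy.\<close>

lemma transported_energy:
  assumes x: "0 \<le> x" and t: "t \<in> {0..<a}"
  shows "((\<lambda>t. sqn m (mv m (W t x z) (mv m (R t z) v))) has_real_derivative
    - 2 * Im z * (\<Sum>i<m. h i * (cmod (mv m (W t x z) (mv m (R t z) v) i))\<^sup>2)) (at t within {0..<a})"
proof -
  define V where "V t = mv m (W t x z) (mv m (R t z) v)" for t
  have "((\<lambda>t. V t i) has_vector_derivative mv m (G x t z) (V t) i) (at t within {0..<a})" if i: "i < m" for i
  proof -
    have Rd: "((\<lambda>t. mv m (R t z) v l) has_vector_derivative mv m (G 0 t z) (mv m (R t z) v) l) (at t within {0..<a})"
      if "l < m" for l
    proof -
      have "((\<lambda>t. \<Sum>j<m. R t z l j * v j) has_vector_derivative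
          (\<Sum>j<m. mm m (G 0 t z) (R t z) l j * v j)) (at t within {0..<a})"
        using that t by (intro has_vector_derivative_sum has_vector_derivative_mult_left R_deriv) auto
      then show ?thesis by (simp add: mv_mm[symmetric]) (simp add: mv_def)
    qed
    have "((\<lambda>t. V t i) has_vector_derivative (\<Sum>l<m. W t x z i l * mv m (G 0 t z) (mv m (R t z) v) l +
       (mm m (G x t z) (W t x z) i l - mm m (W t x z) (G 0 t z) i l) * mv m (R t z) v l)) (at t within {0..<a})"
      unfolding V_def mv_def[of m "W _ x z"]
      using x t i by (intro has_vector_derivative_sum has_vector_derivative_mult W_t_deriv Rd) auto
    also have "(\<Sum>l<m. W t x z i l * mv m (G 0 t z) (mv m (R t z) v) l +
       (mm m (G x t z) (W t x z) i l - mm m (W t x z) (G 0 t z) i l) * mv m (R t z) v l) =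
       mv m (W t x z) (mv m (G 0 t z) (mv m (R t z) v)) i + mv m (mm m (G x t z) (W t x z)) (mv m (R t z) v) i
       - mv m (mm m (W t x z) (G 0 t z)) (mv m (R t z) v) i"
      unfolding mv_def[of m "W t x z" _ i] mv_def[of m "mm m _ _" _ i]
      by (simp add: sum.distrib sum_subtractf left_diff_distrib)
    also have "\<dots> = mv m (G x t z) (V t) i" by (simp add: mv_mm V_def)
    finally show ?thesis .
  qed
  from weighted_square_has_derivative[of m V, OF this, where s = "\<lambda>_. 1", unfolded energy_rate[OF h_skew[OF x t]]]
  show ?thesis by (simp add: sqn_def V_def)
qed

lemma W_R_initial: "mv m (W 0 x z) (mv m (R 0 z) v) i = mv m (W 0 x z) v i"
  by (intro mv_cong) (simp add: mv_def R_0 sum.remove)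

text \<open>What matters is that the exponential factor is independent of \<open>x\<close>. The sum
  of the \<open>h i\<close> is a convenient common upper bound for all of them.\<close>

lemma transported_upper:
  assumes z: "Im z \<le> 0" and x: "0 \<le> x" and t: "t \<in> {0..<a}"
  shows "sqn m (mv m (W t x z) (mv m (R t z) v)) \<le>
    exp (- 2 * Im z * (\<Sum>i<m. h i) * t) * sqn m (mv m (W 0 x z) v)"
proof -
  define H where "H = - 2 * Im z * (\<Sum>i<m. h i)"
  define N where "N t = sqn m (mv m (W t x z) (mv m (R t z) v))" for t
  define N' where "N' t = - 2 * Im z * (\<Sum>i<m. h i * (cmod (mv m (W t x z) (mv m (R t z) v) i))\<^sup>2)" for t
  have "exp (- H * t) * N t \<le> exp (- H * 0) * N 0"
  proof (rule antimono_within[of "{0..<a}" "\<lambda>t. exp (- H * t) * N t" "\<lambda>t. exp (- H * t) * (N' t - H * N t)"])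
    fix t assume t: "t \<in> {0..<a}"
    have "((\<lambda>t. exp (- H * t)) has_real_derivative - H * exp (- H * t)) (at t within {0..<a})"
      by (auto intro!: derivative_eq_intros)
    from DERIV_mult[OF this transported_energy[OF x t, of z v, folded N_def N'_def]]
    show "((\<lambda>t. exp (- H * t) * N t) has_real_derivative exp (- H * t) * (N' t - H * N t)) (at t within {0..<a})"
      by (simp add: algebra_simps)
    have "h i \<le> (\<Sum>i<m. h i)" if "i < m" for i
      using that h_pos by (intro member_le_sum) (auto intro: less_imp_le)
    then have "(\<Sum>i<m. h i * (cmod (mv m (W t x z) (mv m (R t z) v) i))\<^sup>2) \<le> (\<Sum>i<m. h i) * N t"
      unfolding N_def sqn_def sum_distrib_left[of "\<Sum>i<m. h i"] by (intro sum_mono mult_right_mono) auto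
    then have "N' t \<le> - 2 * Im z * ((\<Sum>i<m. h i) * N t)"
      unfolding N'_def using z by (intro mult_left_mono) auto
    then show "exp (- H * t) * (N' t - H * N t) \<le> 0"
      by (intro mult_nonneg_nonpos) (auto simp: H_def mult.assoc)
  qed (use t in auto)
  then have le: "exp (H * t) * (exp (- H * t) * N t) \<le> exp (H * t) * N 0" by (intro mult_left_mono) auto
  have "N t = exp (H * t) * (exp (- H * t) * N t)" by (simp add: exp_minus)
  also note le
  also have "N 0 = sqn m (mv m (W 0 x z) v)"
    using t x by (simp add: N_def sqn_def W_R_initial)
  finally have "N t \<le> exp (H * t) * sqn m (mv m (W 0 x z) v)" .
  then show ?thesis by (simp only: N_def H_def)
qed

text \<open>The transported energy at \<open>x = 0\<close>, where \<open>W\<close> is the identity,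
  is nondecreasing in \<open>t\<close>. This supplies the injectivity of
  \<open>R t z\<close>.\<close>

lemma R_expanding:
  assumes z: "Im z \<le> 0" and t: "t \<in> {0..<a}"
  shows "sqn m v \<le> sqn m (mv m (R t z) v)"
proof -
  define N where "N t = sqn m (mv m (W t 0 z) (mv m (R t z) v))" for t
  have N: "N t = sqn m (mv m (R t z) v)" if "t \<in> {0..<a}" for t
    using skew_system.sol_0[OF sys[OF that]] by (simp add: N_def sqn_def skew_system.sol_def[OF sys[OF that]])
  have "- N t \<le> - N 0"
  proof (rule antimono_within[of "{0..<a}" "\<lambda>t. - N t"
        "\<lambda>t. - (- 2 * Im z * (\<Sum>i<m. h i * (cmod (mv m (W t 0 z) (mv m (R t z) v) i))\<^sup>2))"])
    fix t assume t: "t \<in> {0..<a}"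
    then show "((\<lambda>t. - N t) has_real_derivative
      - (- 2 * Im z * (\<Sum>i<m. h i * (cmod (mv m (W t 0 z) (mv m (R t z) v) i))\<^sup>2))) (at t within {0..<a})"
      unfolding N_def by (intro DERIV_minus transported_energy) auto
    have "0 \<le> - Im z * (\<Sum>i<m. h i * (cmod (mv m (W t 0 z) (mv m (R t z) v) i))\<^sup>2)"
      using z h_pos by (intro mult_nonneg_nonneg sum_nonneg) (auto simp: less_imp_le)
    then show "- (- 2 * Im z * (\<Sum>i<m. h i * (cmod (mv m (W t 0 z) (mv m (R t z) v) i))\<^sup>2)) \<le> 0" by simp
  qed (use t in auto)
  moreover have "N 0 = sqn m v" using t by (simp add: N sqn_def mv_def R_0 sum.remove)
  ultimately show ?thesis using N[OF t] by simp
qed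

lemma subordinate_transport:
  assumes z: "Im z \<le> 0" and t: "t \<in> {0..<a}"
    and v: "skew_system.subordinate m d (W 0) k z v"
  shows "skew_system.subordinate m d (W t) k z (mv m (R t z) v)"
proof -
  have 0: "0 \<in> {0..<a}" using t by auto
  note defs = skew_system.subordinate_def[OF sys] skew_system.growth_def[OF sys] skew_system.rate_def[OF sys] skew_system.sol_def[OF sys]
  define c where "c = - Im z * (d (k - 1) + d k)"
  obtain C where C: "\<And>x. 0 \<le> x \<Longrightarrow> exp (- c * x) * sqn m (mv m (W 0 x z) v) \<le> C"
    using v unfolding defs[OF 0] c_def by auto
  define E where "E = exp (- 2 * Im z * (\<Sum>i<m. h i) * t)"
  have "exp (- c * x) * sqn m (mv m (W t x z) (mv m (R t z) v)) \<le> E * C" if x: "0 \<le> x" for x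
  proof -
    have "exp (- c * x) * sqn m (mv m (W t x z) (mv m (R t z) v)) \<le> exp (- c * x) * (E * sqn m (mv m (W 0 x z) v))"
      using transported_upper[OF z x t] unfolding E_def by (intro mult_left_mono) auto
    also have "\<dots> = E * (exp (- c * x) * sqn m (mv m (W 0 x z) v))" by simp
    also have "\<dots> \<le> E * C" using C[OF x] by (intro mult_left_mono) (auto simp: E_def)
    finally show ?thesis .
  qed
  then show ?thesis unfolding defs[OF t] c_def by blast
qed

end

section \<open>Matrices\<close>

lemma l2_norm_sqn: "dim_vec v = m \<Longrightarrow> l2_norm v = sqrt (sqn m (\<lambda>i. v $ i))"
  by (simp add: l2_norm_def L2_set_def sqn_def)

lemma l2_norm_nonneg [simp]: "0 \<le> l2_norm v"
  by (simp add: l2_norm_def L2_set_nonneg)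

lemma cmod_le_l2_norm: "i < dim_vec v \<Longrightarrow> cmod (v $ i) \<le> l2_norm v"
  using cmod_le_sqrt_sqn[of i "dim_vec v" "\<lambda>i. v $ i"] by (simp add: l2_norm_sqn)

lemma l2_norm_smult: "l2_norm (c \<cdot>\<^sub>v v) = cmod c * l2_norm v"
proof -
  have "sqn (dim_vec v) (\<lambda>i. (c \<cdot>\<^sub>v v) $ i) = (cmod c)\<^sup>2 * sqn (dim_vec v) (\<lambda>i. v $ i)"
    by (simp add: sqn_def norm_mult power_mult_distrib sum_distrib_left)
  then show ?thesis by (simp add: l2_norm_sqn[of _ "dim_vec v"] real_sqrt_mult)
qed

text \<open>A crude bound whose only task is finiteness of suprema: over the unit ball in
  \<open>mat_norm\<close>, and over the strip in the definition of \<open>M0\<close>.\<close>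

lemma l2_norm_mult_vec_le_entries:
  assumes A: "A \<in> carrier_mat m m" and v: "v \<in> carrier_vec m"
    and K: "\<And>i j. i < m \<Longrightarrow> j < m \<Longrightarrow> cmod (A $$ (i, j)) \<le> K"
  shows "l2_norm (A *\<^sub>v v) \<le> m * (m * K * l2_norm v)"
proof -
  have "l2_norm (A *\<^sub>v v) \<le> (\<Sum>i<m. cmod ((A *\<^sub>v v) $ i))"
    using A unfolding l2_norm_def by (intro order_trans[OF L2_set_le_sum]) auto
  also have "\<dots> \<le> (\<Sum>i<m. m * K * l2_norm v)"
  proof (rule sum_mono)
    fix i assume i: "i \<in> {..<m}"
    have "(A *\<^sub>v v) $ i = mv m (\<lambda>i j. A $$ (i, j)) (\<lambda>j. v $ j) i"
      using A v i by (simp add: scalar_prod_def mv_def atLeast0LessThan)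
    moreover have "0 \<le> K" using i by (intro order_trans[OF norm_ge_zero K[of i i]]) auto
    ultimately show "cmod ((A *\<^sub>v v) $ i) \<le> m * K * l2_norm v"
      using K i v cmod_le_l2_norm[of _ v] by (auto intro!: cmod_mv_le)
  qed
  finally show ?thesis by simp
qed

lemma bdd_above_mat_norm:
  assumes A: "A \<in> carrier_mat m m"
  shows "bdd_above ((\<lambda>v. l2_norm (A *\<^sub>v v)) ` {v \<in> carrier_vec (dim_col A). l2_norm v \<le> 1})"
proof -
  define K where "K = (\<Sum>p\<in>{..<m} \<times> {..<m}. cmod (A $$ p))"
  have K: "cmod (A $$ (i, j)) \<le> K" if "i < m" "j < m" for i j
    unfolding K_def using that by (intro member_le_sum[where f = "\<lambda>p. cmod (A $$ p)"]) auto
  have "0 \<le> K" unfolding K_def by (intro sum_nonneg) auto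
  then have "m * (m * K * l2_norm v) \<le> m * (m * K * 1)" if "l2_norm v \<le> 1" for v
    using that by (intro mult_left_mono mult_nonneg_nonneg) auto
  then show ?thesis
    using l2_norm_mult_vec_le_entries[OF A _ K] A
    by (intro bdd_aboveI2[of _ _ "m * (m * K * 1)"]) (force intro: order_trans)
qed

lemma l2_norm_mult_vec_le:
  assumes A: "A \<in> carrier_mat m m" and v: "v \<in> carrier_vec m"
  shows "l2_norm (A *\<^sub>v v) \<le> mat_norm A * l2_norm v"
proof (cases "l2_norm v = 0")
  case True
  have "v = 0\<^sub>v m"
  proof (rule eq_vecI)
    show "v $ i = 0\<^sub>v m $ i" if "i < dim_vec (0\<^sub>v m :: complex Matrix.vec)" for i
      using cmod_le_l2_norm[of i v] that v True by auto
  qed (use v in auto)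
  then have "A *\<^sub>v v = 0\<^sub>v m" using A by (intro eq_vecI) auto
  then show ?thesis using True by (simp add: l2_norm_def L2_set_def)
next
  case False
  define c where "c = l2_norm v"
  have c: "0 < c" using False l2_norm_nonneg[of v] unfolding c_def by linarith
  define u where "u = complex_of_real (1 / c) \<cdot>\<^sub>v v"
  have "l2_norm u = 1" using c by (simp add: u_def l2_norm_smult c_def norm_divide)
  then have "l2_norm (A *\<^sub>v u) \<le> mat_norm A"
    unfolding mat_norm_def using A v
    by (intro cSUP_upper bdd_above_mat_norm[OF A]) (auto simp: u_def)
  moreover have "A *\<^sub>v u = complex_of_real (1 / c) \<cdot>\<^sub>v (A *\<^sub>v v)"
    using A v unfolding u_def by (intro mult_mat_vec) auto
  ultimately have "l2_norm (A *\<^sub>v v) / c \<le> mat_norm A"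
    using c by (simp add: l2_norm_smult norm_divide)
  then show ?thesis using c by (simp add: c_def[symmetric] field_simps)
qed

lemma mat_norm_le_entries:
  assumes A: "A \<in> carrier_mat m m" and K: "\<And>i j. i < m \<Longrightarrow> j < m \<Longrightarrow> cmod (A $$ (i, j)) \<le> K" and "0 \<le> K"
  shows "mat_norm A \<le> m * (m * K)"
  unfolding mat_norm_def
proof (rule cSUP_least)
  have "0\<^sub>v m \<in> {v \<in> carrier_vec (dim_col A). l2_norm v \<le> 1}"
    using A by (simp add: l2_norm_def L2_set_def)
  then show "{v \<in> carrier_vec (dim_col A). l2_norm v \<le> 1} \<noteq> {}" by blast
  fix v assume "v \<in> {v \<in> carrier_vec (dim_col A). l2_norm v \<le> 1}"
  then have v: "v \<in> carrier_vec m" "l2_norm v \<le> 1" using A by auto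
  have "l2_norm (A *\<^sub>v v) \<le> m * (m * K * l2_norm v)" by (rule l2_norm_mult_vec_le_entries[OF A v(1) K])
  also have "\<dots> \<le> m * (m * K * 1)"
    using v(2) \<open>0 \<le> K\<close> by (intro mult_left_mono mult_nonneg_nonneg) auto
  finally show "l2_norm (A *\<^sub>v v) \<le> m * (m * K)" by simp
qed

lemma cmod_entry_le_mat_norm:
  assumes A: "A \<in> carrier_mat m m" and ij: "i < m" "j < m"
  shows "cmod (A $$ (i, j)) \<le> mat_norm A"
proof -
  have "l2_norm (unit_vec m j :: complex Matrix.vec) = 1"
    using ij by (simp add: l2_norm_sqn[of _ m] sqn_def sum.remove[of _ j])
  moreover have "(A *\<^sub>v unit_vec m j) $ i = A $$ (i, j)"
    using A ij by simp
  ultimately show ?thesis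
    using l2_norm_mult_vec_le[OF A, of "unit_vec m j"] cmod_le_l2_norm[of i "A *\<^sub>v unit_vec m j"] A ij by simp
qed

text \<open>Cauchy-Schwarz together with the operator norm; this is the source of
  \<open>Z_bound\<close>.\<close>

lemma sesquilinear_le_mat_norm:
  assumes A: "A \<in> carrier_mat m m"
  shows "cmod (\<Sum>i<m. cnj (a i) * mv m (\<lambda>i j. A $$ (i, j)) b i) \<le> mat_norm A * sqrt (sqn m a) * sqrt (sqn m b)"
proof -
  define v where "v = Matrix.vec m b"
  have v: "v \<in> carrier_vec m" by (simp add: v_def)
  have lv: "l2_norm v = sqrt (sqn m b)" by (simp add: l2_norm_sqn[of _ m] v_def sqn_def)
  have Av: "(A *\<^sub>v v) $ i = mv m (\<lambda>i j. A $$ (i, j)) b i" if "i < m" for i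
    using A that by (simp add: v_def scalar_prod_def mv_def atLeast0LessThan)
  have "cmod (\<Sum>i<m. cnj (a i) * mv m (\<lambda>i j. A $$ (i, j)) b i) \<le>
      (\<Sum>i<m. \<bar>cmod (a i)\<bar> * \<bar>cmod (mv m (\<lambda>i j. A $$ (i, j)) b i)\<bar>)"
    by (rule order_trans[OF norm_sum]) (simp add: norm_mult)
  also have "\<dots> \<le> sqrt (sqn m a) * sqrt (sqn m (mv m (\<lambda>i j. A $$ (i, j)) b))"
    unfolding sqn_def L2_set_def[symmetric] by (rule L2_set_mult_ineq)
  also have "sqrt (sqn m (mv m (\<lambda>i j. A $$ (i, j)) b)) = l2_norm (A *\<^sub>v v)"
    using A by (simp add: l2_norm_sqn[of _ m] sqn_def Av del: index_mult_mat_vec)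
  also have "sqrt (sqn m a) * l2_norm (A *\<^sub>v v) \<le> sqrt (sqn m a) * (mat_norm A * sqrt (sqn m b))"
    using l2_norm_mult_vec_le[OF A v] lv by (intro mult_left_mono) auto
  finally show ?thesis by (simp add: mult_ac)
qed

section \<open>Matrix entries and the Weyl integrand in coordinates\<close>

lemma real_diag_carrier [simp]: "real_diag m d \<in> carrier_mat m m"
  by (simp add: real_diag_def)

lemma dim_real_diag [simp]: "dim_row (real_diag m d) = m" "dim_col (real_diag m d) = m"
  by (simp_all add: real_diag_def mat_diag_def)

lemma commutator_carrier: "A \<in> carrier_mat m m \<Longrightarrow> commutator (real_diag m d) A \<in> carrier_mat m m"
  unfolding commutator_def by (intro minus_carrier_mat mult_carrier_mat) auto

lemma commutator_real_diag:
  assumes "A \<in> carrier_mat m m" "i < m" "j < m"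
  shows "commutator (real_diag m d) A $$ (i, j) = diag_comm d (\<lambda>i j. A $$ (i, j)) i j"
  using assms by (simp add: commutator_def real_diag_def mat_diag_mult_left mat_diag_mult_right diag_comm_def algebra_simps)

lemma index_mult_mm:
  assumes "A \<in> carrier_mat m m" "B \<in> carrier_mat m m" "i < m" "j < m"
  shows "(A * B) $$ (i, j) = mm m (\<lambda>i j. A $$ (i, j)) (\<lambda>i j. B $$ (i, j)) i j"
  using assms by (simp add: scalar_prod_def mm_def atLeast0LessThan)

lemma index_coef:
  assumes "A \<in> carrier_mat m m" "i < m" "j < m"
  shows "(((\<i> * z) \<cdot>\<^sub>m real_diag m d - commutator (real_diag m d) A)) $$ (i, j) =
    coef d z (diag_comm d (\<lambda>i j. A $$ (i, j))) i j"
proof -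
  have "real_diag m d $$ (i, j) = (if i = j then of_real (d i) else 0)"
    using assms by (simp add: real_diag_def mat_diag_def)
  then show ?thesis
    using assms commutator_carrier[OF assms(1), of d] real_diag_carrier[of m d]
    by (simp add: commutator_real_diag coef_def)
qed

lemma mat_adjoint_index:
  "i < dim_col A \<Longrightarrow> j < dim_row A \<Longrightarrow> mat_adjoint A $$ (i, j) = cnj (A $$ (j, i))"
  by (simp add: mat_adjoint_def mat_of_rows_index conjugate_complex_def)

lemma mat_adjoint_carrier: "A \<in> carrier_mat m m \<Longrightarrow> mat_adjoint A \<in> carrier_mat m m"
  by (rule carrier_matI) (simp_all add: mat_adjoint_def)

text \<open>On the diagonal the two outer exponentials multiply to a real weight, and the entry
  becomes the weighted squared norm of the solution that starts in column \<open>j\<close> of the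
  Weyl function.\<close>

lemma weyl_integrand_diagonal:
  assumes \<phi>: "\<phi> z \<in> carrier_mat m m" and w: "w x z \<in> carrier_mat m m" and j: "j < m"
  shows "weyl_integrand m d w \<phi> r z x $$ (j, j) =
    of_real (exp (- (- 2 * Im z * d j + r) * x) * sqn m (mv m (\<lambda>i j. w x z $$ (i, j)) (\<lambda>i. \<phi> z $$ (i, j))))"
proof -
  define P where "P = w x z * \<phi> z"
  define Q where "Q = mat_adjoint (\<phi> z) * mat_adjoint (w x z)"
  define e1 where "e1 j = exp (\<i> * cnj z * of_real x * of_real (d j))" for j
  define e2 where "e2 j = exp (- (\<i> * z * of_real (d j) + of_real r) * of_real x)" for j
  note c = \<phi> w mat_adjoint_carrier[OF \<phi>] mat_adjoint_carrier[OF w]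
  have PQ: "P \<in> carrier_mat m m" "Q \<in> carrier_mat m m" using c by (auto simp: P_def Q_def)
  have P: "P $$ (l, j) = mv m (\<lambda>i j. w x z $$ (i, j)) (\<lambda>i. \<phi> z $$ (i, j)) l" if "l < m" for l
    unfolding P_def using index_mult_mm[OF w \<phi> that j] by (simp add: mm_def mv_def)
  have Q: "Q $$ (j, l) = cnj (P $$ (l, j))" if "l < m" for l
  proof -
    have "Q $$ (j, l) = (\<Sum>s<m. cnj (\<phi> z $$ (s, j)) * cnj (w x z $$ (l, s)))"
      unfolding Q_def using c j that
      by (simp add: index_mult_mm[of _ m] mm_def mat_adjoint_index del: index_mult_mat)
    then show ?thesis using P[OF that] by (simp add: mv_def mult.commute)
  qed
  have "weyl_integrand m d w \<phi> r z x = mat_diag m e1 * mat_adjoint (\<phi> z) * mat_adjoint (w x z) * w x z * \<phi> z * mat_diag m e2"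
    by (simp add: weyl_integrand_def e1_def[abs_def] e2_def[abs_def])
  also have "mat_diag m e1 * mat_adjoint (\<phi> z) * mat_adjoint (w x z) * w x z * \<phi> z = mat_diag m e1 * (Q * P)"
    unfolding P_def Q_def using c by (simp add: assoc_mult_mat[of _ m m _ m _ m])
  finally have "weyl_integrand m d w \<phi> r z x $$ (j, j) = e1 j * (Q * P) $$ (j, j) * e2 j"
    using PQ j by (simp add: mat_diag_mult_left[of _ m m] mat_diag_mult_right[of _ m m] del: index_mult_mat)
  also have "(Q * P) $$ (j, j) = (\<Sum>l<m. cnj (P $$ (l, j)) * P $$ (l, j))"
    using index_mult_mm[OF PQ(2,1) j j] by (simp add: mm_def Q)
  also have "\<dots> = of_real (sqn m (mv m (\<lambda>i j. w x z $$ (i, j)) (\<lambda>i. \<phi> z $$ (i, j))))"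
    by (simp add: sqn_def P complex_norm_square mult.commute del: of_real_power)
  also have "e1 j * of_real (sqn m (mv m (\<lambda>i j. w x z $$ (i, j)) (\<lambda>i. \<phi> z $$ (i, j)))) * e2 j =
      (e1 j * e2 j) * of_real (sqn m (mv m (\<lambda>i j. w x z $$ (i, j)) (\<lambda>i. \<phi> z $$ (i, j))))" by simp
  also have "e1 j * e2 j = of_real (exp (- (- 2 * Im z * d j + r) * x))"
  proof -
    have "\<i> * cnj z * of_real x * of_real (d j) + - (\<i> * z * of_real (d j) + of_real r) * of_real x
        = of_real (- (- 2 * Im z * d j + r) * x)"
      by (simp add: complex_eq_iff algebra_simps)
    then show ?thesis unfolding e1_def e2_def exp_add[symmetric] by (simp only: exp_of_real)
  qed
  finally show ?thesis by simp
qed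

lemma open_lower_half_plane: "open (lower_half_plane M)"
  unfolding lower_half_plane_def by (rule open_halfspace_Im_lt)

lemma connected_lower_half_plane: "connected (lower_half_plane M)"
  unfolding lower_half_plane_def by (intro convex_connected convex_halfspace_Im_lt)

lemma lower_half_plane_nonempty: "lower_half_plane M \<noteq> {}"
proof -
  have "Complex 0 (- M - 1) \<in> lower_half_plane M" by (simp add: lower_half_plane_def)
  then show ?thesis by blast
qed

lemma upper_triangular_injective:
  fixes A :: "nat \<Rightarrow> nat \<Rightarrow> complex"
  assumes A: "\<And>i. i < m \<Longrightarrow> A i i = 1" "\<And>i j. j < i \<Longrightarrow> i < m \<Longrightarrow> A i j = 0"
    and v: "\<And>i. i < m \<Longrightarrow> mv m A v i = 0" and i: "i < m"
  shows "v i = 0"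
  using i
\<comment> \<open>Back substitution from the last row upwards, hence the measure
  \<open>m - i\<close>.\<close>
proof (induction "m - i" arbitrary: i rule: less_induct)
  case less
  have "mv m A v i = A i i * v i + (\<Sum>j\<in>{..<m} - {i}. A i j * v j)"
    unfolding mv_def using less.prems by (intro sum.remove) auto
  also have "(\<Sum>j\<in>{..<m} - {i}. A i j * v j) = 0"
  proof (rule sum.neutral, rule ballI)
    fix j assume j: "j \<in> {..<m} - {i}"
    show "A i j * v j = 0"
    proof (cases "j < i")
      case False
      then have "m - j < m - i" using j less.prems by auto
      then show ?thesis using less.hyps[of j] j by simp
    qed (use A(2) less.prems in simp)
  qed
  finally show ?case using v[OF less.prems] A(1)[OF less.prems] by simp
qed

section \<open>Block rows, block columns and the inverse denominator\<close>

lemma index_bottom_rows_mult: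
  assumes "A \<in> carrier_mat m n" "k \<le> m" "i < m - k" "j < n"
  shows "(bottom_rows m k * A) $$ (i, j) = A $$ (k + i, j)"
proof -
  have "(bottom_rows m k * A) $$ (i, j) = (\<Sum>l<m. (if l = k + i then 1 else 0) * A $$ (l, j))"
    using assms by (simp add: bottom_rows_def scalar_prod_def atLeast0LessThan)
  also have "\<dots> = A $$ (k + i, j)" using assms by (simp add: sum.remove[of _ "k + i"])
  finally show ?thesis .
qed

lemma index_top_rows_mult:
  assumes "A \<in> carrier_mat m n" "k \<le> m" "i < k" "j < n"
  shows "(top_rows m k * A) $$ (i, j) = A $$ (i, j)"
proof -
  have "(top_rows m k * A) $$ (i, j) = (\<Sum>l<m. (if l = i then 1 else 0) * A $$ (l, j))"
    using assms by (simp add: top_rows_def scalar_prod_def atLeast0LessThan)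
  also have "\<dots> = A $$ (i, j)" using assms by (simp add: sum.remove[of _ i])
  finally show ?thesis .
qed

lemma index_mult_bottom_cols:
  assumes "A \<in> carrier_mat n m" "k \<le> m" "i < n" "j < m - k"
  shows "(A * (bottom_rows m k)\<^sup>T) $$ (i, j) = A $$ (i, k + j)"
proof -
  have "(A * (bottom_rows m k)\<^sup>T) $$ (i, j) = (\<Sum>l<m. A $$ (i, l) * (if l = k + j then 1 else 0))"
    using assms by (simp add: bottom_rows_def scalar_prod_def atLeast0LessThan)
  also have "\<dots> = A $$ (i, k + j)" using assms by (simp add: sum.remove[of _ "k + j"])
  finally show ?thesis .
qed

lemma bottom_rows_carrier [simp]: "bottom_rows m k \<in> carrier_mat (m - k) m"
  by (simp add: bottom_rows_def)

lemma top_rows_carrier [simp]: "top_rows m k \<in> carrier_mat k m"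
  by (simp add: top_rows_def)

lemma mat_inverse_of_injective:
  fixes A :: "complex mat"
  assumes A: "A \<in> carrier_mat n n"
    and inj: "\<And>v. v \<in> carrier_vec n \<Longrightarrow> A *\<^sub>v v = 0\<^sub>v n \<Longrightarrow> v = 0\<^sub>v n"
  obtains B where "mat_inverse A = Some B" "B \<in> carrier_mat n n" "A * B = 1\<^sub>m n" "invertible_mat A"
proof -
  have "Determinant.det A \<noteq> 0" using det_0_iff_vec_prod_zero_field[OF A] inj by blast
  then have "A \<in> Units (ring_mat TYPE(complex) n ())" by (rule det_non_zero_imp_unit[OF A])
  then obtain B where B: "mat_inverse A = Some B" using mat_inverse(1)[OF A, of "()"] by fastforce
  have AB: "A * B = 1\<^sub>m n" "B * A = 1\<^sub>m n" "B \<in> carrier_mat n n" using mat_inverse(2)[OF A B] by auto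
  then have "invertible_mat A" using A unfolding invertible_mat_def inverts_mat_def by auto
  then show thesis using that B AB by blast
qed

text \<open>The vector \<open>b\<close> is the first column of the inverse denominator. The first
  column of \<open>psi_breve\<close> is therefore the upper part of that combination of the last
  \<open>m - k\<close> columns of the product whose lower part is the first unit vector; the
  evolution formula is derived from this description.\<close>

lemma psi_breve_spec:
  assumes R: "R \<in> carrier_mat m m" and \<phi>: "\<phi> \<in> carrier_mat m m" and k: "k < m"
    and inj: "\<And>b. (\<And>i. k \<le> i \<Longrightarrow> i < m \<Longrightarrow> (\<Sum>j<m - k. (R * \<phi>) $$ (i, k + j) * b j) = 0) \<Longrightarrow>
      (\<And>j. j < m - k \<Longrightarrow> b j = 0)"
  obtains b where "invertible_mat (psi_denominator m k R \<phi>)"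
    "\<And>i. k \<le> i \<Longrightarrow> i < m \<Longrightarrow> (\<Sum>j<m - k. (R * \<phi>) $$ (i, k + j) * b j) = (if i = k then 1 else 0)"
    "\<And>i. i < k \<Longrightarrow> (psi_breve m k R \<phi> *\<^sub>v unit_vec (m - k) 0) $ i = (\<Sum>j<m - k. (R * \<phi>) $$ (i, k + j) * b j)"
    "psi_breve m k R \<phi> *\<^sub>v unit_vec (m - k) 0 \<in> carrier_vec k"
proof -
  define n where "n = m - k"
  define E where "E = (bottom_rows m k)\<^sup>T"
  define A where "A = psi_denominator m k R \<phi>"
  define T where "T = top_rows m k * R * \<phi> * E"
  have n: "0 < n" using k by (simp add: n_def)
  have E: "E \<in> carrier_mat m n" by (simp add: E_def n_def)
  have RP: "R * \<phi> \<in> carrier_mat m m" using R \<phi> by simp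
  have Aeq: "A = bottom_rows m k * ((R * \<phi>) * E)"
    unfolding A_def psi_denominator_def E_def[symmetric] using R \<phi> E
    by (simp add: assoc_mult_mat[of "bottom_rows m k" n m R m \<phi> m]
        assoc_mult_mat[of "bottom_rows m k" n m "R * \<phi>" m E n] n_def)
  have Teq: "T = top_rows m k * ((R * \<phi>) * E)"
    unfolding T_def using R \<phi> E
    by (simp add: assoc_mult_mat[of "top_rows m k" k m R m \<phi> m]
        assoc_mult_mat[of "top_rows m k" k m "R * \<phi>" m E n])
  have A: "A \<in> carrier_mat n n" unfolding Aeq n_def
    by (rule mult_carrier_mat[OF bottom_rows_carrier mult_carrier_mat[OF RP E[unfolded n_def]]])
  have T: "T \<in> carrier_mat k n" unfolding Teq
    by (rule mult_carrier_mat[OF top_rows_carrier mult_carrier_mat[OF RP E]])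
  have Aij: "A $$ (i, j) = (R * \<phi>) $$ (k + i, k + j)" if "i < n" "j < n" for i j
    using that RP E k unfolding Aeq n_def E_def
    by (subst index_bottom_rows_mult[of _ m n]) (auto simp: n_def index_mult_bottom_cols[of _ m] simp del: index_mult_mat)
  have Tij: "T $$ (i, j) = (R * \<phi>) $$ (i, k + j)" if "i < k" "j < n" for i j
    using that RP E k unfolding Teq n_def E_def
    by (subst index_top_rows_mult[of _ m n]) (auto simp: n_def index_mult_bottom_cols[of _ m] simp del: index_mult_mat)
  have Av: "(A *\<^sub>v v) $ i = (\<Sum>j<m - k. (R * \<phi>) $$ (k + i, k + j) * v $ j)" if "v \<in> carrier_vec n" "i < n" for v i
    using that A by (simp add: scalar_prod_def Aij atLeast0LessThan n_def del: index_mult_mat)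
  obtain B where B: "mat_inverse A = Some B" "B \<in> carrier_mat n n" "A * B = 1\<^sub>m n" "invertible_mat A"
  proof (rule mat_inverse_of_injective[OF A])
    fix v :: "complex Matrix.vec" assume v: "v \<in> carrier_vec n" "A *\<^sub>v v = 0\<^sub>v n"
    have "(\<Sum>j<m - k. (R * \<phi>) $$ (i, k + j) * v $ j) = 0" if "k \<le> i" "i < m" for i
      using Av[OF v(1), of "i - k"] v(2) that by (simp add: n_def)
    then have "v $ j = 0" if "j < n" for j using inj that by (simp add: n_def)
    then show "v = 0\<^sub>v n" using v(1) by (intro eq_vecI) auto
  qed
  define b where "b = B *\<^sub>v unit_vec n 0"
  have b: "b \<in> carrier_vec n" using B by (simp add: b_def)
  have Ab: "A *\<^sub>v b = unit_vec n 0"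
    unfolding b_def using A B by (subst assoc_mult_mat_vec[symmetric, of _ n n _ n]) auto
  have psi: "psi_breve m k R \<phi> *\<^sub>v unit_vec (m - k) 0 = T *\<^sub>v b"
  proof -
    have "psi_breve m k R \<phi> = T * B"
      unfolding psi_breve_def A_def[symmetric] E_def[symmetric] T_def[symmetric] B(1) by simp
    then show ?thesis
      unfolding b_def n_def[symmetric] using T B by (simp add: assoc_mult_mat_vec[of _ k n _ n])
  qed
  show thesis
  proof
    show "invertible_mat (psi_denominator m k R \<phi>)" using B(4) by (simp add: A_def)
    show "(\<Sum>j<m - k. (R * \<phi>) $$ (i, k + j) * b $ j) = (if i = k then 1 else 0)" if "k \<le> i" "i < m" for i
      using Av[OF b, of "i - k"] Ab that n by (auto simp: n_def)
    show "(psi_breve m k R \<phi> *\<^sub>v unit_vec (m - k) 0) $ i = (\<Sum>j<m - k. (R * \<phi>) $$ (i, k + j) * b $ j)" if "i < k" for i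
      unfolding psi using that T b by (simp add: scalar_prod_def Tij atLeast0LessThan n_def del: index_mult_mat)
    show "psi_breve m k R \<phi> *\<^sub>v unit_vec (m - k) 0 \<in> carrier_vec k" unfolding psi
      by (rule mult_mat_vec_carrier[OF T b])
  qed
qed

section \<open>Evolution of the Weyl function\<close>

lemma skew_diag_comm:
  assumes "\<And>i j. i < m \<Longrightarrow> j < m \<Longrightarrow> P j i = cnj (P i j)"
  shows "skew m (diag_comm d P)"
  unfolding skew_def
proof (intro allI impI)
  fix i j assume ij: "i < m" "j < m"
  show "diag_comm d P j i = - cnj (diag_comm d P i j)"
    unfolding diag_comm_def assms[OF ij] by (simp add: algebra_simps)
qed

lemma skew_system_of_fundamental_solution:
  assumes d: "\<And>i. i < m \<Longrightarrow> 0 < d i" "\<And>i j. i < j \<Longrightarrow> j < m \<Longrightarrow> d j < d i"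
    and A: "\<And>x. 0 \<le> x \<Longrightarrow> A x \<in> carrier_mat m m"
    and herm: "\<And>x. 0 \<le> x \<Longrightarrow> mat_adjoint (A x) = A x"
    and M0: "\<And>x. 0 \<le> x \<Longrightarrow> mat_norm (commutator (real_diag m d) (A x)) \<le> M0"
    and w: "normalized_fundamental_solution m d (\<lambda>x. commutator (real_diag m d) (A x)) w"
  shows "skew_system m d (\<lambda>x. diag_comm d (\<lambda>i j. A x $$ (i, j))) (\<lambda>x z i j. w x z $$ (i, j)) M0"
proof
  show "skew m (diag_comm d (\<lambda>i j. A x $$ (i, j)))" if x: "0 \<le> x" for x
  proof (rule skew_diag_comm)
    fix i j assume "i < m" "j < m"
    then have "mat_adjoint (A x) $$ (j, i) = cnj (A x $$ (i, j))"
      using A[OF x] by (intro mat_adjoint_index) auto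
    then show "A x $$ (j, i) = cnj (A x $$ (i, j))" using herm[OF x] by simp
  qed
  show "cmod (\<Sum>i<m. cnj (p i) * mv m (diag_comm d (\<lambda>i j. A x $$ (i, j))) q i) \<le> M0 * sqrt (sqn m p) * sqrt (sqn m q)"
    if x: "0 \<le> x" for x p q
  proof -
    define Z where "Z = commutator (real_diag m d) (A x)"
    have "mv m (diag_comm d (\<lambda>i j. A x $$ (i, j))) q i = mv m (\<lambda>i j. Z $$ (i, j)) q i" if "i < m" for i
      unfolding mv_def Z_def using that A[OF x] by (simp add: commutator_real_diag)
    then have "cmod (\<Sum>i<m. cnj (p i) * mv m (diag_comm d (\<lambda>i j. A x $$ (i, j))) q i) \<le> mat_norm Z * sqrt (sqn m p) * sqrt (sqn m q)"
      using sesquilinear_le_mat_norm[OF commutator_carrier[OF A[OF x]], of p d q] by (simp add: Z_def)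
    also have "\<dots> \<le> M0 * sqrt (sqn m p) * sqrt (sqn m q)"
      using M0[OF x] unfolding Z_def by (intro mult_right_mono) auto
    finally show ?thesis .
  qed
  have w0: "w 0 z = 1\<^sub>m m" for z using w by (simp add: normalized_fundamental_solution_def)
  show "w 0 z $$ (i, j) = (if i = j then 1 else 0)" if "i < m" "j < m" for z i j
    using that by (simp add: w0)
  show "((\<lambda>x. w x z $$ (i, j)) has_vector_derivative
      mm m (coef d z (diag_comm d (\<lambda>i j. A x $$ (i, j)))) (\<lambda>i j. w x z $$ (i, j)) i j) (at x within {0..})"
    if x: "0 \<le> x" and ij: "i < m" "j < m" for x z i j
  proof -
    have der: "mat_has_derivative m (\<lambda>y. w y z)
        (((\<i> * z) \<cdot>\<^sub>m real_diag m d - commutator (real_diag m d) (A x)) * w x z) x {0..}"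
      using w x by (simp add: normalized_fundamental_solution_def)
    then have wc: "w x z \<in> carrier_mat m m" using x by (simp add: mat_has_derivative_def)
    have c: "(\<i> * z) \<cdot>\<^sub>m real_diag m d - commutator (real_diag m d) (A x) \<in> carrier_mat m m"
      by (intro minus_carrier_mat commutator_carrier A x)
    have "((\<lambda>y. w y z $$ (i, j)) has_vector_derivative
        (((\<i> * z) \<cdot>\<^sub>m real_diag m d - commutator (real_diag m d) (A x)) * w x z) $$ (i, j)) (at x within {0..})"
      using der ij unfolding mat_has_derivative_def by blast
    also have "(((\<i> * z) \<cdot>\<^sub>m real_diag m d - commutator (real_diag m d) (A x)) * w x z) $$ (i, j) =
        mm m (coef d z (diag_comm d (\<lambda>i j. A x $$ (i, j)))) (\<lambda>i j. w x z $$ (i, j)) i j"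
      unfolding index_mult_mm[OF c wc ij] using ij by (intro mm_cong index_coef A x refl) auto
    finally show ?thesis .
  qed
qed (use d in auto)

text \<open>The Weyl condition gives the normalization only on a half-plane of its own choice. The
  entries concerned are constant there, so the identity theorem extends it.\<close>

lemma normalized_upper_triangular_continuation:
  assumes hol: "mat_holomorphic_on m \<phi> (lower_half_plane M)"
    and norm: "\<And>z. z \<in> lower_half_plane M' \<Longrightarrow> normalized_upper_triangular m (\<phi> z)"
    and z: "z \<in> lower_half_plane M"
  shows "normalized_upper_triangular m (\<phi> z)"
proof -
  define U where "U = lower_half_plane (max M M')"
  have U: "open U" "U \<noteq> {}" "U \<subseteq> lower_half_plane M" "U \<subseteq> lower_half_plane M'"
    by (auto simp: U_def open_lower_half_plane lower_half_plane_nonempty) (auto simp: lower_half_plane_def)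
  have "\<phi> z $$ (i, j) = c" if "i < m" "j < m" "\<And>z. z \<in> lower_half_plane M' \<Longrightarrow> \<phi> z $$ (i, j) = c" for i j c
  proof (rule analytic_continuation_open[of U "lower_half_plane M" "\<lambda>z. \<phi> z $$ (i, j)" "\<lambda>_. c"])
    show "(\<lambda>z. \<phi> z $$ (i, j)) holomorphic_on lower_half_plane M"
      using hol that by (simp add: mat_holomorphic_on_def)
  qed (use U that z in \<open>auto simp: open_lower_half_plane connected_lower_half_plane\<close>)
  then show ?thesis using norm unfolding normalized_upper_triangular_def by blast
qed

text \<open>The integral of the entry \<open>(k, k)\<close> controls column \<open>k\<close>. Its
  exponent contains the additional \<open>r\<close>, so the direct estimate works only far down in
  the half-plane, and \<open>subordinate_continuation\<close> covers the rest.\<close>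

lemma (in skew_system) weyl_column_subordinate:
  assumes W: "W = (\<lambda>x z i j. w x z $$ (i, j))"
    and w: "\<And>x z. 0 \<le> x \<Longrightarrow> w x z \<in> carrier_mat m m"
    and hol: "mat_holomorphic_on m \<phi> (lower_half_plane M)"
    and M: "0 \<le> M" "2 * M0 < M * (d (k - 1) - d k)" and r: "0 < r"
    and int: "\<And>z. z \<in> lower_half_plane M' \<Longrightarrow>
      (\<lambda>x. weyl_integrand m d w \<phi> r z x $$ (k, k)) absolutely_integrable_on {0..}"
    and norm: "\<And>z. z \<in> lower_half_plane M \<Longrightarrow> normalized_upper_triangular m (\<phi> z)"
    and k: "1 \<le> k" "k < m" and z: "z \<in> lower_half_plane M"
  shows "subordinate k z (\<lambda>i. \<phi> z $$ (i, k))"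
proof -
  define g where "g = d (k - 1) - d k"
  have g: "0 < g" using d_dec[of "k - 1" k] k by (simp add: g_def)
  \<comment> \<open>Below \<open>- (r / g)\<close> the extra \<open>r\<close> fits into the distance
    \<open>- Im z * g\<close> between \<open>- 2 * Im z * d k\<close> and \<open>rate z k\<close>;
    the other two bounds keep \<open>U\<close> inside both half-planes.\<close>
  define N where "N = max (max M M') (r / g)"
  define U where "U = lower_half_plane N"
  have U: "open U" "U \<noteq> {}" "U \<subseteq> lower_half_plane M" "U \<subseteq> lower_half_plane M'"
    by (auto simp: U_def open_lower_half_plane lower_half_plane_nonempty) (auto simp: lower_half_plane_def N_def)
  show ?thesis
  proof (rule subordinate_continuation[of "lower_half_plane M" k "\<lambda>z i. \<phi> z $$ (i, k)" U])
    fix z assume z: "z \<in> lower_half_plane M"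
    then have "M \<le> - Im z" by (simp add: lower_half_plane_def)
    then have "M * g \<le> - Im z * g" using g by (intro mult_right_mono) auto
    then show "0 < gap k z" using M by (simp add: gap_def g_def)
    show "Im z \<le> 0" using \<open>M \<le> - Im z\<close> M by simp
    show "\<phi> z $$ (k, k) = 1" "\<And>i. k < i \<Longrightarrow> i < m \<Longrightarrow> \<phi> z $$ (i, k) = 0"
      using norm[OF z] k by (auto simp: normalized_upper_triangular_def)
  next
    fix z assume "z \<in> U"
    then have zM: "z \<in> lower_half_plane M" "z \<in> lower_half_plane M'" and zr: "r / g < - Im z"
      using U by (auto simp: U_def lower_half_plane_def N_def)
    define q where "q = - 2 * Im z * d k + r"
    have "0 \<le> - Im z * d k"
      using zM(1) M d_pos[OF k(2)] by (intro mult_nonneg_nonneg) (auto simp: lower_half_plane_def)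
    then have q: "0 \<le> q" using r unfolding q_def by simp
    have "r < - Im z * g" using zr g by (simp add: pos_divide_less_eq)
    then have "q \<le> rate z k" by (simp add: q_def rate_def g_def algebra_simps)
    have "(\<lambda>x. of_real (exp (- q * x) * sqn m (sol z (\<lambda>i. \<phi> z $$ (i, k)) x)) :: complex) integrable_on {0..}"
    proof (rule integrable_eq)
      show "(\<lambda>x. weyl_integrand m d w \<phi> r z x $$ (k, k)) integrable_on {0..}"
        using int[OF zM(2)] by (rule set_lebesgue_integral_eq_integral(1))
      have \<phi>: "\<phi> z \<in> carrier_mat m m" using hol zM by (simp add: mat_holomorphic_on_def)
      show "weyl_integrand m d w \<phi> r z x $$ (k, k) =
          of_real (exp (- q * x) * sqn m (sol z (\<lambda>i. \<phi> z $$ (i, k)) x))" if "x \<in> {0..}" for x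
        unfolding sol_def unfolding q_def W
        using that by (intro weyl_integrand_diagonal \<phi> w k) auto
    qed
    from integrable_linear[OF this bounded_linear_Re]
    have "(\<lambda>x. exp (- q * x) * sqn m (sol z (\<lambda>i. \<phi> z $$ (i, k)) x)) integrable_on {0..}"
      by (simp add: o_def)
    then show "subordinate k z (\<lambda>i. \<phi> z $$ (i, k))"
      using zM M by (intro subordinate_if_integrable[OF _ k q \<open>q \<le> rate z k\<close>]) (auto simp: lower_half_plane_def)
  qed (use hol k U z in \<open>auto simp: open_lower_half_plane connected_lower_half_plane mat_holomorphic_on_def\<close>)
qed

theorem theorem4p1:
  fixes m :: nat and a M0 M :: real
    and d dh :: "nat \<Rightarrow> real"
    and \<rho> \<rho>x \<rho>t :: "real \<Rightarrow> real \<Rightarrow> complex mat"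
    and \<rho>h :: "real \<Rightarrow> complex mat"
    and R \<phi> :: "real \<Rightarrow> complex \<Rightarrow> complex mat"
  defines "D \<equiv> real_diag m d" and "Dh \<equiv> real_diag m dh"
  assumes "m \<ge> 2" and "0 < a"
    and "\<forall>i<m. \<forall>j<m. i < j \<longrightarrow> d i > d j" and "\<forall>i<m. d i > 0"
    and "\<forall>i<m. dh i > 0"
    and "\<forall>(x, t) \<in> strip a. \<rho> x t \<in> carrier_mat m m \<and> mat_adjoint (\<rho> x t) = \<rho> x t"
    and "C1_on_strip m a \<rho> \<rho>x \<rho>t"
    and "\<exists>C. \<forall>(x, t) \<in> strip a. mat_norm (\<rho> x t) \<le> C"
    and "\<forall>(x, t) \<in> strip a.
           commutator D (\<rho>t x t) - commutator Dh (\<rho>x x t) =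
           commutator D (\<rho> x t) * commutator Dh (\<rho> x t) -
           commutator Dh (\<rho> x t) * commutator D (\<rho> x t)"
    and "\<forall>t\<in>{0..<a}. \<rho> 0 t = \<rho>h t"
    and "\<forall>z. R 0 z = 1\<^sub>m m \<and>
           (\<forall>t\<in>{0..<a}. mat_has_derivative m (\<lambda>s. R s z)
              (((\<i> * z) \<cdot>\<^sub>m Dh - commutator Dh (\<rho>h t)) * R t z) t {0..<a})"
    and "M0 = (SUP (x, t) \<in> strip a. mat_norm (commutator D (\<rho> x t)))"
    and "M > Max ((\<lambda>k. 2 * M0 / (d (k - 1) - d k)) ` {1..<m})"
    and "\<forall>t\<in>{0..<a}. weyl_function m d (\<lambda>x. commutator D (\<rho> x t)) (\<phi> t) \<and>
           mat_holomorphic_on m (\<phi> t) (lower_half_plane M)"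
  shows "\<forall>z\<in>lower_half_plane M. \<forall>t\<in>{0..<a}.
           (\<forall>k\<in>{1..<m}.
              invertible_mat (psi_denominator m k (R t z) (\<phi> 0 z)) \<and>
              Matrix.vec k (\<lambda>i. \<phi> t z $$ (i, k)) =
                psi_breve m k (R t z) (\<phi> 0 z) *\<^sub>v unit_vec (m - k) 0) \<and>
           normalized_upper_triangular m (\<phi> t z)"
proof -
  have d_dec: "\<And>i j. i < j \<Longrightarrow> j < m \<Longrightarrow> d j < d i" using assms(5) by auto
  have d_pos: "\<And>i. i < m \<Longrightarrow> 0 < d i" using assms(6) by auto
  have in_strip: "(x, t) \<in> strip a \<longleftrightarrow> 0 \<le> x \<and> t \<in> {0..<a}" for x t
    by (simp add: strip_def)
  have \<rho>: "\<rho> x t \<in> carrier_mat m m" and \<rho>_adj: "mat_adjoint (\<rho> x t) = \<rho> x t" if "0 \<le> x" "t \<in> {0..<a}" for x t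
    using assms(8) that by (auto simp: in_strip)
  have \<rho>_herm: "\<rho> x t $$ (j, i) = cnj (\<rho> x t $$ (i, j))"
    if "0 \<le> x" "t \<in> {0..<a}" "i < m" "j < m" for x t i j
    using mat_adjoint_index[of j "\<rho> x t" i] \<rho>[OF that(1,2)] \<rho>_adj[OF that(1,2)] that by auto
  have \<rho>_x: "mat_has_derivative m (\<lambda>y. \<rho> y t) (\<rho>x x t) x {0..}"
    and \<rho>_t: "mat_has_derivative m (\<lambda>s. \<rho> x s) (\<rho>t x t) t {0..<a}" if "0 \<le> x" "t \<in> {0..<a}" for x t
    using assms(9) that by (auto simp: C1_on_strip_def in_strip)
  have \<rho>x: "\<rho>x x t \<in> carrier_mat m m" and \<rho>t: "\<rho>t x t \<in> carrier_mat m m" if "0 \<le> x" "t \<in> {0..<a}" for x t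
    using \<rho>_x[OF that] \<rho>_t[OF that] by (auto simp: mat_has_derivative_def)
  \<comment> \<open>A supremum of reals bounds its family only if the family is bounded above; this
    is where the uniform bound on \<open>\<rho>\<close> enters.\<close>
  have M0_ge: "mat_norm (commutator D (\<rho> x t)) \<le> M0" if "0 \<le> x" "t \<in> {0..<a}" for x t
  proof -
    obtain C where "\<forall>(x, t) \<in> strip a. mat_norm (\<rho> x t) \<le> C" using assms(10) by blast
    then have C: "mat_norm (\<rho> x t) \<le> C" if "0 \<le> x" "t \<in> {0..<a}" for x t
      using that by (auto simp: in_strip)
    have "mat_norm (commutator D (\<rho> x t)) \<le> m * (m * (d 0 * C))" if xt: "0 \<le> x" "t \<in> {0..<a}" for x t
      unfolding D_def
    proof (rule mat_norm_le_entries[OF commutator_carrier[OF \<rho>[OF xt]]])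
      have entry: "cmod (\<rho> x t $$ (i, j)) \<le> C" if "i < m" "j < m" for i j
        using cmod_entry_le_mat_norm[OF \<rho>[OF xt] that] C[OF xt] by linarith
      have "0 < m" using assms(3) by simp
      then have "0 \<le> C" "0 < d 0" using order_trans[OF norm_ge_zero entry[of 0 0]] d_pos by auto
      then show "0 \<le> d 0 * C" by simp
      show "cmod (commutator (real_diag m d) (\<rho> x t) $$ (i, j)) \<le> d 0 * C" if ij: "i < m" "j < m" for i j
      proof -
        have d0: "d l \<le> d 0" if "l < m" for l using d_dec[of 0 l] that by (cases "l = 0") auto
        have "\<bar>d i - d j\<bar> \<le> d 0" using d0[OF ij(1)] d0[OF ij(2)] d_pos[OF ij(1)] d_pos[OF ij(2)] by auto
        then have "\<bar>d i - d j\<bar> * cmod (\<rho> x t $$ (i, j)) \<le> d 0 * C"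
          using entry[OF ij] \<open>0 < d 0\<close> by (intro mult_mono) auto
        then show ?thesis
          by (simp only: commutator_real_diag[OF \<rho>[OF xt] ij] diag_comm_def norm_mult norm_of_real)
      qed
    qed
    then have "bdd_above ((\<lambda>(x, t). mat_norm (commutator D (\<rho> x t))) ` strip a)"
      by (intro bdd_aboveI[of _ "m * (m * (d 0 * C))"]) (auto simp: in_strip)
    from cSUP_upper[OF _ this, of "(x, t)"] show ?thesis
      unfolding assms(14) using that by (simp add: in_strip)
  qed
  have "0 \<le> M0"
  proof -
    have 0: "0 \<in> {0..<a}" "0 < m" using assms(3,4) by auto
    show ?thesis
      using cmod_entry_le_mat_norm[OF commutator_carrier[OF \<rho>[OF order_refl 0(1)], of d] 0(2,2)]
        M0_ge[OF order_refl 0(1)] norm_ge_zero order_trans unfolding D_def by metis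
  qed
  have M_gt: "2 * M0 < M * (d (k - 1) - d k)" "0 \<le> M" if "1 \<le> k" "k < m" for k
  proof -
    have g: "0 < d (k - 1) - d k" using d_dec[of "k - 1" k] that by simp
    have "2 * M0 / (d (k - 1) - d k) \<le> Max ((\<lambda>k. 2 * M0 / (d (k - 1) - d k)) ` {1..<m})"
      using that by (intro Max_ge) auto
    then have lt: "2 * M0 / (d (k - 1) - d k) < M" using assms(15) by linarith
    then show "2 * M0 < M * (d (k - 1) - d k)" using g by (simp add: pos_divide_less_eq)
    have "0 \<le> 2 * M0 / (d (k - 1) - d k)" using g \<open>0 \<le> M0\<close> by simp
    then show "0 \<le> M" using lt by linarith
  qed
  have "0 \<le> M" using M_gt(2)[of 1] assms(3) by simp
  \<comment> \<open>Bundling the existential data of \<open>weyl_function\<close> lets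
    \<open>w\<close>, \<open>M'\<close> and \<open>r\<close> be chosen together as functions of
    \<open>t\<close>.\<close>
  define Q where "Q t w M' r \<longleftrightarrow> normalized_fundamental_solution m d (\<lambda>x. commutator D (\<rho> x t)) w \<and> 0 < r \<and>
      (\<forall>z\<in>lower_half_plane M'. \<forall>i<m. \<forall>j<m.
         (\<lambda>x. weyl_integrand m d w (\<phi> t) r z x $$ (i, j)) absolutely_integrable_on {0..}) \<and>
      (\<forall>z\<in>lower_half_plane M'. normalized_upper_triangular m (\<phi> t z))" for t w M' r
  have "\<exists>w M' r. Q t w M' r" if "t \<in> {0..<a}" for t
    using assms(16) that unfolding weyl_function_def Q_def by blast
  then obtain w M' r where Q: "\<And>t. t \<in> {0..<a} \<Longrightarrow> Q t (w t) (M' t) (r t)" by metis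
  then have
    nfs: "\<And>t. t \<in> {0..<a} \<Longrightarrow> normalized_fundamental_solution m d (\<lambda>x. commutator D (\<rho> x t)) (w t)" and
    r: "\<And>t. t \<in> {0..<a} \<Longrightarrow> 0 < r t" and
    int: "\<And>t z i j. t \<in> {0..<a} \<Longrightarrow> z \<in> lower_half_plane (M' t) \<Longrightarrow> i < m \<Longrightarrow> j < m \<Longrightarrow>
      (\<lambda>x. weyl_integrand m d (w t) (\<phi> t) (r t) z x $$ (i, j)) absolutely_integrable_on {0..}" and
    norm': "\<And>t z. t \<in> {0..<a} \<Longrightarrow> z \<in> lower_half_plane (M' t) \<Longrightarrow> normalized_upper_triangular m (\<phi> t z)"
    unfolding Q_def by blast+
  have hol: "mat_holomorphic_on m (\<phi> t) (lower_half_plane M)" if "t \<in> {0..<a}" for t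
    using assms(16) that by blast
  have norm: "normalized_upper_triangular m (\<phi> t z)" if "t \<in> {0..<a}" "z \<in> lower_half_plane M" for t z
    using normalized_upper_triangular_continuation[OF hol norm'] that by blast
  have w: "w t x z \<in> carrier_mat m m" if "t \<in> {0..<a}" "0 \<le> x" for t x z
    using nfs[OF that(1)] that(2) by (auto simp: normalized_fundamental_solution_def mat_has_derivative_def)
  have R_der: "mat_has_derivative m (\<lambda>s. R s z) (((\<i> * z) \<cdot>\<^sub>m Dh - commutator Dh (\<rho> 0 t)) * R t z) t {0..<a}"
    and R0: "R 0 z = 1\<^sub>m m" if "t \<in> {0..<a}" for t z
    using assms(12,13) that by auto
  have R: "R t z \<in> carrier_mat m m" if "t \<in> {0..<a}" for t z
    using R_der[OF that, of z] that by (simp add: mat_has_derivative_def)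
  define W where "W t x z i j = w t x z $$ (i, j)" for t x z i j
  have W: "W t = (\<lambda>x z i j. w t x z $$ (i, j))" for t by (intro ext) (simp add: W_def)
  define p where "p x t i j = \<rho> x t $$ (i, j)" for x t i j
  have sys: "skew_system m d (\<lambda>x. diag_comm d (p x t)) (W t) M0" if t: "t \<in> {0..<a}" for t
    unfolding p_def[abs_def] W
    using d_pos d_dec \<rho>[OF _ t] \<rho>_adj[OF _ t] M0_ge[OF _ t] nfs[OF t]
    unfolding D_def by (rule skew_system_of_fundamental_solution)
  interpret nonlinear_optics m a d dh M0 p "\<lambda>x t i j. \<rho>x x t $$ (i, j)" "\<lambda>x t i j. \<rho>t x t $$ (i, j)"
    W "\<lambda>t z i j. R t z $$ (i, j)"
  proof (rule nonlinear_optics.intro)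
    show "skew m (diag_comm dh (p x t))" if "0 \<le> x" "t \<in> {0..<a}" for x t
      unfolding p_def[abs_def] using \<rho>_herm[OF that] by (intro skew_diag_comm)
    show "((\<lambda>x. p x t i j) has_vector_derivative \<rho>x x t $$ (i, j)) (at x within {0..})"
      "((\<lambda>t. p x t i j) has_vector_derivative \<rho>t x t $$ (i, j)) (at t within {0..<a})"
      if "0 \<le> x" "t \<in> {0..<a}" "i < m" "j < m" for x t i j
      using \<rho>_x[OF that(1,2)] \<rho>_t[OF that(1,2)] that(3,4) by (auto simp: mat_has_derivative_def p_def)
    show "continuous_on ({0..} \<times> {0..<a}) (\<lambda>(x, t). \<rho>t x t $$ (i, j))" if "i < m" "j < m" for i j
      using assms(9) that by (auto simp: C1_on_strip_def mat_continuous_on_def strip_def case_prod_unfold)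
    show "diag_comm d (\<lambda>i j. \<rho>t x t $$ (i, j)) i j - diag_comm dh (\<lambda>i j. \<rho>x x t $$ (i, j)) i j =
      mm m (diag_comm d (p x t)) (diag_comm dh (p x t)) i j - mm m (diag_comm dh (p x t)) (diag_comm d (p x t)) i j"
      if xt: "0 \<le> x" "t \<in> {0..<a}" and ij: "i < m" "j < m" for x t i j
    proof -
      have c: "commutator D A \<in> carrier_mat m m" "commutator Dh A \<in> carrier_mat m m"
        if "A \<in> carrier_mat m m" for A
        using commutator_carrier[OF that] by (simp_all add: D_def Dh_def)
      have e: "commutator D A $$ (i, j) = diag_comm d (\<lambda>i j. A $$ (i, j)) i j"
        "commutator Dh A $$ (i, j) = diag_comm dh (\<lambda>i j. A $$ (i, j)) i j"
        if "A \<in> carrier_mat m m" "i < m" "j < m" for A i j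
        using commutator_real_diag[OF that] by (simp_all add: D_def Dh_def)
      note cs = c[OF \<rho>[OF xt]] c[OF \<rho>x[OF xt]] c[OF \<rho>t[OF xt]]
      have "(commutator D (\<rho>t x t) - commutator Dh (\<rho>x x t)) $$ (i, j) =
           (commutator D (\<rho> x t) * commutator Dh (\<rho> x t) -
           commutator Dh (\<rho> x t) * commutator D (\<rho> x t)) $$ (i, j)"
        using bspec[OF assms(11), of "(x, t)"] xt by (simp add: in_strip)
      also have "(commutator D (\<rho>t x t) - commutator Dh (\<rho>x x t)) $$ (i, j) =
          diag_comm d (\<lambda>i j. \<rho>t x t $$ (i, j)) i j - diag_comm dh (\<lambda>i j. \<rho>x x t $$ (i, j)) i j"
        using cs ij by (simp add: e \<rho>x[OF xt] \<rho>t[OF xt])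
      also have "(commutator D (\<rho> x t) * commutator Dh (\<rho> x t) - commutator Dh (\<rho> x t) * commutator D (\<rho> x t)) $$ (i, j) =
          (commutator D (\<rho> x t) * commutator Dh (\<rho> x t)) $$ (i, j) - (commutator Dh (\<rho> x t) * commutator D (\<rho> x t)) $$ (i, j)"
        using cs ij by (intro index_minus_mat) auto
      also have "(commutator D (\<rho> x t) * commutator Dh (\<rho> x t)) $$ (i, j) = mm m (diag_comm d (p x t)) (diag_comm dh (p x t)) i j"
        unfolding index_mult_mm[OF cs(1,2) ij] p_def[abs_def] using ij \<rho>[OF xt] by (intro mm_cong) (simp_all add: e)
      also have "(commutator Dh (\<rho> x t) * commutator D (\<rho> x t)) $$ (i, j) = mm m (diag_comm dh (p x t)) (diag_comm d (p x t)) i j"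
        unfolding index_mult_mm[OF cs(2,1) ij] p_def[abs_def] using ij \<rho>[OF xt] by (intro mm_cong) (simp_all add: e)
      finally show ?thesis .
    qed
    show "R 0 z $$ (i, j) = (if i = j then 1 else 0)" if "i < m" "j < m" for z i j
      using R0[of 0 z] assms(4) that by simp
    show "((\<lambda>t. R t z $$ (i, j)) has_vector_derivative
        mm m (coef dh z (diag_comm dh (p 0 t))) (\<lambda>i j. R t z $$ (i, j)) i j) (at t within {0..<a})"
      if t: "t \<in> {0..<a}" and ij: "i < m" "j < m" for t z i j
    proof -
      have c: "(\<i> * z) \<cdot>\<^sub>m Dh - commutator Dh (\<rho> 0 t) \<in> carrier_mat m m"
        unfolding Dh_def by (intro minus_carrier_mat commutator_carrier \<rho> t) simp
      have "((\<lambda>t. R t z $$ (i, j)) has_vector_derivative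
          (((\<i> * z) \<cdot>\<^sub>m Dh - commutator Dh (\<rho> 0 t)) * R t z) $$ (i, j)) (at t within {0..<a})"
        using R_der[OF t] ij unfolding mat_has_derivative_def by blast
      also have "(((\<i> * z) \<cdot>\<^sub>m Dh - commutator Dh (\<rho> 0 t)) * R t z) $$ (i, j) =
          mm m (coef dh z (diag_comm dh (p 0 t))) (\<lambda>i j. R t z $$ (i, j)) i j"
        unfolding index_mult_mm[OF c R[OF t] ij]
      proof (rule mm_cong)
        show "((\<i> * z) \<cdot>\<^sub>m Dh - commutator Dh (\<rho> 0 t)) $$ (i, l) = coef dh z (diag_comm dh (p 0 t)) i l"
          if "l < m" for l
          unfolding Dh_def p_def[abs_def] using ij t that by (intro index_coef \<rho>) auto
      qed simp
      finally show ?thesis .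
    qed
  qed (use sys assms(7) in auto)
  show ?thesis
  proof (intro ballI conjI)
    fix z t assume z: "z \<in> lower_half_plane M" and t: "t \<in> {0..<a}"
    show "normalized_upper_triangular m (\<phi> t z)" by (rule norm[OF t z])
    fix k assume "k \<in> {1..<m}"
    then have k: "1 \<le> k" "k < m" by auto
    have imz: "Im z \<le> 0" using z \<open>0 \<le> M\<close> by (simp add: lower_half_plane_def)
    have 0: "0 \<in> {0..<a}" using assms(4) by simp
    have \<phi>: "\<phi> 0 z \<in> carrier_mat m m" using hol[OF 0] z by (simp add: mat_holomorphic_on_def)
    have weyl: "skew_system.subordinate m d (W t) k z (\<lambda>i. \<phi> t z $$ (i, j))"
      if t: "t \<in> {0..<a}" and j: "k \<le> j" "j < m" for t j
    proof -
      interpret skew_system m d "\<lambda>x. diag_comm d (p x t)" "W t" M0 by (rule sys[OF t])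
      have j1: "1 \<le> j" using k j by simp
      have "subordinate j z (\<lambda>i. \<phi> t z $$ (i, j))"
        by (rule weyl_column_subordinate[OF W w[OF t] hol[OF t] \<open>0 \<le> M\<close> M_gt(1)[OF j1 j(2)] r[OF t]
              int[OF t _ j(2) j(2)] norm[OF t] j1 j(2) z])
      then show ?thesis by (rule subordinate_mono[OF _ k(1) j imz])
    qed
    interpret skew_system m d "\<lambda>x. diag_comm d (p x t)" "W t" M0 by (rule sys[OF t])
    have gap: "0 < gap k z"
    proof -
      have "M * (d (k - 1) - d k) \<le> - Im z * (d (k - 1) - d k)"
        using z d_dec[of "k - 1" k] k by (intro mult_right_mono) (auto simp: lower_half_plane_def)
      then show ?thesis using M_gt(1)[OF k] by (simp add: gap_def)
    qed
    define N where "N i j = (R t z * \<phi> 0 z) $$ (i, j)" for i j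
    have N: "N i j = mv m (\<lambda>i j. R t z $$ (i, j)) (\<lambda>i. \<phi> 0 z $$ (i, j)) i" if "i < m" "j < m" for i j
      unfolding N_def index_mult_mm[OF R[OF t] \<phi> that] by (simp add: mm_def mv_def)
    \<comment> \<open>A combination of the last \<open>m - k\<close> columns of
      \<open>R(t, z) \<phi>(0, z)\<close>; all of them are subordinate at level \<open>k\<close> at
      time \<open>t\<close>.\<close>
    define comb where "comb b i = (\<Sum>j<m - k. b j * N i (k + j))" for b and i :: nat
    have comb_eq: "comb b i = (\<Sum>j<m - k. (R t z * \<phi> 0 z) $$ (i, k + j) * b j)" for b i
      unfolding comb_def N_def by (simp only: mult.commute)
    have sub: "subordinate k z (comb b)" for b
      unfolding comb_def
    proof (rule subordinate_sum)
      fix j assume "j \<in> {..<m - k}"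
      then have j: "k \<le> k + j" "k + j < m" using k by auto
      show "subordinate k z (\<lambda>i. N i (k + j))"
        using N j(2) by (intro subordinate_cong[OF subordinate_transport[OF imz t weyl[OF 0 j]]])
    qed simp
    \<comment> \<open>A combination with vanishing coordinates from \<open>k\<close> on is
      subordinate and hence zero. Then \<open>R_expanding\<close> removes \<open>R\<close>, and the
      unit triangular shape of \<open>\<phi> 0 z\<close> removes the Weyl function, leaving
      \<open>b = 0\<close>.\<close>
    have inj: "b j = 0" if b: "\<And>i. k \<le> i \<Longrightarrow> i < m \<Longrightarrow> comb b i = 0" and j: "j < m - k" for b j
    proof -
      define v where "v i = (if k \<le> i then b (i - k) else 0)" for i
      have comb: "comb b i = mv m (\<lambda>i j. R t z $$ (i, j)) (mv m (\<lambda>i j. \<phi> 0 z $$ (i, j)) v) i" if i: "i < m" for i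
      proof -
        have "mv m (\<lambda>i j. R t z $$ (i, j)) (mv m (\<lambda>i j. \<phi> 0 z $$ (i, j)) v) i = (\<Sum>j<m. N i j * v j)"
          unfolding mv_mm[symmetric] using i by (simp add: mv_def[of m "mm m _ _"] N) (simp add: mm_def mv_def)
        also have "\<dots> = (\<Sum>j\<in>{k..<m}. N i j * v j)"
          by (intro sum.mono_neutral_right) (auto simp: v_def)
        also have "\<dots> = comb b i"
          unfolding comb_def using k
          by (intro sum.reindex_bij_witness[of _ "\<lambda>j. k + j" "\<lambda>j. j - k"]) (auto simp: v_def)
        finally show ?thesis by simp
      qed
      have "comb b i = 0" if "i < m" for i
        using subordinate_unique[OF imz k gap sub b that] .
      then have "sqn m (mv m (\<lambda>i j. R t z $$ (i, j)) (mv m (\<lambda>i j. \<phi> 0 z $$ (i, j)) v)) = 0"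
        using comb by (simp add: sqn_eq_0_iff)
      then have "sqn m (mv m (\<lambda>i j. \<phi> 0 z $$ (i, j)) v) = 0"
        using R_expanding[OF imz t, of "mv m (\<lambda>i j. \<phi> 0 z $$ (i, j)) v"] sqn_nonneg by (metis order_antisym)
      then have zero: "mv m (\<lambda>i j. \<phi> 0 z $$ (i, j)) v i = 0" if "i < m" for i
        using that unfolding sqn_eq_0_iff by blast
      have "v (k + j) = 0"
      proof (rule upper_triangular_injective[OF _ _ zero])
        show "\<phi> 0 z $$ (i, i) = 1" if "i < m" for i
          using norm[OF 0 z] that unfolding normalized_upper_triangular_def by blast
        show "\<phi> 0 z $$ (i, j) = 0" if "j < i" "i < m" for i j
          using norm[OF 0 z] that order.strict_trans unfolding normalized_upper_triangular_def by blast
      qed (use j in auto)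
      then show ?thesis by (simp add: v_def)
    qed
    obtain b where inv: "invertible_mat (psi_denominator m k (R t z) (\<phi> 0 z))"
      and low: "\<And>i. k \<le> i \<Longrightarrow> i < m \<Longrightarrow> comb b i = (if i = k then 1 else 0)"
      and up: "\<And>i. i < k \<Longrightarrow> (psi_breve m k (R t z) (\<phi> 0 z) *\<^sub>v unit_vec (m - k) 0) $ i = comb b i"
      and car: "psi_breve m k (R t z) (\<phi> 0 z) *\<^sub>v unit_vec (m - k) 0 \<in> carrier_vec k"
    proof (rule psi_breve_spec[OF R[OF t, of z] \<phi> k(2)])
      show "b j = 0" if "\<And>i. k \<le> i \<Longrightarrow> i < m \<Longrightarrow> (\<Sum>j<m - k. (R t z * \<phi> 0 z) $$ (i, k + j) * b j) = 0"
        "j < m - k" for b j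
        using inj[of b j] that unfolding comb_eq by blast
    qed (unfold comb_eq[symmetric], rule that)
    show "invertible_mat (psi_denominator m k (R t z) (\<phi> 0 z))" by (rule inv)
    \<comment> \<open>Both vectors are subordinate at level \<open>k\<close>, and from coordinate
      \<open>k\<close> on both read 1, 0, ..., 0: the combination by the choice of \<open>b\<close>,
      the Weyl column by normalization. Uniqueness then identifies the first \<open>k\<close>
      entries.\<close>
    have "comb b i - \<phi> t z $$ (i, k) = 0" if "i < m" for i
    proof (rule subordinate_unique[OF imz k gap, of "\<lambda>i. comb b i - \<phi> t z $$ (i, k)"])
      show "subordinate k z (\<lambda>i. comb b i - \<phi> t z $$ (i, k))"
        using weyl[OF t _ k(2)] by (intro subordinate_diff sub) simp
      show "comb b i - \<phi> t z $$ (i, k) = 0" if "k \<le> i" "i < m" for i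
        using low[OF that] norm[OF t z] that k by (auto simp: normalized_upper_triangular_def)
    qed (use that in auto)
    then show "Matrix.vec k (\<lambda>i. \<phi> t z $$ (i, k)) = psi_breve m k (R t z) (\<phi> 0 z) *\<^sub>v unit_vec (m - k) 0"
      using carrier_vecD[OF car] k by (intro eq_vecI) (auto simp: up simp del: index_mult_mat_vec dim_mult_mat_vec)
  qed
qed

end
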